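(* Let $\Omega$ be an arbitrary index set. Suppose $L : A_{\Omega} \rightarrow \mathbb{R}$ is linear and PSD and, for each $j \in \Omega$, the Carleman condition $$\sum_{k=1}^{\infty} \frac{1}{\sqrt[2k]{L(x_j^{2k})}} = \infty$$ holds. Then there exists a unique constructibly Radon measure $\nu$ on $\mathbb{R}^{\Omega}$ (with finite moments) such that $L = L_{\nu}$, i.e. $L(f)=\int\hat f\,d\nu$ for all $f\in A_\Omega$.
   Context: $A_\Omega=\mathbb{R}[x_i\mid i\in\Omega]$. $L$ is PSD if $L(f)\ge0$ for every finite sum of squares $f$ of elements of $A_\Omega$. For $f\in A_\Omega$, $\hat f:\mathbb{R}^\Omega\to\mathbb{R}$ is the evaluation function. In the Carleman condition, a term with $L(x_j^{2k})=0$ is interpreted as $+\infty$. For a commutative $\mathbb{R}$-algebra $D$ with $1$, $X(D)$ is the set of unital ring homomorphisms $\alpha:D\to\mathbb{R}$ with the weakest topology making all $\hat a:\alpha\mapsto\alpha(a)$, $a\in D$, continuous. A subset of $X(D)$ is constructibly Borel if it lies in the $\sigma$-algebra generated by the sets $\{\alpha\in X(D)\mid\alpha(a)>0\}$, $a\in D$. A Radon measure is a positive, locally finite, inner regular (with respect to compact sets) measure on the Borel $\sigma$-algebra. A constructibly Radon measure on $X(D)$ is a positive measure on the $\sigma$-algebra of constructibly Borel sets such that, for each countably generated subalgebra $D'$ of $D$, its pushforward to $X(D')$ via $\alpha\mapsto\alpha|_{D'}$ is Radon. $\mathbb{R}^\Omega$ is identified with $X(A_\Omega)$ via point evaluations.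 By convention, a constructibly Radon measure $\nu$ on $\mathbb{R}^\Omega$ is required to have finite moments: $\int \hat f\,d\nu$ is well-defined and finite for every monomial $f$ in the $x_i$. For such $\nu$, $L_\nu:A_\Omega\to\mathbb{R}$ is $L_\nu(f)=\int\hat f\,d\nu$. *)

theory Defs
  imports "HOL-Analysis.Analysis" "HOL-Analysis.Finite_Function_Topology"
begin

section \<open>Commutative real algebras and their real characters\<close>

instance poly_mapping :: (monoid_add, real_algebra) real_algebra
proof
  have lookup_scaleR: "Poly_Mapping.lookup (c *\<^sub>R x) m = c *\<^sub>R Poly_Mapping.lookup x m"
    for c :: real and x :: "'a \<Rightarrow>\<^sub>0 'b" and m
  proof -
    have "finite {i. c *\<^sub>R Poly_Mapping.lookup x i \<noteq> 0}"
      by (rule finite_subset [of _ "Poly_Mapping.keys x"]) (auto simp: in_keys_iff)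
    then show ?thesis
      by (simp add: scaleR_poly_mapping_def)
  qed
  fix c :: real and x y :: "'a \<Rightarrow>\<^sub>0 'b"
  have prod_fun_eq: "prod_fun f g k =
      (\<Sum>a\<in>A. f a * (\<Sum>b\<in>B. (g b when k = a + b)))"
    if "finite A" "finite B" "\<And>a. a \<notin> A \<Longrightarrow> f a = 0" "\<And>b. b \<notin> B \<Longrightarrow> g b = 0"
    for f g :: "'a \<Rightarrow> 'b" and k A B
  proof -
    have "Sum_any (\<lambda>b. g b when k = a + b) = (\<Sum>b\<in>B. (g b when k = a + b))" for a
      using that by (intro Sum_any.expand_superset) (auto simp: when_def)
    then show ?thesis
      unfolding prod_fun_def using that(1,3)
        by (subst Sum_any.expand_superset [of A]) (auto, metis mult_zero_left)
  qed
  let ?A = "Poly_Mapping.keys x" and ?B = "Poly_Mapping.keys y"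
  have lookup_times: "Poly_Mapping.lookup (u * v) k =
      (\<Sum>a\<in>?A. Poly_Mapping.lookup u a * (\<Sum>b\<in>?B. (Poly_Mapping.lookup v b when k = a + b)))"
    if "Poly_Mapping.keys u \<subseteq> ?A" "Poly_Mapping.keys v \<subseteq> ?B"
    for u v :: "'a \<Rightarrow>\<^sub>0 'b" and k
    unfolding times_poly_mapping.rep_eq
    using that by (intro prod_fun_eq) (auto simp: in_keys_iff)
  have keys_scaleR: "Poly_Mapping.keys (c *\<^sub>R u) \<subseteq> Poly_Mapping.keys u"
    for u :: "'a \<Rightarrow>\<^sub>0 'b"
    by (auto simp: in_keys_iff lookup_scaleR)
  show "(c *\<^sub>R x) * y = c *\<^sub>R (x * y)"
    by (rule poly_mapping_eqI)
      (simp add: lookup_scaleR lookup_times keys_scaleR scaleR_sum_right)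
  show "x * (c *\<^sub>R y) = c *\<^sub>R (x * y)"
    by (rule poly_mapping_eqI)
      (simp add: lookup_scaleR lookup_times keys_scaleR scaleR_sum_right sum_distrib_left
        when_def if_distrib cong: if_cong)
qed

instance poly_mapping :: (monoid_add, real_algebra_1) real_algebra_1 ..

text \<open>
  A commutative unital real algebra is given as a subalgebra \<open>D\<close> of a type of class
  \<open>comm_ring_1\<close> and \<open>real_algebra_1\<close>, so that subalgebras of \<open>D\<close> live on the same type.
\<close>

definition real_subalgebra :: "'a::{comm_ring_1,real_algebra_1} set \<Rightarrow> bool" where
  "real_subalgebra D \<longleftrightarrow> 1 \<in> D \<and>
     (\<forall>a\<in>D. \<forall>b\<in>D. a + b \<in> D \<and> a * b \<in> D) \<and> (\<forall>c. \<forall>a\<in>D. c *\<^sub>R a \<in> D)"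

text \<open>
  Characters are extensional functions (\<open>undefined\<close> outside \<open>D\<close>), so that
  each ring homomorphism on \<open>D\<close> is represented by exactly one HOL function.
\<close>

definition characters :: "'a::{comm_ring_1,real_algebra_1} set \<Rightarrow> ('a \<Rightarrow> real) set" where
  "characters D = {\<alpha> \<in> extensional D. \<alpha> 1 = 1 \<and>
     (\<forall>a\<in>D. \<forall>b\<in>D. \<alpha> (a + b) = \<alpha> a + \<alpha> b \<and> \<alpha> (a * b) = \<alpha> a * \<alpha> b)}"

definition character_topology ::
    "'a::{comm_ring_1,real_algebra_1} set \<Rightarrow> ('a \<Rightarrow> real) topology" where
  "character_topology D =
     topology_generated_by {{\<alpha> \<in> characters D. \<alpha> a \<in> U} | a U. a \<in> D \<and> open U}"

definition constructible_borel ::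
    "'a::{comm_ring_1,real_algebra_1} set \<Rightarrow> ('a \<Rightarrow> real) measure" where
  "constructible_borel D = sigma (characters D) {{\<alpha> \<in> characters D. \<alpha> a > 0} | a. a \<in> D}"


section \<open>Radon and constructibly Radon measures\<close>

definition borel_of :: "'a topology \<Rightarrow> 'a measure" where
  "borel_of T = sigma (topspace T) {U. openin T U}"

definition radon_measure :: "'a topology \<Rightarrow> 'a measure \<Rightarrow> bool" where
  "radon_measure T M \<longleftrightarrow> sets M = sets (borel_of T) \<and>
     (\<forall>x\<in>topspace T. \<exists>U. openin T U \<and> x \<in> U \<and> emeasure M U < \<infinity>) \<and>
     (\<forall>B\<in>sets M. emeasure M B = (SUP K\<in>{K. compactin T K \<and> K \<subseteq> B}. emeasure M K))"

text \<open>
  For a countably generated algebra \<open>D'\<close> the space of characters is second countable, its Borel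
  sets are exactly the constructibly Borel sets, and hence the restriction map used in the
  pushforward below is measurable.
\<close>

definition constructibly_radon ::
    "'a::{comm_ring_1,real_algebra_1} set \<Rightarrow> ('a \<Rightarrow> real) measure \<Rightarrow> bool" where
  "constructibly_radon D \<mu> \<longleftrightarrow> sets \<mu> = sets (constructible_borel D) \<and>
     (\<forall>C. countable C \<and> C \<subseteq> D \<longrightarrow>
       (let D' = real_subalgebra hull C; T = character_topology D' in
         radon_measure T (distr \<mu> (borel_of T) (\<lambda>\<alpha>. restrict \<alpha> D'))))"


section \<open>Polynomials in an arbitrary set of variables\<close>

text \<open>
  A polynomial maps monomials, i.e. finitely supported exponent functions, to coefficients.
  The index set \<open>\<Omega>\<close> is a set rather than a type, so that it may be empty.
\<close>

type_synonym 'i rpoly = "('i \<Rightarrow>\<^sub>0 nat) \<Rightarrow>\<^sub>0 real"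

definition poly_alg :: "'i set \<Rightarrow> 'i rpoly set" where
  "poly_alg \<Omega> = {f. \<forall>m\<in>Poly_Mapping.keys f. Poly_Mapping.keys m \<subseteq> \<Omega>}"

definition monomials :: "'i set \<Rightarrow> 'i rpoly set" where
  "monomials \<Omega> = {Poly_Mapping.single m 1 | m. Poly_Mapping.keys m \<subseteq> \<Omega>}"

definition poly_var :: "'i \<Rightarrow> 'i rpoly" where
  "poly_var i = Poly_Mapping.single (Poly_Mapping.single i 1) 1"

definition poly_eval :: "('i \<Rightarrow> real) \<Rightarrow> 'i rpoly \<Rightarrow> real" where
  "poly_eval x f = (\<Sum>m\<in>Poly_Mapping.keys f. Poly_Mapping.lookup f m *
     (\<Prod>i\<in>Poly_Mapping.keys m. x i ^ Poly_Mapping.lookup m i))"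

abbreviation real_power_space :: "'i set \<Rightarrow> ('i \<Rightarrow> real) set" where
  "real_power_space \<Omega> \<equiv> \<Omega> \<rightarrow>\<^sub>E UNIV"

definition point_character :: "'i set \<Rightarrow> ('i \<Rightarrow> real) \<Rightarrow> 'i rpoly \<Rightarrow> real" where
  "point_character \<Omega> x = restrict (poly_eval x) (poly_alg \<Omega>)"

text \<open>
  The bijection \<open>point_character \<Omega>\<close> from the power space onto the characters of
  \<open>poly_alg \<Omega>\<close> transports the constructibly Borel sets and the constructibly Radon measures
  to the power space. Finiteness of all moments is part of the notion there.
\<close>

definition constructibly_radon_power :: "'i set \<Rightarrow> ('i \<Rightarrow> real) measure \<Rightarrow> bool" where
  "constructibly_radon_power \<Omega> \<nu> \<longleftrightarrow>
     sets \<nu> = sets (vimage_algebra (real_power_space \<Omega>) (point_character \<Omega>)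
                      (constructible_borel (poly_alg \<Omega>))) \<and>
     constructibly_radon (poly_alg \<Omega>)
       (distr \<nu> (constructible_borel (poly_alg \<Omega>)) (point_character \<Omega>)) \<and>
     (\<forall>f\<in>monomials \<Omega>. integrable \<nu> (\<lambda>x. poly_eval x f))"

definition moment_functional :: "('i \<Rightarrow> real) measure \<Rightarrow> 'i rpoly \<Rightarrow> real" where
  "moment_functional \<nu> f = (\<integral>x. poly_eval x f \<partial>\<nu>)"


section \<open>Linear functionals on polynomials\<close>

definition linear_functional_on :: "'a::real_vector set \<Rightarrow> ('a \<Rightarrow> real) \<Rightarrow> bool" where
  "linear_functional_on A L \<longleftrightarrow>
     (\<forall>f\<in>A. \<forall>g\<in>A. L (f + g) = L f + L g) \<and> (\<forall>c. \<forall>f\<in>A. L (c *\<^sub>R f) = c * L f)"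

definition psd_on :: "'a::comm_ring_1 set \<Rightarrow> ('a \<Rightarrow> real) \<Rightarrow> bool" where
  "psd_on A L \<longleftrightarrow> (\<forall>gs. set gs \<subseteq> A \<longrightarrow> L (\<Sum>g\<leftarrow>gs. g ^ 2) \<ge> 0)"

text \<open>
  The sum starts at exponent \<open>2\<close>. Since it is taken in the extended nonnegative reals,
  where \<open>1 / 0 = \<infinity>\<close>, a vanishing moment contributes an infinite term.
\<close>

definition carleman :: "('i rpoly \<Rightarrow> real) \<Rightarrow> 'i \<Rightarrow> bool" where
  "carleman L j \<longleftrightarrow>
     suminf (\<lambda>k. 1 / ennreal (root (2 * Suc k) (L (poly_var j ^ (2 * Suc k))))) = \<infinity>"

end

theory Submission
  imports Defs "HOL-Probability.Probability" "HOL-Computational_Algebra.Fundamental_Theorem_Algebra"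
begin

text \<open>
  On the line Carleman's condition makes the moment problem determinate, by the quasi-analyticity of
  the Fourier transform. So for each variable \<open>x\<close> the numbers \<open>L (x\<^sup>k * q\<^sup>2)\<close> are the moments of
  exactly one measure, and integrating \<open>h\<close> against these measures gives a new functional \<open>h(x) L\<close>,
  which is again positive and satisfies Carleman's condition. By uniqueness on the line these
  operations commute for different variables, so indicators of half-lines can be applied for
  finitely many variables one after the other. The values at \<open>1\<close> are the finite-dimensional
  distributions of a \<open>0\<close>-\<open>1\<close>-valued process, and Kolmogorov's extension theorem gives a measure on
  the full power space. Its moments, and conversely the half-line values of any representing
  measure, are determined one variable at a time, again by uniqueness on the line. A finite measure
  is constructibly Radon because the characters of a countably generated algebra form a closed
  subset of a countable power of the real line, hence a Polish space.
\<close>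

section \<open>Carleman's inequality and quasi-analyticity\<close>

text \<open>In several variables a nonnegative polynomial need not be a sum of squares, so
  positivity of \<open>L\<close> on squares does not directly give positivity on all nonnegative
  polynomials. This forces the passage through one variable at a time, where squares suffice. The
  price is that positivity and Carleman's condition must survive every one-variable operation. They
  do because h(x) L is dominated on squares by W L for a single algebra element W: Cauchy-Schwarz
  bounds L(W x^(2k))^2 by L(W^2) L(x^(4k)), and log-convexity of the even moments makes up for the
  doubled exponent. Bits of half-lines replace the real values because the law of finitely many bits
  is a finite table, obtained by composing operations, and its consistency is the identity that two
  complementary indicators add up to 1. A coordinate is read back from its bits at rational levels,
  so only countably many null sets arise for each half-line.\<close>

lemma root_prod_le_mean:
  fixes x :: "'a \<Rightarrow> real"
  assumes fin: "finite A" "A \<noteq> {}" and pos: "\<And>i. i \<in> A \<Longrightarrow> 0 < x i"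
  shows "root (card A) (\<Prod>i\<in>A. x i) \<le> (\<Sum>i\<in>A. x i) / card A"
  using arith_geom_mean [of A x] fin pos prod_pos [of A x]
  by (simp add: root_powr_inverse card_gt_0_iff less_imp_le sum_divide_distrib)

text \<open>Carleman's inequality, with constant e. The arithmetic-geometric mean inequality is
  applied to c k * a k rather than to a k; the weights are chosen so that their product telescopes
  to (n + 2)^(n + 1), whose root is n + 2. Summing over n then leaves the factor c k / (k + 1),
  which is (1 + 1 / (k + 1))^(k + 1) and stays below e.\<close>

lemma carleman_inequality_summable:
  fixes a :: "nat \<Rightarrow> real"
  assumes pos: "\<And>n. 0 < a n" and sm: "summable a"
  shows "summable (\<lambda>n. root (Suc n) (\<Prod>k\<le>n. a k))"
proof -
  define c :: "nat \<Rightarrow> real" where "c k = real (k + 2) ^ (k + 1) / real (k + 1) ^ k" for k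
  define D where "D n = (\<Sum>k<n. c k * a k)" for n
  have c_pos: "0 < c k" for k unfolding c_def by simp
  have prod_c: "(\<Prod>k\<le>n. c k) = real (n + 2) ^ (n + 1)" for n
  proof (induction n)
    case (Suc n)
    then show ?case by (simp add: c_def)
  qed (simp add: c_def)
  have c_le: "c k / real (k + 1) \<le> exp 1" for k
  proof -
    have "c k / real (k + 1) = (1 + 1 / real (k + 1)) ^ (k + 1)"
      by (simp add: c_def field_simps)
    also have "\<dots> \<le> exp (1 / real (k + 1)) ^ (k + 1)"
      by (intro power_mono) (auto intro: exp_ge_add_one_self)
    also have "\<dots> = exp (real (k + 1) * (1 / real (k + 1)))"
      by (rule exp_of_nat_mult [symmetric])
    finally show ?thesis by simp
  qed
  have term_le: "root (Suc n) (\<Prod>k\<le>n. a k) \<le> D (Suc n) / (real (n + 1) * real (n + 2))" for n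
  proof -
    have "root (card {..n}) (\<Prod>k\<le>n. c k * a k) \<le> (\<Sum>k\<le>n. c k * a k) / card {..n}"
      by (rule root_prod_le_mean) (simp_all add: c_pos pos)
    moreover have "root (Suc n) (\<Prod>k\<le>n. c k * a k) = real (n + 2) * root (Suc n) (\<Prod>k\<le>n. a k)"
    proof -
      have "root (Suc n) (real (n + 2) ^ Suc n) = real (n + 2)"
        by (rule real_root_power_cancel) auto
      then show ?thesis
        by (simp add: prod.distrib prod_c real_root_mult)
    qed
    ultimately have "real (n + 2) * root (Suc n) (\<Prod>k\<le>n. a k) \<le> D (Suc n) / real (n + 1)"
      by (simp add: D_def lessThan_Suc_atMost)
    then have "root (Suc n) (\<Prod>k\<le>n. a k) \<le> D (Suc n) / real (n + 1) / real (n + 2)"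
      by (subst pos_le_divide_eq) (simp_all add: mult.commute)
    then show ?thesis by (simp only: divide_divide_eq_left)
  qed
  have D_pos: "0 \<le> D n" for n
    unfolding D_def by (intro sum_nonneg) (auto intro: less_imp_le mult_pos_pos c_pos pos)
  have partial: "(\<Sum>n<N. D (Suc n) / (real (n + 1) * real (n + 2))) + D N / real (N + 1)
      = (\<Sum>k<N. c k * a k / real (k + 1))" for N
  proof (induction N)
    case (Suc N)
    have "D (Suc N) / (real (N + 1) * real (N + 2)) + D (Suc N) / real (Suc N + 1) - D N / real (N + 1)
        = c N * a N / real (N + 1)"
    proof -
      have aux: "u / (x * (x + 1)) + u / (x + 1) = u / x" if "0 < x" for u x :: real
      proof -
        have "u / (x + 1) = (x * u) / (x * (x + 1))" using that by simp
        then have "u / (x * (x + 1)) + u / (x + 1) = (x + 1) * u / (x * (x + 1))"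
          by (simp only: add_divide_distrib [symmetric] distrib_right add.commute mult_1)
        also have "\<dots> = (x + 1) * u / ((x + 1) * x)" by (simp add: mult.commute)
        also have "\<dots> = u / x" using that by (subst mult_divide_mult_cancel_left) auto
        finally show ?thesis .
      qed
      from aux [of "real (N + 1)" "D (Suc N)"]
      have "D (Suc N) / (real (N + 1) * real (N + 2)) + D (Suc N) / real (Suc N + 1) = D (Suc N) / real (N + 1)"
        by (simp add: algebra_simps)
      then show ?thesis by (simp add: D_def add_divide_distrib)
    qed
    with Suc show ?case by simp
  qed (simp add: D_def)
  have "summable (\<lambda>n. D (Suc n) / (real (n + 1) * real (n + 2)))"
  proof (rule bounded_imp_summable)
    fix n
    have "(\<Sum>n\<le>n. D (Suc n) / (real (n + 1) * real (n + 2))) \<le> (\<Sum>k<Suc n. c k * a k / real (k + 1))"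
    proof -
      have "0 \<le> D (Suc n) / real (Suc n + 1)" by (intro divide_nonneg_nonneg D_pos) simp
      then show ?thesis using partial [of "Suc n"] unfolding lessThan_Suc_atMost by linarith
    qed
    also have "\<dots> \<le> (\<Sum>k<Suc n. exp 1 * a k)"
    proof (rule sum_mono)
      fix k
      have "(c k / real (k + 1)) * a k \<le> exp 1 * a k"
        by (intro mult_right_mono c_le less_imp_le pos)
      then show "c k * a k / real (k + 1) \<le> exp 1 * a k" by simp
    qed
    also have "\<dots> = exp 1 * (\<Sum>k<Suc n. a k)" by (rule sum_distrib_left [symmetric])
    also have "\<dots> \<le> exp 1 * suminf a"
      by (intro mult_left_mono sum_le_suminf sm) (auto intro: less_imp_le pos)
    finally show "(\<Sum>n\<le>n. D (Suc n) / (real (n + 1) * real (n + 2))) \<le> exp 1 * suminf a" .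
  qed (intro divide_nonneg_nonneg D_pos; simp)
  then show ?thesis
  proof (rule summable_comparison_test [rotated], intro exI allI impI)
    fix n
    have "0 \<le> root (Suc n) (\<Prod>k\<le>n. a k)"
      by (intro real_root_ge_zero prod_nonneg) (auto intro: less_imp_le pos)
    with term_le [of n] show "norm (root (Suc n) (\<Prod>k\<le>n. a k)) \<le> D (Suc n) / (real (n + 1) * real (n + 2))"
      by simp
  qed
qed

text \<open>Log-convexity makes the ratios of consecutive terms increase. Each of the
  \<open>k\<close> factors leading from \<open>M n\<close> to \<open>M (n + k)\<close> is therefore
  at most the ratio at \<open>N\<close>, the last one that can occur.\<close>

lemma log_convex_ratio:
  fixes M :: "nat \<Rightarrow> real"
  assumes pos: "\<And>n. 0 < M n" and lc: "\<And>n. (M (Suc n))\<^sup>2 \<le> M n * M (Suc (Suc n))"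
    and "n + k \<le> Suc N"
  shows "M (n + k) \<le> M n * (M (Suc N) / M N) ^ k"
proof -
  define r where "r n = M (Suc n) / M n" for n
  have "r n \<le> r (Suc n)" for n
    using lc [of n] pos [of n] pos [of "Suc n"] by (simp add: r_def field_simps power2_eq_square)
  then have mono: "i \<le> j \<Longrightarrow> r i \<le> r j" for i j
    by (rule lift_Suc_mono_le)
  have r_pos: "0 < r n" for n using pos by (simp add: r_def)
  show ?thesis
    using assms(3)
  proof (induction k)
    case (Suc k)
    have "M (n + Suc k) = M (n + k) * r (n + k)"
      using pos [of "n + k"] by (simp add: r_def)
    also have "\<dots> \<le> (M n * r N ^ k) * r N"
      using Suc mono [of "n + k" N]
      by (intro mult_mono) (auto simp: r_def intro!: less_imp_le [OF pos] mult_nonneg_nonneg divide_nonneg_nonneg zero_le_power)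
    finally show ?case by (simp add: r_def ac_simps)
  qed simp
qed

text \<open>
  Bang's argument: on an interval of length \<open>M N / (e * M (N + 1))\<close> the normalised bound
  \<open>exp (-(N + 1))\<close> on the first \<open>N + 1\<close> derivatives deteriorates only to \<open>exp (-N)\<close>.
\<close>

lemma bang_quasianalytic:
  fixes f :: "nat \<Rightarrow> real \<Rightarrow> complex" and M :: "nat \<Rightarrow> real"
  assumes pos: "\<And>n. 0 < M n" and lc: "\<And>n. (M (Suc n))\<^sup>2 \<le> M n * M (Suc (Suc n))"
    and taylor: "\<And>n m t h. cmod (f n (t + h) - (\<Sum>k<m. f (n + k) t * of_real (h ^ k / fact k)))
        \<le> M (n + m) * \<bar>h\<bar> ^ m / fact m"
    and zero: "\<And>n. f n 0 = 0"
    and div: "\<not> summable (\<lambda>n. M n / M (Suc n))"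
  shows "f 0 t = 0"
proof -
  define e :: real where "e = exp 1"
  have e: "0 < e" by (simp add: e_def)
  define Bd where "Bd N b t \<longleftrightarrow> (\<forall>n<N. cmod (f n t) \<le> b * e ^ n * M n)" for N b t
  have step: "Bd (Suc N) (b * exp (e * \<bar>h\<bar> * (M (Suc N) / M N))) (t + h)"
    if Bd: "Bd (Suc N) b t" and b: "1 / e ^ Suc N \<le> b" for N b t h
    unfolding Bd_def
  proof (intro allI impI)
    fix n assume n: "n < Suc N"
    define m where "m = Suc N - n"
    define \<rho> where "\<rho> = M (Suc N) / M N"
    have \<rho>: "0 < \<rho>" using pos by (simp add: \<rho>_def)
    have b0: "0 < b" by (rule less_le_trans [OF _ b]) (use e in auto)
    have M_le: "M (n + k) \<le> M n * \<rho> ^ k" if "k \<le> m" for k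
      unfolding \<rho>_def using that n by (intro log_convex_ratio pos lc) (auto simp: m_def)
    have nm: "n + m = Suc N" using n by (simp add: m_def)
    let ?g = "\<lambda>k. b * e ^ (n + k) * M (n + k) * \<bar>h\<bar> ^ k / fact k"
    have "cmod (f n (t + h)) \<le> cmod (\<Sum>k<m. f (n + k) t * of_real (h ^ k / fact k))
        + M (n + m) * \<bar>h\<bar> ^ m / fact m"
      using taylor [of n t h m] norm_triangle_sub [of "f n (t + h)"]
      by (smt (verit, best))
    also have "cmod (\<Sum>k<m. f (n + k) t * of_real (h ^ k / fact k)) \<le> (\<Sum>k<m. ?g k)"
    proof (rule sum_norm_le)
      fix k assume "k \<in> {..<m}"
      then have "cmod (f (n + k) t) \<le> b * e ^ (n + k) * M (n + k)"
        using Bd n by (simp add: Bd_def m_def)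
      then have "cmod (f (n + k) t) * (\<bar>h\<bar> ^ k / fact k) \<le> b * e ^ (n + k) * M (n + k) * (\<bar>h\<bar> ^ k / fact k)"
        by (rule mult_right_mono) simp
      then show "cmod (f (n + k) t * of_real (h ^ k / fact k)) \<le> ?g k"
        by (simp add: norm_mult norm_divide norm_power power_abs)
    qed
    \<comment> \<open>The hypothesis on \<open>t\<close> is silent about order \<open>Suc N\<close>.
      There the Taylor remainder carries the bare constant \<open>M (Suc N)\<close>, and b \<ge>
      e^(-(N + 1)) makes it fit the pattern of the other terms.\<close>
    also have "M (n + m) * \<bar>h\<bar> ^ m / fact m \<le> ?g m"
    proof -
      have "1 \<le> b * e ^ Suc N" using b e by (simp add: field_simps)
      then have "1 * (M (n + m) * \<bar>h\<bar> ^ m / fact m) \<le> b * e ^ Suc N * (M (n + m) * \<bar>h\<bar> ^ m / fact m)"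
        by (intro mult_right_mono) (auto intro!: divide_nonneg_nonneg mult_nonneg_nonneg less_imp_le [OF pos])
      then show ?thesis using nm by simp
    qed
    also have "(\<Sum>k<m. ?g k) + ?g m = (\<Sum>k\<le>m. ?g k)"
      by (simp add: lessThan_Suc_atMost [symmetric])
    also have "\<dots> \<le> (\<Sum>k\<le>m. b * e ^ n * M n * ((e * \<bar>h\<bar> * \<rho>) ^ k / fact k))"
    proof (rule sum_mono)
      fix k assume "k \<in> {..m}"
      then have "b * e ^ (n + k) * \<bar>h\<bar> ^ k / fact k * M (n + k) \<le> b * e ^ (n + k) * \<bar>h\<bar> ^ k / fact k * (M n * \<rho> ^ k)"
        using b0 e by (intro mult_left_mono M_le) auto
      then show "?g k \<le> b * e ^ n * M n * ((e * \<bar>h\<bar> * \<rho>) ^ k / fact k)"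
        by (simp add: power_add power_mult_distrib mult_ac)
    qed
    also have "\<dots> = b * e ^ n * M n * (\<Sum>k\<le>m. (e * \<bar>h\<bar> * \<rho>) ^ k / fact k)"
      by (simp add: sum_distrib_left)
    also have "\<dots> \<le> b * e ^ n * M n * exp (e * \<bar>h\<bar> * \<rho>)"
    proof (rule mult_left_mono)
      have "(\<Sum>k<Suc m. (e * \<bar>h\<bar> * \<rho>) ^ k / fact k) \<le> suminf (\<lambda>k. (e * \<bar>h\<bar> * \<rho>) ^ k / fact k)"
        using e \<rho> summable_exp [of "e * \<bar>h\<bar> * \<rho>"]
        by (intro sum_le_suminf) (auto simp: divide_inverse mult.commute)
      then show "(\<Sum>k\<le>m. (e * \<bar>h\<bar> * \<rho>) ^ k / fact k) \<le> exp (e * \<bar>h\<bar> * \<rho>)"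
        by (simp add: lessThan_Suc_atMost exp_def divide_inverse mult.commute)
    qed (use b0 e pos [of n] in \<open>auto intro!: mult_nonneg_nonneg less_imp_le [OF pos]\<close>)
    finally show "cmod (f n (t + h)) \<le> b * exp (e * \<bar>h\<bar> * (M (Suc N) / M N)) * e ^ n * M n"
      by (simp add: \<rho>_def mult_ac)
  qed
  define Q where "Q N s \<longleftrightarrow> (\<forall>t. \<bar>t\<bar> \<le> s \<longrightarrow> Bd N (1 / e ^ N) t)" for N s
  define a where "a n = M n / M (Suc n)" for n
  have a_pos: "0 < a n" for n using pos by (simp add: a_def)
  have Q_step: "Q N (s + a N / e)" if Q: "Q (Suc N) s" and s: "0 \<le> s" for N s
    unfolding Q_def
  proof (intro allI impI)
    fix t assume t: "\<bar>t\<bar> \<le> s + a N / e"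
    \<comment> \<open>The projection of \<open>t\<close> to the interval of radius \<open>s\<close>.
      A Taylor step of length at most \<open>a N / e\<close> leads from it to
      \<open>t\<close>.\<close>
    define t' where "t' = (if \<bar>t\<bar> \<le> s then t else sgn t * s)"
    have t': "\<bar>t'\<bar> \<le> s" using s by (auto simp: t'_def abs_mult sgn_if)
    have h: "\<bar>t - t'\<bar> \<le> a N / e"
      using t s a_pos [of N] e by (auto simp: t'_def sgn_if abs_if split: if_splits)
    have "Bd (Suc N) (1 / e ^ Suc N) t'" using Q t' by (simp add: Q_def)
    then have "Bd (Suc N) (1 / e ^ Suc N * exp (e * \<bar>t - t'\<bar> * (M (Suc N) / M N))) (t' + (t - t'))"
      by (rule step) simp
    moreover have "1 / e ^ Suc N * exp (e * \<bar>t - t'\<bar> * (M (Suc N) / M N)) \<le> 1 / e ^ N"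
    proof -
      have "e * \<bar>t - t'\<bar> * (M (Suc N) / M N) \<le> 1"
        using h e pos [of N] pos [of "Suc N"] by (simp add: a_def field_simps)
      then have "exp (e * \<bar>t - t'\<bar> * (M (Suc N) / M N)) \<le> e" by (simp add: e_def)
      then have "1 / e ^ Suc N * exp (e * \<bar>t - t'\<bar> * (M (Suc N) / M N)) \<le> 1 / e ^ Suc N * e"
        using e by (intro mult_left_mono) auto
      then show ?thesis using e by simp
    qed
    ultimately show "Bd N (1 / e ^ N) t"
      unfolding Bd_def using e pos
      by (smt (verit, best) add_diff_cancel_left' add.commute diff_add_cancel less_Suc_eq mult_right_mono zero_le_power)
  qed
  \<comment> \<open>At the origin all derivatives vanish, so the bound holds there at level
    \<open>m + d\<close>. Each of the \<open>d\<close> steps down gives up one order and gains an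
    interval of length \<open>a (m + i) / e\<close>.\<close>
  have "Q m (\<Sum>i<d. a (m + i) / e)" for m d
  proof (induction d arbitrary: m)
    case 0
    then show ?case
      using e pos by (auto simp: Q_def Bd_def zero intro!: mult_nonneg_nonneg divide_nonneg_nonneg less_imp_le [OF pos])
  next
    case (Suc d)
    have "Q m ((\<Sum>i<d. a (Suc m + i) / e) + a m / e)"
      by (intro Q_step Suc sum_nonneg) (auto intro!: less_imp_le [OF a_pos] divide_nonneg_nonneg less_imp_le [OF e])
    then show ?case by (simp only: sum.lessThan_Suc_shift) (simp add: add.commute)
  qed
  then have Bd0: "Bd m (1 / e ^ m) t" if "\<bar>t\<bar> \<le> (\<Sum>i<d. a (m + i) / e)" for m d
    using that by (auto simp: Q_def)
  \<comment> \<open>Level \<open>Suc m\<close> rather than \<open>m\<close>: \<open>Bd m\<close>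
    controls only orders below \<open>m\<close>, and order 0 has to be among them. Since every tail
    of the series of ratios diverges, finitely many steps reach \<open>t\<close>.\<close>
  have "cmod (f 0 t) \<le> M 0 * (1 / e) ^ Suc m" for m
  proof -
    have "\<exists>d. \<bar>t\<bar> \<le> (\<Sum>i<d. a (Suc m + i) / e)"
    proof (rule ccontr)
      assume "\<not> ?thesis"
      then have *: "(\<Sum>i<d. a (Suc m + i) / e) \<le> \<bar>t\<bar>" for d by (meson linear)
      have "summable (\<lambda>i. a (Suc m + i) / e)"
        using * [of "Suc _"] a_pos e
        by (intro bounded_imp_summable [where B = "\<bar>t\<bar>"]) (auto simp: lessThan_Suc_atMost intro: less_imp_le)
      then have "summable (\<lambda>i. a (i + Suc m))"
        using e summable_mult [of "\<lambda>i. a (Suc m + i) / e" e] by (simp add: add.commute)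
      then have "summable a" by (simp only: summable_iff_shift)
      with div show False by (simp add: a_def [abs_def])
    qed
    then obtain d where "\<bar>t\<bar> \<le> (\<Sum>i<d. a (Suc m + i) / e)" ..
    from Bd0 [OF this] show ?thesis by (auto simp: Bd_def power_one_over mult.commute)
  qed
  moreover have "(\<lambda>m. M 0 * (1 / e) ^ Suc m) \<longlonglongrightarrow> M 0 * 0"
    by (intro tendsto_mult tendsto_const LIMSEQ_Suc LIMSEQ_realpow_zero) (use e in \<open>auto simp: e_def\<close>)
  ultimately have "cmod (f 0 t) \<le> M 0 * 0"
    by (intro LIMSEQ_le_const [of _ "M 0 * 0"]) auto
  then show ?thesis by simp
qed

section \<open>Determinacy of the moment problem on the line\<close>

definition has_moments :: "real measure \<Rightarrow> (nat \<Rightarrow> real) \<Rightarrow> bool" where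
  "has_moments \<mu> s \<longleftrightarrow> sets \<mu> = sets borel \<and> finite_measure \<mu> \<and>
     (\<forall>k. integrable \<mu> (\<lambda>t. t ^ k) \<and> (\<integral>t. t ^ k \<partial>\<mu>) = s k)"

definition carleman_seq :: "(nat \<Rightarrow> real) \<Rightarrow> bool" where
  "carleman_seq s \<longleftrightarrow> suminf (\<lambda>k. 1 / ennreal (root (2 * Suc k) (s (2 * Suc k)))) = \<infinity>"

section \<open>Fourier transforms of measures with moments\<close>

lemma integrable_abs_power:
  assumes "has_moments \<mu> s"
  shows "integrable \<mu> (\<lambda>t. \<bar>t\<bar> ^ k)"
  using assms integrable_abs [of \<mu> "\<lambda>t. t ^ k"] by (simp add: has_moments_def power_abs)

lemma iexp_taylor:
  "cmod (iexp x - (\<Sum>k<m. (\<i> * of_real x) ^ k / fact k)) \<le> \<bar>x\<bar> ^ m / fact m"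
proof (cases m)
  case (Suc n)
  then show ?thesis using iexp_approx1 [of x n] by (simp add: lessThan_Suc_atMost)
qed simp

text \<open>The \<open>n\<close>-th derivative of the Fourier transform, written as an integral. The
  quasi-analyticity argument asks only for Taylor estimates between these functions, so no
  derivative is ever taken.\<close>

definition fourier_moment :: "real measure \<Rightarrow> nat \<Rightarrow> real \<Rightarrow> complex" where
  "fourier_moment \<mu> n t = (CLINT x|\<mu>. (\<i> * of_real x) ^ n * iexp (t * x))"

lemma integrable_fourier_moment:
  assumes "has_moments \<mu> s"
  shows "integrable \<mu> (\<lambda>x. (\<i> * complex_of_real x) ^ n * iexp (t * x))"
proof (rule Bochner_Integration.integrable_bound [OF integrable_abs_power [OF assms, of n]])
  have [measurable_cong]: "sets \<mu> = sets borel" using assms by (simp add: has_moments_def)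
  show "(\<lambda>x. (\<i> * complex_of_real x) ^ n * iexp (t * x)) \<in> borel_measurable \<mu>" by measurable
qed (simp add: norm_mult norm_power)

text \<open>Under the integral sign the difference is the Taylor remainder of the exponential times
  a factor of modulus |x|^n, so the pointwise estimate integrates to an absolute moment of order
  \<open>n + m\<close>.\<close>

lemma fourier_moment_taylor:
  assumes mu: "has_moments \<mu> s"
  shows "cmod (fourier_moment \<mu> n (t + h) - (\<Sum>k<m. fourier_moment \<mu> (n + k) t * of_real (h ^ k / fact k)))
    \<le> (\<integral>x. \<bar>x\<bar> ^ (n + m) \<partial>\<mu>) * \<bar>h\<bar> ^ m / fact m"
proof -
  note int [simp, intro] = integrable_fourier_moment [OF mu]
  let ?g = "\<lambda>n t x. (\<i> * complex_of_real x) ^ n * iexp (t * x)"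
  define D where "D x = ?g n (t + h) x - (\<Sum>k<m. ?g (n + k) t x * of_real (h ^ k / fact k))" for x
  have int_sum: "integrable \<mu> (\<lambda>x. \<Sum>k<m. ?g (n + k) t x * of_real (h ^ k / fact k))"
    by (rule Bochner_Integration.integrable_sum) (rule integrable_mult_left, rule int)
  have int_D: "integrable \<mu> D"
    unfolding D_def by (rule Bochner_Integration.integrable_diff [OF int int_sum])
  have D_eq: "D x = ?g n t x * (iexp (h * x) - (\<Sum>k<m. (\<i> * of_real (h * x)) ^ k / fact k))" for x
  proof -
    have "iexp ((t + h) * x) = iexp (t * x) * iexp (h * x)"
      by (simp add: exp_add [symmetric] ring_distribs)
    moreover have "?g (n + k) t x * of_real (h ^ k / fact k)
        = ?g n t x * ((\<i> * of_real (h * x)) ^ k / fact k)" for k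
      by (simp add: power_add power_mult_distrib)
    ultimately show ?thesis
      unfolding D_def by (simp only: right_diff_distrib sum_distrib_left mult.assoc)
  qed
  have D_le: "cmod (D x) \<le> \<bar>x\<bar> ^ (n + m) * (\<bar>h\<bar> ^ m / fact m)" for x
  proof -
    have "cmod (D x) = \<bar>x\<bar> ^ n * cmod (iexp (h * x) - (\<Sum>k<m. (\<i> * of_real (h * x)) ^ k / fact k))"
      unfolding D_eq norm_mult by (simp add: norm_mult norm_power)
    also have "\<dots> \<le> \<bar>x\<bar> ^ n * (\<bar>h * x\<bar> ^ m / fact m)"
      by (intro mult_left_mono iexp_taylor) simp
    finally show ?thesis by (simp add: abs_mult power_mult_distrib power_add mult_ac)
  qed
  have "fourier_moment \<mu> (n + k) t * of_real (h ^ k / fact k)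
      = (CLINT x|\<mu>. ?g (n + k) t x * of_real (h ^ k / fact k))" for k
    unfolding fourier_moment_def by (rule integral_mult_left_zero [symmetric])
  then have "(\<Sum>k<m. fourier_moment \<mu> (n + k) t * of_real (h ^ k / fact k))
      = (CLINT x|\<mu>. \<Sum>k<m. ?g (n + k) t x * of_real (h ^ k / fact k))"
    by (subst Bochner_Integration.integral_sum) (rule integrable_mult_left, rule int, simp only:)
  then have "fourier_moment \<mu> n (t + h) - (\<Sum>k<m. fourier_moment \<mu> (n + k) t * of_real (h ^ k / fact k))
      = integral\<^sup>L \<mu> D"
    unfolding D_def by (subst Bochner_Integration.integral_diff [OF int int_sum]) (simp only: fourier_moment_def)
  then have "cmod (fourier_moment \<mu> n (t + h) - (\<Sum>k<m. fourier_moment \<mu> (n + k) t * of_real (h ^ k / fact k)))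
      \<le> (\<integral>x. cmod (D x) \<partial>\<mu>)"
    using integral_norm_bound [of \<mu> D] by (simp only:)
  also have "\<dots> \<le> (\<integral>x. \<bar>x\<bar> ^ (n + m) * (\<bar>h\<bar> ^ m / fact m) \<partial>\<mu>)"
    by (rule integral_mono [OF integrable_norm [OF int_D] integrable_mult_left D_le])
      (rule integrable_abs_power [OF mu])
  finally show ?thesis by simp
qed

text \<open>The summand \<open>1\<close> (the moments of a point mass at \<open>1\<close>) keeps the sequence positive.\<close>

definition majorant :: "real measure \<Rightarrow> real measure \<Rightarrow> nat \<Rightarrow> real" where
  "majorant \<mu> \<nu> n = 1 + (\<integral>x. \<bar>x\<bar> ^ n \<partial>\<mu>) + (\<integral>x. \<bar>x\<bar> ^ n \<partial>\<nu>)"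

lemma majorant_ge_1: "1 \<le> majorant \<mu> \<nu> n"
  by (simp add: majorant_def)

text \<open>Each of the three summands of \<open>majorant\<close> contributes a nonnegative
  quadratic in \<open>l\<close>: the integral of |x|^n (l - |x|)^2 for either measure, and (l - 1)^2
  for the constant 1. Their sum is evaluated at its minimiser.\<close>

lemma majorant_log_convex:
  assumes mu: "has_moments \<mu> s" and nu: "has_moments \<nu> s'"
  shows "(majorant \<mu> \<nu> (Suc n))\<^sup>2 \<le> majorant \<mu> \<nu> n * majorant \<mu> \<nu> (Suc (Suc n))"
proof -
  let ?M = "majorant \<mu> \<nu>"
  have quad: "0 \<le> l\<^sup>2 * (\<integral>x. \<bar>x\<bar> ^ n \<partial>\<rho>) - 2 * l * (\<integral>x. \<bar>x\<bar> ^ Suc n \<partial>\<rho>) + (\<integral>x. \<bar>x\<bar> ^ Suc (Suc n) \<partial>\<rho>)"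
    if rho: "has_moments \<rho> r" for \<rho> r and l :: real
  proof -
    note [simp, intro] = integrable_abs_power [OF rho]
    have "0 \<le> (\<integral>x. \<bar>x\<bar> ^ n * (l - \<bar>x\<bar>)\<^sup>2 \<partial>\<rho>)" by (intro Bochner_Integration.integral_nonneg) auto
    also have "\<dots> = (\<integral>x. l\<^sup>2 * \<bar>x\<bar> ^ n - 2 * l * \<bar>x\<bar> ^ Suc n + \<bar>x\<bar> ^ Suc (Suc n) \<partial>\<rho>)"
      by (rule Bochner_Integration.integral_cong) (auto simp: power2_eq_square algebra_simps)
    also have "\<dots> = l\<^sup>2 * (\<integral>x. \<bar>x\<bar> ^ n \<partial>\<rho>) - 2 * l * (\<integral>x. \<bar>x\<bar> ^ Suc n \<partial>\<rho>) + (\<integral>x. \<bar>x\<bar> ^ Suc (Suc n) \<partial>\<rho>)"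
      by (simp del: power_Suc)
    finally show ?thesis .
  qed
  define l where "l = ?M (Suc n) / ?M n"
  have "0 \<le> l\<^sup>2 * ?M n - 2 * l * ?M (Suc n) + ?M (Suc (Suc n))"
    using quad [OF mu, of l] quad [OF nu, of l] zero_le_power2 [of "l - 1"]
    by (simp add: majorant_def algebra_simps power2_eq_square)
  moreover have l: "l * ?M n = ?M (Suc n)"
    using majorant_ge_1 [of \<mu> \<nu> n] by (simp add: l_def)
  ultimately have "0 \<le> ?M (Suc (Suc n)) - l * ?M (Suc n)"
    by (simp add: power2_eq_square mult.assoc)
  then have "0 \<le> ?M n * (?M (Suc (Suc n)) - l * ?M (Suc n))"
    using majorant_ge_1 [of \<mu> \<nu> n] by (intro mult_nonneg_nonneg) auto
  also have "\<dots> = ?M n * ?M (Suc (Suc n)) - (l * ?M n) * ?M (Suc n)"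
    by (simp add: right_diff_distrib)
  finally show ?thesis by (simp add: l power2_eq_square)
qed

text \<open>A vanishing even moment concentrates the measure at the origin. This settles the case in
  which Carleman's condition holds because of a term 1 / 0.\<close>

lemma carleman_seq_vanish:
  assumes mu: "has_moments \<mu> s" and k: "0 < k" "s (2 * k) = 0" and l: "0 < l"
  shows "s l = 0"
proof -
  have "AE t in \<mu>. t ^ (2 * k) = 0"
    using mu k by (subst integral_nonneg_eq_0_iff_AE [symmetric]) (auto simp: has_moments_def)
  then have "AE t in \<mu>. t ^ l = 0"
    by eventually_elim (use k l in auto)
  then have "(\<integral>t. t ^ l \<partial>\<mu>) = 0" by (rule integral_eq_zero_AE)
  then show ?thesis using mu by (simp add: has_moments_def)
qed

text \<open>The converse use of Carleman's inequality: the products of the ratios telescope, so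
  summable ratios would make the roots of \<open>majorant 0 / majorant (Suc n)\<close> summable. At
  even orders these roots dominate a constant multiple of the terms of Carleman's series.\<close>

lemma majorant_not_summable:
  assumes mu: "has_moments \<mu> s" and nu: "has_moments \<nu> s" and carl: "carleman_seq s"
  shows "\<not> summable (\<lambda>n. majorant \<mu> \<nu> n / majorant \<mu> \<nu> (Suc n))"
proof
  let ?M = "majorant \<mu> \<nu>"
  have M: "1 \<le> ?M n" "0 < ?M n" for n using majorant_ge_1 [of \<mu> \<nu> n] by auto
  assume "summable (\<lambda>n. ?M n / ?M (Suc n))"
  then have "summable (\<lambda>n. root (Suc n) (\<Prod>k\<le>n. ?M k / ?M (Suc k)))"
    by (intro carleman_inequality_summable) (use M in auto)
  moreover have "(\<Prod>k\<le>n. ?M k / ?M (Suc k)) = ?M 0 / ?M (Suc n)" for n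
  proof (induction n)
    case (Suc n)
    then show ?case using M(2) [of "Suc n"] by simp
  qed simp
  ultimately have sm: "summable (\<lambda>n. root (Suc n) (?M 0 / ?M (Suc n)))" by simp
  define r where "r k = root (2 * Suc k) (s (2 * Suc k))" for k
  have s_nonneg: "0 \<le> s (2 * k)" for k
  proof -
    have "0 \<le> (\<integral>t. t ^ (2 * k) \<partial>\<mu>)" by (intro Bochner_Integration.integral_nonneg) simp
    also have "\<dots> = s (2 * k)" using mu by (simp only: has_moments_def)
    finally show ?thesis .
  qed
  have r_nonneg: "0 \<le> r k" for k unfolding r_def by (rule real_root_ge_zero [OF s_nonneg])
  have M_eq: "?M (2 * k) = 1 + 2 * s (2 * k)" for k
    using mu nu by (simp add: majorant_def has_moments_def power_even_abs)
  \<comment> \<open>The constant 3 comes from 1 + 2 s(2k) \<le> 3 max(1, r)^(2k). It is enlarged to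
    a power of 3 so that the root can be taken; the maximum with 1 absorbs the summand 1 of
    \<open>majorant\<close>.\<close>
  have le: "1 / (3 * max 1 (r k)) \<le> root (Suc (2 * k + 1)) (?M 0 / ?M (Suc (2 * k + 1)))" for k
  proof -
    let ?q = "3 * max 1 (r k)"
    have "s (2 * Suc k) = r k ^ (2 * Suc k)"
      unfolding r_def by (rule real_root_pow_pos2 [symmetric]) (simp, rule s_nonneg)
    also have "\<dots> \<le> (max 1 (r k)) ^ (2 * Suc k)" by (intro power_mono r_nonneg) auto
    finally have "?M (2 * Suc k) \<le> 3 * (max 1 (r k)) ^ (2 * Suc k)"
      unfolding M_eq using one_le_power [of "max 1 (r k)" "2 * Suc k"] by linarith
    also have "\<dots> \<le> 3 ^ (2 * Suc k) * (max 1 (r k)) ^ (2 * Suc k)"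
      using power_increasing [of 1 "2 * Suc k" "3::real"] by (intro mult_right_mono) auto
    finally have "?M (2 * Suc k) \<le> ?q ^ (2 * Suc k)" by (simp only: power_mult_distrib)
    then have "root (2 * Suc k) (?M (2 * Suc k)) \<le> root (2 * Suc k) (?q ^ (2 * Suc k))"
      by (subst real_root_le_iff) auto
    also have "\<dots> = ?q" by (rule real_root_power_cancel) auto
    finally have "root (2 * Suc k) (?M (2 * Suc k)) \<le> ?q" .
    moreover have "0 < root (2 * Suc k) (?M (2 * Suc k))" by (rule real_root_gt_zero) (use M in auto)
    ultimately have "1 / ?q \<le> 1 / root (2 * Suc k) (?M (2 * Suc k))"
      by (intro divide_left_mono) auto
    also have "\<dots> = root (2 * Suc k) (1 / ?M (2 * Suc k))" by (simp add: real_root_divide)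
    also have "\<dots> \<le> root (2 * Suc k) (?M 0 / ?M (2 * Suc k))"
      using M (1) [of 0] M (2) [of "2 * Suc k"]
      by (subst real_root_le_iff) (auto intro: divide_right_mono)
    finally show ?thesis by simp
  qed
  have sm2: "summable (\<lambda>k. root (Suc (2 * k + 1)) (?M 0 / ?M (Suc (2 * k + 1))))"
    using summable_reindex [OF sm, of "\<lambda>k. 2 * k + 1"] M
    by (auto simp: inj_on_def o_def intro!: real_root_ge_zero divide_nonneg_nonneg less_imp_le [OF M (2)])
  have "summable (\<lambda>k. 1 / (3 * max 1 (r k)))"
    by (rule summable_comparison_test' [OF sm2, where N = 0]) (use le in auto)
  then have sm': "summable (\<lambda>k. 1 / max 1 (r k))"
    using summable_mult [of "\<lambda>k. 1 / (3 * max 1 (r k))" 3] by simp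
  \<comment> \<open>A single zero would make every \<open>r l\<close> vanish, and the summable
    series would then consist of ones.\<close>
  have r_ne: "r k \<noteq> 0" for k
  proof
    assume "r k = 0"
    then have "s (2 * Suc k) = 0" by (simp add: r_def)
    then have "s (2 * Suc l) = 0" for l
      using carleman_seq_vanish [OF mu, of "Suc k" "2 * Suc l"] by simp
    then have "r l = 0" for l by (simp add: r_def)
    with sm' show False by (simp add: summable_const_iff)
  qed
  \<comment> \<open>The terms tend to 0, so eventually \<open>r k\<close> exceeds 1 and the maximum
    can be removed.\<close>
  from summable_LIMSEQ_zero [OF sm'] have "eventually (\<lambda>k. 1 / max 1 (r k) < 1) sequentially"
    by (rule order_tendstoD) auto
  then have ev: "eventually (\<lambda>k. norm (1 / r k) \<le> 1 / max 1 (r k)) sequentially"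
    by eventually_elim (auto simp: max_def split: if_splits)
  have "summable (\<lambda>k. 1 / r k)"
    by (rule summable_comparison_test_ev [OF ev sm'])
  then have "suminf (\<lambda>k. ennreal (1 / r k)) = ennreal (suminf (\<lambda>k. 1 / r k))"
    using r_nonneg by (intro suminf_ennreal_eq summable_sums) auto
  moreover have *: "1 / ennreal (r k) = ennreal (1 / r k)" for k
    using r_nonneg [of k] r_ne [of k] divide_ennreal [of 1 "r k"] by simp
  have "suminf (\<lambda>k. ennreal (1 / r k)) = \<infinity>"
    using carl unfolding carleman_seq_def r_def [symmetric] * .
  ultimately have "ennreal (suminf (\<lambda>k. 1 / r k)) = \<infinity>" by (rule trans [OF sym])
  then show False by (metis ennreal_neq_top infinity_ennreal_def)
qed

text \<open>Levy's uniqueness theorem for finite measures: the total mass is the value of the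
  transform at 0, so both measures are rescaled by the same factor to probability measures. Mass
  zero admits no rescaling and is treated apart.\<close>

lemma finite_measure_eqI_char:
  assumes mu: "sets \<mu> = sets (borel :: real measure)" "finite_measure \<mu>"
    and nu: "sets \<nu> = sets (borel :: real measure)" "finite_measure \<nu>"
    and char: "char \<mu> = char \<nu>"
  shows "\<mu> = \<nu>"
proof -
  interpret mu: finite_measure \<mu> by fact
  interpret nu: finite_measure \<nu> by fact
  have sp: "space \<mu> = UNIV" "space \<nu> = UNIV"
    using mu(1) nu(1) by (auto dest: sets_eq_imp_space_eq)
  define c where "c = measure \<mu> UNIV"
  have "char \<mu> 0 = char \<nu> 0" using char by simp
  then have c: "measure \<nu> UNIV = c"
    by (simp add: char_def c_def sp)
  have em: "emeasure \<mu> UNIV = ennreal c" "emeasure \<nu> UNIV = ennreal c"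
    by (simp_all add: mu.emeasure_eq_measure nu.emeasure_eq_measure c c_def)
  show ?thesis
  proof (cases "c = 0")
    case True
    have "emeasure \<mu> A = emeasure \<nu> A" if "A \<in> sets \<mu>" for A
    proof -
      have "emeasure \<mu> A \<le> emeasure \<mu> UNIV" "emeasure \<nu> A \<le> emeasure \<nu> UNIV"
        using that mu(1) nu(1) by (auto intro!: emeasure_mono)
      then show ?thesis using em True by simp
    qed
    then show ?thesis using mu(1) nu(1) by (intro measure_eqI) auto
  next
    case False
    then have c0: "0 < c" by (simp add: c_def zero_less_measure_iff)
    have rd: "real_distribution (scale_measure (ennreal (1 / c)) \<rho>)"
      if "sets \<rho> = sets borel" "emeasure \<rho> UNIV = ennreal c" for \<rho>
    proof -
      have "space \<rho> = UNIV" using that(1) by (auto dest: sets_eq_imp_space_eq)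
      then show ?thesis
        using that c0 by (intro real_distribution.intro prob_spaceI real_distribution_axioms.intro)
          (auto simp: space_scale_measure ennreal_mult' [symmetric])
    qed
    have char_scale: "char (scale_measure (ennreal (1 / c)) \<rho>) t = char \<rho> t / c"
      if "sets \<rho> = sets borel" for \<rho> t
    proof -
      have "scale_measure (ennreal (1 / c)) \<rho> = density \<rho> (\<lambda>_. ennreal (1 / c))"
        by (rule measure_eqI) (auto simp: emeasure_density_const)
      moreover have "(\<lambda>x. iexp (t * x)) \<in> borel_measurable \<rho>"
        using that by (simp cong: measurable_cong_sets)
      ultimately show ?thesis
        using c0 by (simp add: char_def integral_density scaleR_conv_of_real)
    qed
    have "scale_measure (ennreal (1 / c)) \<mu> = scale_measure (ennreal (1 / c)) \<nu>"
      using mu nu em char by (intro Levy_uniqueness rd ext) (auto simp: char_scale)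
    then have "scale_measure (ennreal c) (scale_measure (ennreal (1 / c)) \<mu>)
        = scale_measure (ennreal c) (scale_measure (ennreal (1 / c)) \<nu>)" by simp
    then show ?thesis
      using c0 by (simp add: ennreal_mult' [symmetric])
  qed
qed

text \<open>The derivatives of both transforms at the origin are i^n s n. Their difference thus
  vanishes there to infinite order, with derivatives bounded by a log-convex sequence whose ratios
  have divergent sum.\<close>

theorem moments_determine:
  assumes mu: "has_moments \<mu> s" and nu: "has_moments \<nu> s" and carl: "carleman_seq s"
  shows "\<mu> = \<nu>"
proof (rule finite_measure_eqI_char)
  show "char \<mu> = char \<nu>"
  proof
    fix t
    let ?f = "\<lambda>n t. fourier_moment \<mu> n t - fourier_moment \<nu> n t"
    have "?f 0 t = 0"
    proof (rule bang_quasianalytic [where f = ?f and M = "majorant \<mu> \<nu>"])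
      fix n m and t h :: real
      have "?f n (t + h) - (\<Sum>k<m. ?f (n + k) t * of_real (h ^ k / fact k))
        = (fourier_moment \<mu> n (t + h) - (\<Sum>k<m. fourier_moment \<mu> (n + k) t * of_real (h ^ k / fact k)))
        - (fourier_moment \<nu> n (t + h) - (\<Sum>k<m. fourier_moment \<nu> (n + k) t * of_real (h ^ k / fact k)))"
        by (simp add: left_diff_distrib sum_subtractf del: of_real_divide)
      also have "cmod \<dots> \<le> (\<integral>x. \<bar>x\<bar> ^ (n + m) \<partial>\<mu>) * \<bar>h\<bar> ^ m / fact m + (\<integral>x. \<bar>x\<bar> ^ (n + m) \<partial>\<nu>) * \<bar>h\<bar> ^ m / fact m"
        by (rule order_trans [OF norm_triangle_ineq4]) (rule add_mono [OF fourier_moment_taylor [OF mu] fourier_moment_taylor [OF nu]])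
      also have "\<dots> \<le> majorant \<mu> \<nu> (n + m) * \<bar>h\<bar> ^ m / fact m"
        by (simp add: majorant_def field_simps)
      finally show "cmod (?f n (t + h) - (\<Sum>k<m. ?f (n + k) t * of_real (h ^ k / fact k)))
        \<le> majorant \<mu> \<nu> (n + m) * \<bar>h\<bar> ^ m / fact m" .
    next
      fix n
      have "fourier_moment \<rho> n 0 = \<i> ^ n * of_real (s n)" if "has_moments \<rho> s" for \<rho>
      proof -
        have "fourier_moment \<rho> n 0 = (CLINT x|\<rho>. \<i> ^ n * of_real (x ^ n))"
          by (simp add: fourier_moment_def power_mult_distrib)
        also have "\<dots> = \<i> ^ n * (CLINT x|\<rho>. of_real (x ^ n))"
          by (rule integral_mult_right_zero)
        also have "(CLINT x|\<rho>. of_real (x ^ n)) = of_real (s n)"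
          using that unfolding has_moments_def by (simp only: integral_complex_of_real)
        finally show ?thesis .
      qed
      then show "?f n 0 = 0" using mu nu by simp
    next
      show "0 < majorant \<mu> \<nu> n" for n using majorant_ge_1 [of \<mu> \<nu> n] by linarith
    qed (rule majorant_log_convex [OF mu nu] majorant_not_summable [OF mu nu carl])+
    then show "char \<mu> t = char \<nu> t" by (simp add: fourier_moment_def char_def)
  qed
qed (use mu nu in \<open>auto simp: has_moments_def\<close>)

section \<open>Existence for the moment problem on the line\<close>

definition hankel_psd :: "(nat \<Rightarrow> real) \<Rightarrow> bool" where
  "hankel_psd s \<longleftrightarrow> (\<forall>n c. 0 \<le> (\<Sum>i\<le>n. \<Sum>j\<le>n. c i * c j * s (i + j)))"

lemma poly_map_of_real_mult:
  "poly (map_poly of_real (p * q)) z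
    = poly (map_poly of_real p) z * poly (map_poly of_real q) (z :: complex)"
proof -
  have add: "map_poly of_real (p + q) = map_poly of_real p + (map_poly of_real q :: complex poly)" for p q
    by (intro poly_eqI) (simp add: coeff_map_poly)
  have smult: "map_poly of_real (smult c q) = smult (of_real c) (map_poly of_real q :: complex poly)" for c q
    by (intro poly_eqI) (simp add: coeff_map_poly)
  show ?thesis
    by (induction p) (simp_all add: map_poly_pCons add smult algebra_simps)
qed

lemma poly_map_of_real_add:
  "poly (map_poly of_real (p + q)) z
    = poly (map_poly of_real p) z + poly (map_poly of_real q) (z :: complex)"
proof -
  have "map_poly of_real (p + q) = map_poly of_real p + (map_poly of_real q :: complex poly)"
    by (intro poly_eqI) (simp add: coeff_map_poly)
  then show ?thesis by simp
qed

text \<open>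
  A nonnegative nonconstant polynomial is divisible by \<open>(x - a)\<^sup>2 + b\<^sup>2\<close> for any complex root
  \<open>a + b i\<close>; if \<open>b = 0\<close> then \<open>a\<close> is a minimum, hence a double root.
\<close>

lemma nonneg_poly_factor:
  fixes r :: "real poly"
  assumes nn: "\<And>t. 0 \<le> poly r t" and deg: "degree r \<noteq> 0"
  obtains a b u where "r = ([:- a, 1:] ^ 2 + [:b\<^sup>2:]) * u" "\<And>t. 0 \<le> poly u t" "degree u < degree r"
proof -
  define R where "R = (map_poly of_real r :: complex poly)"
  have "degree R = degree r" unfolding R_def by (intro degree_map_poly) auto
  then have "\<not> constant (poly R)" using deg constant_degree by metis
  then obtain z where z: "poly R z = 0" using fundamental_theorem_of_algebra by blast
  define a where "a = Re z"
  define b where "b = Im z"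
  define d where "d = [:- a, 1:] ^ 2 + [:b\<^sup>2:]"
  have d_eq: "d = [:a\<^sup>2 + b\<^sup>2, - 2 * a, 1:]"
    by (simp add: d_def power2_eq_square)
  have d0: "d \<noteq> 0" and deg_d: "degree d = 2" by (simp_all add: d_eq)
  define u where "u = r div d"
  define v where "v = r mod d"
  have r_eq: "r = d * u + v" by (simp add: u_def v_def)
  have "v = 0 \<or> degree v < 2"
    using degree_mod_less [OF d0, of r] by (simp add: v_def deg_d)
  then have "degree v < 2" by auto
  then obtain \<beta> \<alpha> where v: "v = [:\<beta>, \<alpha>:]"
    by (metis degree_pCons_0 less_2_cases pCons_cases degree_eq_zeroE One_nat_def degree_pCons_eq
        degree_0 nat.inject pCons_eq_0_iff not_less_iff_gr_or_eq)
  have "poly (map_poly of_real d) z = 0"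
    by (simp add: d_eq map_poly_pCons a_def b_def complex_eq_iff power2_eq_square algebra_simps)
  then have vz: "poly (map_poly of_real v) z = 0"
    using z unfolding R_def r_eq poly_map_of_real_add poly_map_of_real_mult by simp
  then have v1: "\<beta> + \<alpha> * a = 0" and v2: "\<alpha> * b = 0"
    by (simp_all add: v map_poly_pCons complex_eq_iff a_def b_def mult.commute)
  have "\<alpha> = 0"
  proof (cases "b = 0")
    case True
    have "poly r a = 0"
      using v1 True by (simp add: r_eq v d_def algebra_simps)
    then have "poly (pderiv r) a = 0"
      by (intro DERIV_local_min [OF poly_DERIV, of 1 a r]) (use nn in auto)
    moreover have "poly (pderiv r) a
        = poly (pderiv d) a * poly u a + poly d a * poly (pderiv u) a + \<alpha>"
      by (simp add: r_eq pderiv_add pderiv_mult v pderiv_pCons)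
    moreover have "poly (pderiv d) a = 0" "poly d a = 0"
      using True by (simp_all add: d_eq pderiv_pCons power2_eq_square)
    ultimately show ?thesis by simp
  qed (use v2 in simp)
  with v1 have r_du: "r = d * u" by (simp add: r_eq v)
  have u0: "u \<noteq> 0" using r_du deg by auto
  have u_off: "0 \<le> poly u t" if "t \<noteq> a" for t
  proof -
    have "0 < poly d t" using that by (simp add: d_def add_pos_nonneg)
    moreover have "0 \<le> poly d t * poly u t" using nn [of t] by (simp add: r_du)
    ultimately show ?thesis by (simp add: zero_le_mult_iff)
  qed
  \<comment> \<open>If b = 0 the quadratic divisor vanishes at \<open>a\<close>, so division gives
    no sign there; continuity does.\<close>
  have "0 \<le> poly u a"
  proof (rule tendsto_lowerbound)
    show "(poly u \<longlongrightarrow> poly u a) (at a)" using isCont_def poly_isCont by blast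
    show "\<forall>\<^sub>F t in at a. 0 \<le> poly u t"
      using u_off by (auto simp: eventually_at_filter)
  qed simp
  with u_off have "0 \<le> poly u t" for t by (cases "t = a") auto
  moreover have "degree u < degree r"
    using r_du d0 u0 deg_d by (simp add: degree_mult_eq)
  ultimately show thesis using that [of a b u] r_du by (simp add: d_def)
qed

text \<open>The induction varies the functional together with the polynomial. With d = (x - a)^2 +
  b^2, the functional q -> M (d * q) is again nonnegative on squares, since d q^2 = ((x - a) q)^2 +
  b^2 q^2, and it is applied to the cofactor of smaller degree. No decomposition into squares has to
  be written down.\<close>

lemma psd_functional_nonneg_poly:
  fixes M :: "real poly \<Rightarrow> real"
  assumes "\<And>p q. M (p + q) = M p + M q" "\<And>c p. M (smult c p) = c * M p"
    and "\<And>q. 0 \<le> M (q * q)"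
    and "\<And>t. 0 \<le> poly r t"
  shows "0 \<le> M r"
  using assms
proof (induction "degree r" arbitrary: r M rule: less_induct)
  case less
  show ?case
  proof (cases "degree r = 0")
    case True
    then obtain c where r: "r = [:c:]" by (auto elim: degree_eq_zeroE)
    then have "r = smult c (1 * 1)" by simp
    then show ?thesis using less.prems(2,3) less.prems(4) [of 0] r by (metis mult_nonneg_nonneg poly_const_conv)
  next
    case False
    then obtain a b u where r: "r = ([:- a, 1:] ^ 2 + [:b\<^sup>2:]) * u"
      and u: "\<And>t. 0 \<le> poly u t" "degree u < degree r"
      using nonneg_poly_factor less.prems(4) by metis
    let ?d = "[:- a, 1:] ^ 2 + [:b\<^sup>2:]"
    have "0 \<le> M (?d * u)"
    proof (rule less.hyps [OF u(2), where M = "\<lambda>q. M (?d * q)"])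
      fix q
      have "(X ^ 2 + [:c:]) * (q * q) = (X * q) * (X * q) + smult c (q * q)" for X :: "real poly" and c
      proof -
        have "[:c:] * (q * q) = smult c (q * q)" by simp
        moreover have "X ^ 2 * (q * q) = (X * q) * (X * q)" by (simp add: power2_eq_square mult_ac)
        ultimately show ?thesis by (simp only: distrib_right)
      qed
      then have "M (?d * (q * q)) = M (([:- a, 1:] * q) * ([:- a, 1:] * q)) + b\<^sup>2 * M (q * q)"
        by (simp only: less.prems)
      then show "0 \<le> M (?d * (q * q))" using less.prems(3) by simp
    qed (auto simp: distrib_left less.prems u)
    then show ?thesis by (simp only: r)
  qed
qed

section \<open>Approximation of finitely many moments by atomic measures\<close>

definition atomic_moment :: "(real \<times> real) list \<Rightarrow> nat \<Rightarrow> real" where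
  "atomic_moment xs k = (\<Sum>(w, t)\<leftarrow>xs. w * t ^ k)"

lemma hankel_functional:
  assumes "hankel_psd s"
  obtains M :: "real poly \<Rightarrow> real"
  where "\<And>p q. M (p + q) = M p + M q" "\<And>c p. M (smult c p) = c * M p"
    "\<And>q. 0 \<le> M (q * q)" "\<And>c k. M (monom c k) = c * s k"
    "\<And>f A. M (sum f A) = (\<Sum>k\<in>A. M (f (k :: nat)))"
proof
  define M :: "real poly \<Rightarrow> real" where "M p = (\<Sum>k\<le>degree p. coeff p k * s k)" for p
  have M_eq: "M p = (\<Sum>k\<le>n. coeff p k * s k)" if "degree p \<le> n" for p n
    unfolding M_def using that by (intro sum.mono_neutral_left) (auto simp: coeff_eq_0)
  show add: "M (p + q) = M p + M q" for p q
    by (subst (1 2 3) M_eq [where n = "max (degree p) (degree q)"])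
      (auto simp: sum.distrib distrib_right degree_add_le)
  show smult: "M (smult c p) = c * M p" for c p
    by (subst (1 2) M_eq [where n = "degree p"]) (auto simp: sum_distrib_left mult_ac degree_smult_le)
  show monom: "M (monom c k) = c * s k" for c k
    by (subst M_eq [where n = k]) (auto simp: degree_monom_le if_distrib [of "\<lambda>x. x * _"] cong: if_cong)
  have M0: "M 0 = 0" by (simp add: M_def)
  show sum: "M (sum f A) = (\<Sum>a\<in>A. M (f a))" for f :: "nat \<Rightarrow> real poly" and A
    by (induction A rule: infinite_finite_induct) (auto simp: M0 add)
  show "0 \<le> M (q * q)" for q
  proof -
    have "q * q = (\<Sum>i\<le>degree q. monom (coeff q i) i) * (\<Sum>i\<le>degree q. monom (coeff q i) i)"
      by (simp add: poly_as_sum_of_monoms)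
    also have "\<dots> = (\<Sum>i\<le>degree q. \<Sum>j\<le>degree q. monom (coeff q i * coeff q j) (i + j))"
      by (simp only: sum_product mult_monom)
    finally have "M (q * q) = (\<Sum>i\<le>degree q. \<Sum>j\<le>degree q. coeff q i * coeff q j * s (i + j))"
      by (simp only: sum monom)
    then show ?thesis using assms by (simp add: hankel_psd_def)
  qed
qed

text \<open>
  A near-minimiser \<open>xs\<close> of the squared distance of moment vectors is nearly optimal with respect to
  adding an atom and to rescaling. The first makes the residual \<open>c\<close>, read as a polynomial, nearly
  nonpositive, the second makes it nearly orthogonal to the moments of \<open>xs\<close>.
\<close>

lemma atomic_approximation:
  assumes s: "hankel_psd s" and \<epsilon>: "0 < \<epsilon>"
  obtains xs where "\<forall>(w, t)\<in>set xs. 0 \<le> w" "(\<Sum>k\<le>N. (s k - atomic_moment xs k)\<^sup>2) < \<epsilon>"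
proof -
  from hankel_functional [OF s] obtain M :: "real poly \<Rightarrow> real"
    where M: "\<And>p q. M (p + q) = M p + M q" "\<And>c p. M (smult c p) = c * M p"
      "\<And>q. 0 \<le> M (q * q)" "\<And>c k. M (monom c k) = c * s k"
      "\<And>f A. M (sum f A) = (\<Sum>k\<in>A. M (f (k :: nat)))" by metis
  define A where "A = {xs :: (real \<times> real) list. \<forall>(w, t)\<in>set xs. 0 \<le> w}"
  define J where "J xs = (\<Sum>k\<le>N. (s k - atomic_moment xs k)\<^sup>2)" for xs
  define V where "V = (\<Sum>k\<le>N. monom (1 :: real) (2 * k))"
  define \<delta> where "\<delta> = Inf (J ` A)"
  define S where "S = (\<Sum>k\<le>N. (s k)\<^sup>2)"
  have J_nonneg: "0 \<le> J xs" for xs by (auto simp: J_def intro: sum_nonneg)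
  then have bdd: "bdd_below (J ` A)" by (auto intro: bdd_belowI [of _ 0])
  have \<delta>_le: "\<delta> \<le> J xs" if "xs \<in> A" for xs
    unfolding \<delta>_def using bdd that by (intro cInf_lower) auto
  have Nil: "[] \<in> A" "J [] = S" by (auto simp: A_def J_def S_def atomic_moment_def)
  define K where "K = \<bar>M (1 + V)\<bar> + (1 + (4 * S + 2))"
  have "0 \<le> S" by (auto simp: S_def intro: sum_nonneg)
  then have K: "0 < K" by (simp add: K_def)
  \<comment> \<open>\<open>h\<close> is both the weight of the new atom and the relative size of the
    rescaling. Minimality up to h^2 suffices because the first-order effects are of size h;
    \<open>K\<close> collects the resulting bounds, so that the final estimate is h * K \<le>
    \<epsilon>. The cap 1/2 keeps 1 - h nonnegative.\<close>
  define h where "h = min (1 / 2) (\<epsilon> / K)"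
  have h: "0 < h" "h \<le> 1 / 2" "h * K \<le> \<epsilon>" using \<epsilon> K by (auto simp: h_def min_def field_simps)
  have "\<exists>y\<in>J ` A. y < \<delta> + h\<^sup>2"
    unfolding \<delta>_def using Nil h by (intro cInf_lessD) auto
  then obtain xs where xs: "xs \<in> A" "J xs < \<delta> + h\<^sup>2" by auto
  define m where "m k = atomic_moment xs k" for k
  define c where "c k = s k - m k" for k
  have J_xs: "J xs = (\<Sum>k\<le>N. (c k)\<^sup>2)" by (simp add: J_def c_def m_def)
  define q where "q = (\<Sum>k\<le>N. monom (c k) k)"
  have poly_q: "poly q t = (\<Sum>k\<le>N. c k * t ^ k)" for t by (simp add: q_def poly_sum poly_monom)
  have poly_V: "poly V t = (\<Sum>k\<le>N. t ^ (2 * k))" for t by (simp add: V_def poly_sum poly_monom)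
  \<comment> \<open>An atom of weight \<open>h\<close> at \<open>t\<close> changes \<open>J\<close>
    by - 2 h q(t) + h^2 V(t), which explains \<open>V\<close> as the sum of the squares of the
    powers of \<open>t\<close>.\<close>
  have add_atom: "2 * poly q t \<le> h * (1 + poly V t)" for t
  proof -
    have "(h, t) # xs \<in> A" using xs h by (auto simp: A_def)
    then have "\<delta> \<le> J ((h, t) # xs)" by (rule \<delta>_le)
    also have "\<dots> = (\<Sum>k\<le>N. (c k)\<^sup>2 - 2 * h * (c k * t ^ k) + h\<^sup>2 * t ^ (2 * k))"
      unfolding J_def
    proof (rule sum.cong)
      fix k
      have "s k - atomic_moment ((h, t) # xs) k = c k - h * t ^ k"
        by (simp add: c_def m_def atomic_moment_def)
      moreover have "t ^ (2 * k) = t ^ k * t ^ k" by (simp add: mult_2 power_add)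
      ultimately show "(s k - atomic_moment ((h, t) # xs) k)\<^sup>2 = (c k)\<^sup>2 - 2 * h * (c k * t ^ k) + h\<^sup>2 * t ^ (2 * k)"
        by (simp only:) (simp add: power2_eq_square algebra_simps)
    qed simp
    also have "\<dots> = J xs - 2 * h * poly q t + h\<^sup>2 * poly V t"
      by (simp add: J_xs poly_q poly_V sum.distrib sum_subtractf sum_distrib_left)
    finally have "h * (2 * poly q t) \<le> h * (h * (1 + poly V t))"
      using xs(2) by (simp add: algebra_simps power2_eq_square)
    then show ?thesis using h(1) by simp
  qed
  \<comment> \<open>This is where positivity of \<open>s\<close> enters: the polynomial h (1 + V) -
    2 q is nonnegative on the line.\<close>
  have "2 * M q \<le> h * M (1 + V)"
  proof -
    have "0 \<le> M (smult h (1 + V) + smult (- 2) q)"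
      by (rule psd_functional_nonneg_poly [OF M(1-3)]) (use add_atom in auto)
    moreover have "M (smult h (1 + V) + smult (- 2) q) = h * M (1 + V) + (- 2) * M q"
      by (simp only: M(1,2))
    ultimately show ?thesis by simp
  qed
  moreover have "h * M (1 + V) \<le> h * \<bar>M (1 + V)\<bar>" using h by (intro mult_left_mono) auto
  moreover have "M q = (\<Sum>k\<le>N. c k * s k)" by (simp only: q_def M(4,5))
  ultimately have cs: "2 * (\<Sum>k\<le>N. c k * s k) \<le> h * \<bar>M (1 + V)\<bar>" by simp
  define mm where "mm = (\<Sum>k\<le>N. (m k)\<^sup>2)"
  have cm: "- 2 * (\<Sum>k\<le>N. c k * m k) \<le> h * (1 + mm)"
  proof -
    define ys where "ys = map (\<lambda>(w, t). ((1 - h) * w, t)) xs"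
    have "ys \<in> A" using xs(1) h by (auto simp: A_def ys_def)
    have ys: "atomic_moment ys k = (1 - h) * m k" for k
      unfolding m_def ys_def atomic_moment_def
      by (induction xs) (auto simp: algebra_simps)
    have "\<delta> \<le> J ys" by (rule \<delta>_le) fact
    also have "\<dots> = (\<Sum>k\<le>N. (c k)\<^sup>2 + 2 * h * (c k * m k) + h\<^sup>2 * (m k)\<^sup>2)"
      unfolding J_def
      by (rule sum.cong) (auto simp: c_def ys power2_eq_square algebra_simps)
    also have "\<dots> = J xs + 2 * h * (\<Sum>k\<le>N. c k * m k) + h\<^sup>2 * mm"
      by (simp add: J_xs mm_def sum.distrib sum_distrib_left)
    finally have "h * (- 2 * (\<Sum>k\<le>N. c k * m k)) \<le> h * (h * (1 + mm))"
      using xs(2) by (simp add: algebra_simps power2_eq_square)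
    then show ?thesis using h(1) by (rule mult_left_le_imp_le)
  qed
  \<comment> \<open>Comparison with the empty list gives J xs \<le> S + 1, and m = s - c gives mm
    \<le> 2 S + 2 J xs. This is the origin of 4 S + 2 in \<open>K\<close>.\<close>
  have mm_le: "mm \<le> 4 * S + 2"
  proof -
    have "\<delta> \<le> S" using \<delta>_le [OF Nil(1)] Nil(2) by simp
    moreover have "h\<^sup>2 \<le> 1" using h by (intro power_le_one) auto
    ultimately have J_le: "J xs \<le> S + 1" using xs(2) by simp
    have "(m k)\<^sup>2 \<le> 2 * (s k)\<^sup>2 + 2 * (c k)\<^sup>2" for k
      using zero_le_power2 [of "s k + c k"] by (simp add: c_def power2_eq_square algebra_simps)
    then have "mm \<le> (\<Sum>k\<le>N. 2 * (s k)\<^sup>2 + 2 * (c k)\<^sup>2)" unfolding mm_def by (rule sum_mono)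
    also have "\<dots> = 2 * S + 2 * J xs" by (simp add: S_def J_xs sum.distrib sum_distrib_left)
    finally show ?thesis using J_le by simp
  qed
  have "J xs = (\<Sum>k\<le>N. c k * s k) - (\<Sum>k\<le>N. c k * m k)"
    by (simp add: J_xs sum_subtractf [symmetric] c_def power2_eq_square algebra_simps)
  then have "2 * J xs \<le> h * \<bar>M (1 + V)\<bar> + h * (1 + mm)" using cs cm by simp
  also have "\<dots> \<le> h * K"
    unfolding K_def distrib_left [symmetric] using h mm_le by (intro mult_left_mono) auto
  finally have "J xs < \<epsilon>" using h(3) \<epsilon> by simp
  then show thesis using that [of xs] xs(1) by (simp add: A_def J_def)
qed

section \<open>Truncated powers and weak limits of measures with convergent moments\<close>

definition clip :: "real \<Rightarrow> nat \<Rightarrow> real \<Rightarrow> real" where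
  "clip R k t = (max (- R) (min R t)) ^ k"

lemma isCont_clip: "isCont (clip R k) t"
  unfolding clip_def by (intro continuous_intros)

lemma borel_measurable_clip [measurable]: "clip R k \<in> borel_measurable borel"
  unfolding clip_def by measurable

lemma abs_clip_le:
  assumes "0 \<le> R"
  shows "\<bar>clip R k t\<bar> \<le> R ^ k" "\<bar>clip R k t\<bar> \<le> \<bar>t\<bar> ^ k"
proof -
  have "\<bar>max (- R) (min R t)\<bar> \<le> R" "\<bar>max (- R) (min R t)\<bar> \<le> \<bar>t\<bar>"
    using assms by (auto simp: max_def min_def abs_if)
  then show "\<bar>clip R k t\<bar> \<le> R ^ k" "\<bar>clip R k t\<bar> \<le> \<bar>t\<bar> ^ k"
    unfolding clip_def power_abs by (auto intro: power_mono)
qed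

text \<open>Where clipping changes anything, |t| > R \<ge> 1, so R \<le> |t|^(k + 2). This exponent
  is chosen to make the total exponent even, so that the error is controlled by a moment and tends
  to 0 with 1 / R, uniformly over measures for which that moment is bounded.\<close>

lemma clip_approximates:
  assumes "1 \<le> R"
  shows "\<bar>t ^ k - clip R k t\<bar> \<le> 2 * t ^ (2 * (k + 1)) / R"
proof (cases "\<bar>t\<bar> \<le> R")
  case True
  then have "max (- R) (min R t) = t" by (auto simp: max_def min_def)
  then have "clip R k t = t ^ k" by (simp add: clip_def)
  moreover have "0 \<le> 2 * t ^ (2 * (k + 1)) / R"
    using assms by (intro divide_nonneg_nonneg mult_nonneg_nonneg zero_le_even_power) auto
  ultimately show ?thesis by (simp only: diff_self abs_zero)
next
  case False
  have "\<bar>t ^ k - clip R k t\<bar> \<le> 2 * \<bar>t\<bar> ^ k"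
    using abs_clip_le(2) [of R k t] abs_triangle_ineq4 [of "t ^ k" "clip R k t"] assms
    by (simp add: power_abs)
  also have "\<bar>t\<bar> ^ k * R \<le> \<bar>t\<bar> ^ k * \<bar>t\<bar> ^ (k + 2)"
  proof (rule mult_left_mono)
    have "R \<le> \<bar>t\<bar> ^ 1" using False by simp
    also have "\<dots> \<le> \<bar>t\<bar> ^ (k + 2)" using False assms by (intro power_increasing) auto
    finally show "R \<le> \<bar>t\<bar> ^ (k + 2)" .
  qed simp
  then have "2 * \<bar>t\<bar> ^ k \<le> 2 * (\<bar>t\<bar> ^ k * \<bar>t\<bar> ^ (k + 2)) / R"
    using assms by (simp add: field_simps)
  also have "\<bar>t\<bar> ^ k * \<bar>t\<bar> ^ (k + 2) = \<bar>t\<bar> ^ (2 * (k + 1))"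
    by (simp only: power_add [symmetric]) (simp add: mult_2 power_add)
  also have "\<dots> = t ^ (2 * (k + 1))" by (rule power_even_abs) simp
  finally show ?thesis .
qed

lemma integral_clip_approximates:
  assumes \<mu>: "real_distribution \<mu>" and int: "\<And>k. integrable \<mu> (\<lambda>t. t ^ k)"
    and C: "(\<integral>t. t ^ (2 * (k + 1)) \<partial>\<mu>) \<le> C" and R: "1 \<le> R"
  shows "\<bar>(\<integral>t. t ^ k \<partial>\<mu>) - (\<integral>t. clip R k t \<partial>\<mu>)\<bar> \<le> 2 * C / R"
proof -
  interpret real_distribution \<mu> by fact
  have int_clip: "integrable \<mu> (clip R k)"
    using abs_clip_le(1) [of R k] R
    by (intro integrable_const_bound [of _ "R ^ k"]) auto
  have "(\<integral>t. t ^ k \<partial>\<mu>) - (\<integral>t. clip R k t \<partial>\<mu>) = (\<integral>t. t ^ k - clip R k t \<partial>\<mu>)"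
    by (rule Bochner_Integration.integral_diff [OF int int_clip, symmetric])
  also have "\<bar>\<dots>\<bar> \<le> (\<integral>t. \<bar>t ^ k - clip R k t\<bar> \<partial>\<mu>)"
    by (rule integral_abs_bound)
  also have "\<dots> \<le> (\<integral>t. 2 / R * t ^ (2 * (k + 1)) \<partial>\<mu>)"
    using clip_approximates [OF R]
    by (intro integral_mono integrable_abs Bochner_Integration.integrable_diff int int_clip
        integrable_mult_right) (simp_all add: field_simps)
  also have "\<dots> = 2 / R * (\<integral>t. t ^ (2 * (k + 1)) \<partial>\<mu>)" by simp
  also have "\<dots> \<le> 2 / R * C" using R by (intro mult_left_mono C) auto
  finally show ?thesis by simp
qed

text \<open>Bounded second moments give tightness and hence a weakly convergent subsequence. Weak
  convergence concerns bounded functions only; powers are reached by clipping, whose error is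
  uniform along the sequence because higher even moments are bounded.\<close>

lemma moment_sequence_limit:
  fixes \<mu> :: "nat \<Rightarrow> real measure"
  assumes rd: "\<And>n. real_distribution (\<mu> n)"
    and int: "\<And>n k. integrable (\<mu> n) (\<lambda>t. t ^ k)"
    and lim: "\<And>k. (\<lambda>n. \<integral>t. t ^ k \<partial>\<mu> n) \<longlonglongrightarrow> m k"
  obtains M where "real_distribution M" "has_moments M m"
proof -
  have "\<exists>C. \<forall>n. (\<integral>t. t ^ k \<partial>\<mu> n) \<le> C" for k
    using convergent_imp_Bseq [OF convergentI [OF lim [of k]]] by (auto simp: Bseq_def abs_le_iff)
  then obtain C where C: "\<And>k n. (\<integral>t. t ^ k \<partial>\<mu> n) \<le> C k" by metis
  have "tight \<mu>"
    unfolding tight_def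
  proof (intro conjI allI impI rd)
    fix \<epsilon> :: real assume \<epsilon>: "0 < \<epsilon>"
    \<comment> \<open>Markov's inequality for t^2 gives mass at most C 2 / a^2 outside the interval.
      The absolute value keeps the radicand nonnegative, and the summand 1 inside it makes the final
      inequality strict.\<close>
    define a where "a = sqrt ((\<bar>C 2\<bar> + 1) / \<epsilon>) + 1"
    have a: "0 < a" unfolding a_def by (intro add_nonneg_pos real_sqrt_ge_zero divide_nonneg_pos \<epsilon>) auto
    have a2: "C 2 / a\<^sup>2 < \<epsilon>"
    proof -
      have "(\<bar>C 2\<bar> + 1) / \<epsilon> = (sqrt ((\<bar>C 2\<bar> + 1) / \<epsilon>))\<^sup>2" using \<epsilon> by simp
      also have "\<dots> \<le> a\<^sup>2" unfolding a_def using \<epsilon> by (intro power_mono) auto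
      finally have "\<bar>C 2\<bar> + 1 \<le> a\<^sup>2 * \<epsilon>" using \<epsilon> by (simp add: pos_divide_le_eq)
      then have "C 2 < \<epsilon> * a\<^sup>2" by (simp add: mult.commute)
      then show ?thesis using a by (simp add: pos_divide_less_eq)
    qed
    have "1 - \<epsilon> < measure (\<mu> n) {- a<..a}" for n
    proof -
      interpret real_distribution "\<mu> n" by (rule rd)
      have "measure (\<mu> n) {t \<in> space (\<mu> n). a\<^sup>2 \<le> t\<^sup>2} \<le> (\<integral>t. t\<^sup>2 \<partial>\<mu> n) / a\<^sup>2"
        using a int [of n 2] by (intro integral_Markov_inequality_measure [where A = "{}"]) auto
      also have "\<dots> \<le> C 2 / a\<^sup>2" using C [of n 2] a by (intro divide_right_mono) auto
      finally have *: "measure (\<mu> n) {t. a\<^sup>2 \<le> t\<^sup>2} < \<epsilon>" using a2 by simp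
      have "measure (\<mu> n) (space (\<mu> n) - {- a<..a}) \<le> measure (\<mu> n) {t. a\<^sup>2 \<le> t\<^sup>2}"
      proof (rule finite_measure_mono)
        show "space (\<mu> n) - {- a<..a} \<subseteq> {t. a\<^sup>2 \<le> t\<^sup>2}"
          using a by (auto simp: abs_le_square_iff [symmetric])
      qed simp
      with * show ?thesis using prob_compl [of "{- a<..a}"] by simp
    qed
    then show "\<exists>a b. a < b \<and> (\<forall>n. 1 - \<epsilon> < measure (\<mu> n) {a<..b})"
      using a by (intro exI [of _ "- a"] exI [of _ a]) auto
  qed
  then obtain r M where r: "strict_mono (r :: nat \<Rightarrow> nat)" and M: "real_distribution M"
    and wc: "weak_conv_m (\<mu> \<circ> id \<circ> r) M"
    using tight_imp_convergent_subsubsequence [of \<mu> id] strict_mono_id by (metis)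
  interpret M: real_distribution M by fact
  define \<nu> where "\<nu> n = \<mu> (r n)" for n
  have \<nu>: "real_distribution (\<nu> n)" "integrable (\<nu> n) (\<lambda>t. t ^ k)" "(\<integral>t. t ^ k \<partial>\<nu> n) \<le> C k" for n k
    by (auto simp: \<nu>_def rd int C)
  have lim_\<nu>: "(\<lambda>n. \<integral>t. t ^ k \<partial>\<nu> n) \<longlonglongrightarrow> m k" for k
    using LIMSEQ_subseq_LIMSEQ [OF lim [of k] r] by (simp add: \<nu>_def o_def)
  have lim_clip: "(\<lambda>n. \<integral>t. clip R k t \<partial>\<nu> n) \<longlonglongrightarrow> (\<integral>t. clip R k t \<partial>M)" if "0 \<le> R" for R k
    using weak_conv_imp_integral_bdd_continuous_conv [OF _ M wc isCont_clip, where B = "R ^ k"] rd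
      abs_clip_le(1) [OF that]
    by (simp add: \<nu>_def o_def)
  \<comment> \<open>Fatou's lemma in the clipping level: the clipped integrals pass to the weak
    limit and inherit the bound, and letting the level grow gives the bound for the unclipped even
    power.\<close>
  have even: "integrable M (\<lambda>t. t ^ (2 * k))" "(\<integral>t. t ^ (2 * k) \<partial>M) \<le> C (2 * k)" for k
  proof -
    have clip_nonneg: "0 \<le> clip R (2 * k) t" for R t by (simp add: clip_def)
    have "(\<integral>\<^sup>+ t. ennreal (t ^ (2 * k)) \<partial>M) \<le> (\<integral>\<^sup>+ t. liminf (\<lambda>n. ennreal (clip (real n) (2 * k) t)) \<partial>M)"
    proof (intro nn_integral_mono)
      fix t :: real
      obtain N :: nat where N: "\<bar>t\<bar> \<le> real N" using real_arch_simple by blast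
      have "clip (real n) (2 * k) t = t ^ (2 * k)" if "N \<le> n" for n
        using N that unfolding clip_def by (intro arg_cong [of _ _ "\<lambda>x. x ^ (2 * k)"]) (auto simp: max_def min_def)
      then have "(\<lambda>n. ennreal (clip (real n) (2 * k) t)) \<longlonglongrightarrow> ennreal (t ^ (2 * k))"
        by (intro tendsto_eventually eventually_sequentiallyI [of N]) simp
      then show "ennreal (t ^ (2 * k)) \<le> liminf (\<lambda>n. ennreal (clip (real n) (2 * k) t))"
        by (simp add: lim_imp_Liminf)
    qed
    also have "\<dots> \<le> liminf (\<lambda>n. \<integral>\<^sup>+ t. ennreal (clip (real n) (2 * k) t) \<partial>M)"
      by (intro nn_integral_liminf) simp
    also have "\<dots> \<le> liminf (\<lambda>n. ennreal (C (2 * k)))"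
    proof (intro Liminf_mono always_eventually allI)
      fix R :: nat
      have int_clip: "integrable M (clip (real R) (2 * k))"
        using abs_clip_le(1) [of "real R" "2 * k"]
        by (intro M.integrable_const_bound [of _ "real R ^ (2 * k)"]) auto
      have "(\<integral>t. clip (real R) (2 * k) t \<partial>M) \<le> C (2 * k)"
      proof (rule LIMSEQ_le_const2 [OF lim_clip])
        have "(\<integral>t. clip (real R) (2 * k) t \<partial>\<nu> n) \<le> C (2 * k)" for n
        proof -
          interpret N: real_distribution "\<nu> n" by (rule \<nu>)
          have "(\<integral>t. clip (real R) (2 * k) t \<partial>\<nu> n) \<le> (\<integral>t. t ^ (2 * k) \<partial>\<nu> n)"
          proof (rule integral_mono)
            show "integrable (\<nu> n) (clip (real R) (2 * k))"
              using abs_clip_le(1) [of "real R" "2 * k"]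
              by (intro N.integrable_const_bound [of _ "real R ^ (2 * k)"]) auto
            show "clip (real R) (2 * k) t \<le> t ^ (2 * k)" for t
              using abs_clip_le(2) [of "real R" "2 * k" t] by (simp add: power_even_abs)
          qed (rule \<nu>)
          then show ?thesis using \<nu>(3) [of n "2 * k"] by simp
        qed
        then show "\<exists>N. \<forall>n\<ge>N. (\<integral>t. clip (real R) (2 * k) t \<partial>\<nu> n) \<le> C (2 * k)" by blast
      qed simp
      then show "(\<integral>\<^sup>+ t. ennreal (clip (real R) (2 * k) t) \<partial>M) \<le> ennreal (C (2 * k))"
        using clip_nonneg by (subst nn_integral_eq_integral [OF int_clip]) (auto intro: ennreal_leI)
    qed
    finally have nn: "(\<integral>\<^sup>+ t. ennreal (t ^ (2 * k)) \<partial>M) \<le> ennreal (C (2 * k))"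
      by (simp add: Liminf_const)
    show int': "integrable M (\<lambda>t. t ^ (2 * k))"
      using nn by (intro integrableI_nonneg) (auto intro: le_less_trans)
    have "0 \<le> (\<integral>t. t ^ (2 * k) \<partial>\<nu> 0)" by (intro Bochner_Integration.integral_nonneg) simp
    then have "0 \<le> C (2 * k)" using \<nu>(3) [of 0 "2 * k"] by linarith
    with nn show "(\<integral>t. t ^ (2 * k) \<partial>M) \<le> C (2 * k)"
      by (subst (asm) nn_integral_eq_integral [OF int']) auto
  qed
  have int_M: "integrable M (\<lambda>t. t ^ k)" for k
  proof (rule Bochner_Integration.integrable_bound)
    show "integrable M (\<lambda>t. 1 + t ^ (2 * k))" using even(1) by simp
    have "\<bar>t\<bar> ^ k \<le> 1 + (\<bar>t\<bar> ^ k)\<^sup>2" for t :: real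
      using zero_le_power2 [of "\<bar>t\<bar> ^ k - 1 / 2"] by (simp add: power2_eq_square algebra_simps)
    then show "AE t in M. norm (t ^ k) \<le> norm (1 + t ^ (2 * k))"
      by (simp add: power_abs power_mult [symmetric] mult.commute [of k] power_even_abs)
  qed simp
  have "(\<integral>t. t ^ k \<partial>M) = m k" for k
  proof -
    define D where "D = \<bar>C (2 * (k + 1))\<bar>"
    \<comment> \<open>Half of 4 D / R is the clipping error in the limit measure, the other half the
      limit of the errors along the sequence. Then R tends to infinity.\<close>
    have bound: "\<bar>m k - (\<integral>t. t ^ k \<partial>M)\<bar> \<le> 4 * D / R" if R: "1 \<le> R" for R
    proof -
      have "\<bar>m k - (\<integral>t. clip R k t \<partial>M)\<bar> \<le> 2 * D / R"
      proof (rule LIMSEQ_le_const2)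
        show "(\<lambda>n. \<bar>(\<integral>t. t ^ k \<partial>\<nu> n) - (\<integral>t. clip R k t \<partial>\<nu> n)\<bar>) \<longlonglongrightarrow> \<bar>m k - (\<integral>t. clip R k t \<partial>M)\<bar>"
          using R by (intro tendsto_intros lim_\<nu> lim_clip) auto
        have "\<bar>(\<integral>t. t ^ k \<partial>\<nu> n) - (\<integral>t. clip R k t \<partial>\<nu> n)\<bar> \<le> 2 * D / R" for n
          using \<nu>(3) [of n "2 * (k + 1)"]
          by (intro integral_clip_approximates \<nu> R) (auto simp: D_def)
        then show "\<exists>N. \<forall>n\<ge>N. \<bar>(\<integral>t. t ^ k \<partial>\<nu> n) - (\<integral>t. clip R k t \<partial>\<nu> n)\<bar> \<le> 2 * D / R" by blast
      qed
      moreover have "\<bar>(\<integral>t. t ^ k \<partial>M) - (\<integral>t. clip R k t \<partial>M)\<bar> \<le> 2 * D / R"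
        using even(2) [of "k + 1"] by (intro integral_clip_approximates M R int_M) (auto simp: D_def)
      ultimately have "\<bar>m k - (\<integral>t. t ^ k \<partial>M)\<bar> \<le> 2 * D / R + 2 * D / R" by linarith
      then show ?thesis by simp
    qed
    have "\<bar>m k - (\<integral>t. t ^ k \<partial>M)\<bar> \<le> 0"
    proof (rule LIMSEQ_le_const)
      show "(\<lambda>n. 4 * D / real (Suc n)) \<longlonglongrightarrow> 0"
        using tendsto_mult [OF tendsto_const [of "4 * D"] LIMSEQ_inverse_real_of_nat]
        by (simp add: divide_inverse)
    qed (use bound [of "real (Suc _)"] in auto)
    then show ?thesis by simp
  qed
  then have "has_moments M m" by (simp add: has_moments_def int_M M.finite_measure_axioms)
  with M show thesis by (rule that)
qed

text \<open>The list may name the same point several times, so the measure is the image of a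
  weighted measure on the positions of the list.\<close>

lemma atomic_real_distribution:
  assumes w: "\<forall>(w, t)\<in>set xs. 0 \<le> w" and pos: "0 < atomic_moment xs 0"
  obtains \<mu> where "real_distribution \<mu>" "\<And>k. integrable \<mu> (\<lambda>t. t ^ k)"
    "\<And>k. (\<integral>t. t ^ k \<partial>\<mu>) = atomic_moment xs k / atomic_moment xs 0"
proof -
  define W where "W = atomic_moment xs 0"
  have W: "0 < W" using pos by (simp add: W_def)
  let ?I = "{..<length xs}"
  define P where "P = point_measure ?I (\<lambda>i. ennreal (fst (xs ! i) / W))"
  have wi: "0 \<le> fst (xs ! i) / W" if "i \<in> ?I" for i
  proof -
    have "xs ! i \<in> set xs" using that by auto
    with w have "0 \<le> fst (xs ! i)" by (auto simp: case_prod_unfold)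
    then show ?thesis using W by simp
  qed
  have mom: "atomic_moment xs k = (\<Sum>i<length xs. fst (xs ! i) * snd (xs ! i) ^ k)" for k
    by (simp add: atomic_moment_def sum_list_sum_nth atLeast0LessThan case_prod_unfold)
  define \<mu> where "\<mu> = distr P borel (\<lambda>i. snd (xs ! i))"
  have meas: "(\<lambda>i. snd (xs ! i)) \<in> measurable P borel" by (auto simp: P_def space_point_measure intro!: measurableI)
  have "emeasure P (space P) = (\<Sum>i\<in>?I. ennreal (fst (xs ! i) / W))"
    by (simp add: P_def space_point_measure emeasure_point_measure_finite)
  also have "\<dots> = ennreal (\<Sum>i\<in>?I. fst (xs ! i) / W)" by (rule sum_ennreal) (rule wi)
  also have "(\<Sum>i\<in>?I. fst (xs ! i) / W) = 1"
    using W mom [of 0] by (simp add: sum_divide_distrib [symmetric] W_def [symmetric])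
  finally have "prob_space P" by (intro prob_spaceI) simp
  then have "prob_space \<mu>" unfolding \<mu>_def by (rule prob_space.prob_space_distr) (rule meas)
  then have "real_distribution \<mu>"
    by (intro real_distribution.intro real_distribution_axioms.intro) (auto simp: \<mu>_def)
  moreover have "integrable \<mu> (\<lambda>t. t ^ k)" for k
    unfolding \<mu>_def by (subst integrable_distr_eq [OF meas]) (auto simp: P_def integrable_point_measure_finite)
  moreover have "(\<integral>t. t ^ k \<partial>\<mu>) = atomic_moment xs k / atomic_moment xs 0" for k
  proof -
    have "(\<integral>t. t ^ k \<partial>\<mu>) = (\<integral>i. snd (xs ! i) ^ k \<partial>P)"
      unfolding \<mu>_def by (rule integral_distr [OF meas]) simp
    also have "\<dots> = (\<Sum>i\<in>?I. fst (xs ! i) / W * snd (xs ! i) ^ k)"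
      unfolding P_def by (subst lebesgue_integral_point_measure_finite) (auto simp: wi)
    also have "\<dots> = atomic_moment xs k / W"
      by (simp add: mom sum_divide_distrib)
    finally show ?thesis by (simp add: W_def)
  qed
  ultimately show thesis by (rule that)
qed

lemma has_moments_scale:
  assumes \<mu>: "has_moments \<mu> s" and c: "0 \<le> c"
  shows "has_moments (density \<mu> (\<lambda>_. ennreal c)) (\<lambda>k. c * s k)"
proof -
  interpret finite_measure \<mu> using \<mu> by (simp add: has_moments_def)
  have "(\<lambda>t. t ^ k) \<in> borel_measurable \<mu>" for k
    using \<mu> by (intro borel_measurable_integrable) (simp add: has_moments_def)
  moreover have "finite_measure (density \<mu> (\<lambda>_. ennreal c))"
    by (intro finite_measureI) (simp add: emeasure_density_const ennreal_mult_eq_top_iff)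
  ultimately show ?thesis
    using \<mu> c by (simp add: has_moments_def integrable_density integral_density)
qed

lemma sum_of_bool_eq:
  fixes f :: "'a \<Rightarrow> real"
  assumes "finite A" "a \<in> A"
  shows "(\<Sum>x\<in>A. of_bool (x = a) * f x) = f a"
  using assms by (simp add: of_bool_def if_distrib [of "\<lambda>x. x * _"] cong: if_cong)

text \<open>The first N + 1 moments are matched up to a squared error 1 / (N + 1) by an atomic
  measure; after normalisation these measures have a limit with the right moments. Normalisation
  divides by \<open>s 0\<close>, so \<open>s 0 = 0\<close> is separate: positivity then forces
  \<open>s\<close> to vanish.\<close>

theorem hamburger:
  assumes s: "hankel_psd s"
  obtains \<mu> where "has_moments \<mu> s"
proof -
  have s_even: "0 \<le> s (2 * k)" for k
  proof -
    have "0 \<le> (\<Sum>i\<le>k. \<Sum>j\<le>k. of_bool (i = k) * of_bool (j = k) * s (i + j))"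
      using s [unfolded hankel_psd_def, rule_format, where n = k and c = "\<lambda>i. of_bool (i = k)"] .
    also have "\<dots> = (\<Sum>i\<le>k. of_bool (i = k) * (\<Sum>j\<le>k. of_bool (j = k) * s (i + j)))"
      by (simp only: mult.assoc sum_distrib_left)
    also have "\<dots> = s (2 * k)"
      by (simp add: sum_of_bool_eq mult_2)
    finally show ?thesis .
  qed
  show thesis
  proof (cases "s 0 = 0")
    case True
    have "s k = 0" for k
    proof -
      \<comment> \<open>The Hankel form at the vector e_0 + l e_k, whose two unit vectors are
        distinct as k is not 0.\<close>
      have quad: "0 \<le> 2 * l * s k + l\<^sup>2 * s (2 * k)" if "k \<noteq> 0" for l
      proof -
        let ?c = "\<lambda>i. of_bool (i = 0) + l * of_bool (i = k)"
        have "0 \<le> (\<Sum>i\<le>k. \<Sum>j\<le>k. ?c i * ?c j * s (i + j))"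
          using s [unfolded hankel_psd_def, rule_format, where n = k and c = ?c] .
        also have "\<dots> = (\<Sum>i\<le>k. ?c i * (s i + l * s (i + k)))"
        proof (rule sum.cong)
          fix i assume "i \<in> {..k}"
          have "(\<Sum>j\<le>k. ?c i * ?c j * s (i + j)) = ?c i * (\<Sum>j\<le>k. of_bool (j = 0) * s (i + j) + l * (of_bool (j = k) * s (i + j)))"
            by (simp add: sum_distrib_left algebra_simps)
          also have "(\<Sum>j\<le>k. of_bool (j = 0) * s (i + j) + l * (of_bool (j = k) * s (i + j))) = s i + l * s (i + k)"
            by (simp only: sum.distrib sum_distrib_left [symmetric]) (simp add: sum_of_bool_eq)
          finally show "(\<Sum>j\<le>k. ?c i * ?c j * s (i + j)) = ?c i * (s i + l * s (i + k))" .
        qed simp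
        also have "\<dots> = (\<Sum>i\<le>k. of_bool (i = 0) * (s i + l * s (i + k)) + l * (of_bool (i = k) * (s i + l * s (i + k))))"
          by (simp add: algebra_simps)
        also have "\<dots> = (s 0 + l * s k) + l * (s k + l * s (k + k))"
          by (simp only: sum.distrib sum_distrib_left [symmetric]) (simp add: sum_of_bool_eq)
        finally have "0 \<le> 2 * l * s k + l\<^sup>2 * s (k + k)"
          using True by (simp add: power2_eq_square algebra_simps)
        then show ?thesis by (simp only: mult_2 [of k])
      qed
      show ?thesis
      proof (cases "k = 0")
        case False
        \<comment> \<open>The minimiser after adding l^2 to the quadratic form; adding it avoids a
          division by zero when \<open>s (2 * k)\<close> vanishes.\<close>
        define l where "l = - s k / (1 + s (2 * k))"
        have d: "0 < 1 + s (2 * k)" using s_even [of k] by simp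
        have "0 \<le> (2 * l * s k + l\<^sup>2 * s (2 * k)) + l\<^sup>2" using quad [OF False, of l] by simp
        also have "\<dots> = l * (2 * s k + l * (1 + s (2 * k)))" by (simp add: power2_eq_square algebra_simps)
        also have "\<dots> = - (s k)\<^sup>2 / (1 + s (2 * k))" using d by (simp add: l_def power2_eq_square)
        finally have "(s k)\<^sup>2 \<le> 0" using d by (simp add: divide_le_0_iff)
        then show ?thesis by simp
      qed (use True in simp)
    qed
    then have "has_moments (null_measure borel) s"
      by (simp add: has_moments_def finite_measureI)
    then show thesis by (rule that)
  next
    case False
    then have s0: "0 < s 0" using s_even [of 0] by simp
    have "\<exists>xs. (\<forall>(w, t)\<in>set xs. 0 \<le> w) \<and> (\<Sum>k\<le>N. (s k - atomic_moment xs k)\<^sup>2) < 1 / real (Suc N)" for N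
      by (rule atomic_approximation [OF s, of "1 / real (Suc N)" N]) auto
    then obtain xs where xs: "\<forall>(w, t)\<in>set (xs N). 0 \<le> w"
        "(\<Sum>k\<le>N. (s k - atomic_moment (xs N) k)\<^sup>2) < 1 / real (Suc N)" for N
      by metis
    have lim: "(\<lambda>N. atomic_moment (xs N) k) \<longlonglongrightarrow> s k" for k
    proof -
      have "(\<lambda>N. (s k - atomic_moment (xs N) k)\<^sup>2) \<longlonglongrightarrow> 0"
      proof (rule tendsto_sandwich [OF _ _ tendsto_const LIMSEQ_inverse_real_of_nat])
        show "\<forall>\<^sub>F N in sequentially. (s k - atomic_moment (xs N) k)\<^sup>2 \<le> inverse (real (Suc N))"
        proof (rule eventually_sequentiallyI)
          fix N assume "k \<le> N"
          then have "(s k - atomic_moment (xs N) k)\<^sup>2 \<le> (\<Sum>k\<le>N. (s k - atomic_moment (xs N) k)\<^sup>2)"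
            by (intro member_le_sum) auto
          then show "(s k - atomic_moment (xs N) k)\<^sup>2 \<le> inverse (real (Suc N))"
            using xs(2) [of N] by (simp add: inverse_eq_divide)
        qed
      qed simp
      then have "(\<lambda>N. s k - atomic_moment (xs N) k) \<longlonglongrightarrow> 0" by (simp add: tendsto_power_zero power_tendsto_0_iff)
      from tendsto_diff [OF tendsto_const [of "s k"] this] show ?thesis by simp
    qed
    \<comment> \<open>Only from some index on do the approximants have positive mass, so the
      sequence is shifted by \<open>N0\<close> before normalising.\<close>
    have "eventually (\<lambda>N. 0 < atomic_moment (xs N) 0) sequentially"
      using lim [of 0] s0 by (rule order_tendstoD)
    then obtain N0 where "\<forall>n\<ge>N0. 0 < atomic_moment (xs n) 0"
      unfolding eventually_sequentially ..
    then have N0: "0 < atomic_moment (xs (N + N0)) 0" for N by simp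
    have "\<exists>\<mu>. real_distribution \<mu> \<and> (\<forall>k. integrable \<mu> (\<lambda>t. t ^ k) \<and>
        (\<integral>t. t ^ k \<partial>\<mu>) = atomic_moment (xs (N + N0)) k / atomic_moment (xs (N + N0)) 0)" for N
      by (rule atomic_real_distribution [OF xs(1) N0 [of N]]) blast
    then obtain \<mu> where \<mu>: "\<And>N. real_distribution (\<mu> N)" "\<And>N k. integrable (\<mu> N) (\<lambda>t. t ^ k)"
        "\<And>N k. (\<integral>t. t ^ k \<partial>\<mu> N) = atomic_moment (xs (N + N0)) k / atomic_moment (xs (N + N0)) 0"
      by metis
    have "(\<lambda>N. \<integral>t. t ^ k \<partial>\<mu> N) \<longlonglongrightarrow> s k / s 0" for k
      unfolding \<mu>(3) using s0 by (intro tendsto_divide LIMSEQ_ignore_initial_segment lim) simp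
    with \<mu>(1,2) obtain M where "has_moments M (\<lambda>k. s k / s 0)"
      by (rule moment_sequence_limit)
    from has_moments_scale [OF this, of "s 0"] s0 show thesis by (intro that) simp_all
  qed
qed

section \<open>Determinate sequences\<close>

text \<open>Named after its consequence \<open>moment_measure_unique\<close>; what is required is
  Carleman's condition, which, unlike uniqueness, can be transferred between sequences by
  inequalities.\<close>

definition determinate :: "(nat \<Rightarrow> real) \<Rightarrow> bool" where
  "determinate s \<longleftrightarrow> hankel_psd s \<and> carleman_seq s"

definition moment_measure :: "(nat \<Rightarrow> real) \<Rightarrow> real measure" where
  "moment_measure s = (SOME \<mu>. has_moments \<mu> s)"

lemma moment_measure: "hankel_psd s \<Longrightarrow> has_moments (moment_measure s) s"
  unfolding moment_measure_def by (rule someI_ex) (blast elim: hamburger)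

lemma moment_measure_unique: "determinate s \<Longrightarrow> has_moments \<mu> s \<Longrightarrow> \<mu> = moment_measure s"
  by (auto simp: determinate_def intro: moments_determine moment_measure)

text \<open>A class of test functions integrable against every measure with moments. It contains
  both the powers, which carry the algebra, and the indicators, which carry the measures. The even
  exponent keeps the bound free of absolute values.\<close>

definition polynomially_bounded :: "(real \<Rightarrow> real) \<Rightarrow> bool" where
  "polynomially_bounded h \<longleftrightarrow> h \<in> borel_measurable borel \<and> (\<exists>C m. \<forall>t. \<bar>h t\<bar> \<le> C * (1 + t ^ (2 * m)))"

lemma has_moments_sets: "has_moments \<mu> s \<Longrightarrow> sets \<mu> = sets borel"
  by (simp add: has_moments_def)

lemma integrable_polynomially_bounded:
  assumes \<mu>: "has_moments \<mu> s" and h: "polynomially_bounded h"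
  shows "integrable \<mu> h"
proof -
  from h obtain C m where h': "h \<in> borel_measurable borel" and C: "\<And>t. \<bar>h t\<bar> \<le> C * (1 + t ^ (2 * m))"
    by (auto simp: polynomially_bounded_def)
  have "integrable \<mu> (\<lambda>t. 1 + t ^ (2 * m))"
    using \<mu> by (auto simp: has_moments_def finite_measure.integrable_const)
  then have "integrable \<mu> (\<lambda>t. C * (1 + t ^ (2 * m)))" by (rule integrable_mult_right)
  then show ?thesis
  proof (rule Bochner_Integration.integrable_bound)
    show "h \<in> borel_measurable \<mu>"
      using h' has_moments_sets [OF \<mu>] by (simp cong: measurable_cong_sets)
    show "AE t in \<mu>. norm (h t) \<le> norm (C * (1 + t ^ (2 * m)))"
      using C by (intro always_eventually allI) (smt (verit) real_norm_def)
  qed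
qed

lemma polynomially_bounded_le:
  assumes "h \<in> borel_measurable borel" "\<And>t. \<bar>h t\<bar> \<le> g t" "polynomially_bounded g"
  shows "polynomially_bounded h"
proof -
  from assms(3) obtain C m where C: "\<And>t. \<bar>g t\<bar> \<le> C * (1 + t ^ (2 * m))"
    by (auto simp: polynomially_bounded_def)
  have "\<bar>h t\<bar> \<le> C * (1 + t ^ (2 * m))" for t
    using C [of t] assms(2) [of t] by linarith
  with assms(1) show ?thesis by (auto simp: polynomially_bounded_def)
qed

lemma polynomially_bounded_add:
  assumes f: "polynomially_bounded f" and g: "polynomially_bounded g"
  shows "polynomially_bounded (\<lambda>t. f t + g t)"
proof -
  from f obtain C m where f': "f \<in> borel_measurable borel" and C: "\<And>t. \<bar>f t\<bar> \<le> C * (1 + t ^ (2 * m))"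
    by (auto simp: polynomially_bounded_def)
  from g obtain D n where g': "g \<in> borel_measurable borel" and D: "\<And>t. \<bar>g t\<bar> \<le> D * (1 + t ^ (2 * n))"
    by (auto simp: polynomially_bounded_def)
  define N where "N = max m n"
  have ev: "0 \<le> t ^ (2 * k)" for t :: real and k by (rule zero_le_even_power) simp
  \<comment> \<open>Raising the exponent fails for |t| < 1; there both sides are compared with
    constants, at the cost of the factor 2.\<close>
  have pow: "1 + t ^ (2 * k) \<le> 2 * (1 + t ^ (2 * N))" if "k \<le> N" for t :: real and k
  proof (cases "\<bar>t\<bar> \<le> 1")
    case True
    then have "\<bar>t\<bar> ^ (2 * k) \<le> 1" by (intro power_le_one) auto
    then have "t ^ (2 * k) \<le> 1" by (simp add: power_even_abs)
    moreover have "1 + a \<le> 2 * (1 + b)" if "a \<le> 1" "0 \<le> b" for a b :: real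
      using that by simp
    ultimately show ?thesis using ev by blast
  next
    case False
    then have "\<bar>t\<bar> ^ (2 * k) \<le> \<bar>t\<bar> ^ (2 * N)" using that by (intro power_increasing) auto
    then have "t ^ (2 * k) \<le> t ^ (2 * N)" by (simp add: power_even_abs)
    moreover have "1 + a \<le> 2 * (1 + b)" if "a \<le> b" "0 \<le> b" for a b :: real
      using that by simp
    ultimately show ?thesis using ev by blast
  qed
  have "0 \<le> C" "0 \<le> D"
    using C [of 0] D [of 0] abs_ge_zero [of "f 0"] abs_ge_zero [of "g 0"]
    by (auto simp: power_0_left split: if_splits intro: order_trans)
  have "\<bar>f t + g t\<bar> \<le> (2 * C + 2 * D) * (1 + t ^ (2 * N))" for t
  proof -
    have "C * (1 + t ^ (2 * m)) \<le> C * (2 * (1 + t ^ (2 * N)))"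
      by (intro mult_left_mono pow) (auto simp: N_def \<open>0 \<le> C\<close>)
    moreover have "D * (1 + t ^ (2 * n)) \<le> D * (2 * (1 + t ^ (2 * N)))"
      by (intro mult_left_mono pow) (auto simp: N_def \<open>0 \<le> D\<close>)
    ultimately show ?thesis
      using C [of t] D [of t] abs_triangle_ineq [of "f t" "g t"] by (simp add: algebra_simps)
  qed
  with f' g' show ?thesis by (auto simp: polynomially_bounded_def)
qed

lemma polynomially_bounded_cmult:
  assumes f: "polynomially_bounded f"
  shows "polynomially_bounded (\<lambda>t. c * f t)"
proof -
  from f obtain C m where f': "f \<in> borel_measurable borel" and C: "\<And>t. \<bar>f t\<bar> \<le> C * (1 + t ^ (2 * m))"
    by (auto simp: polynomially_bounded_def)
  have "\<bar>c * f t\<bar> \<le> (\<bar>c\<bar> * C) * (1 + t ^ (2 * m))" for t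
    using mult_left_mono [OF C [of t], of "\<bar>c\<bar>"] by (simp add: abs_mult mult.assoc)
  with f' show ?thesis by (auto simp: polynomially_bounded_def)
qed

lemma polynomially_bounded_power: "polynomially_bounded (\<lambda>t. t ^ k)"
proof -
  have "\<bar>t\<bar> ^ k \<le> 1 * (1 + t ^ (2 * k))" for t :: real
  proof -
    have "\<bar>t\<bar> ^ k \<le> 1 + (\<bar>t\<bar> ^ k)\<^sup>2"
      using zero_le_power2 [of "\<bar>t\<bar> ^ k - 1 / 2"] by (simp add: power2_eq_square algebra_simps)
    also have "(\<bar>t\<bar> ^ k)\<^sup>2 = t ^ (2 * k)"
      by (simp add: power_mult [symmetric] mult.commute [of k] power_even_abs)
    finally show ?thesis by simp
  qed
  then show ?thesis
    unfolding polynomially_bounded_def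
    by (intro conjI exI [of _ 1] exI [of _ k]) (auto simp: power_abs)
qed

lemma polynomially_bounded_const: "polynomially_bounded (\<lambda>t. c)"
  using polynomially_bounded_cmult [OF polynomially_bounded_power [of 0], of c] by simp

lemma polynomially_bounded_indicator: "A \<in> sets borel \<Longrightarrow> polynomially_bounded (indicator A)"
  by (rule polynomially_bounded_le [OF _ _ polynomially_bounded_const [of 1]]) (auto simp: indicator_def)

lemma polynomially_bounded_unit:
  "h \<in> borel_measurable borel \<Longrightarrow> (\<And>t. 0 \<le> h t \<and> h t \<le> 1) \<Longrightarrow> polynomially_bounded h"
  by (rule polynomially_bounded_le [OF _ _ polynomially_bounded_const [of 1]]) (simp_all add: abs_of_nonneg)

text \<open>The sum of the two measures. Integrals of nonnegative functions add by induction over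
  measurable functions, and those of \<open>h\<close> by splitting into positive and negative
  part.\<close>

lemma has_moments_sum:
  assumes \<mu>: "has_moments \<mu> s" and \<nu>: "has_moments \<nu> s'"
  obtains \<rho> where "has_moments \<rho> (\<lambda>k. s k + s' k)"
    "\<And>h. polynomially_bounded h \<Longrightarrow> (\<integral>t. h t \<partial>\<rho>) = (\<integral>t. h t \<partial>\<mu>) + (\<integral>t. h t \<partial>\<nu>)"
proof -
  interpret \<mu>: finite_measure \<mu> using \<mu> by (simp add: has_moments_def)
  interpret \<nu>: finite_measure \<nu> using \<nu> by (simp add: has_moments_def)
  note [measurable_cong] = has_moments_sets [OF \<mu>] has_moments_sets [OF \<nu>]
  define \<rho> where "\<rho> = measure_of UNIV (sets borel) (\<lambda>A. emeasure \<mu> A + emeasure \<nu> A)"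
  have sets_\<rho> [measurable_cong, simp]: "sets \<rho> = sets borel"
    unfolding \<rho>_def by (subst sets_measure_of) (auto simp: borel_def sigma_sets_sigma_sets_eq)
  have em: "emeasure \<rho> A = emeasure \<mu> A + emeasure \<nu> A" if "A \<in> sets borel" for A
  proof (rule emeasure_measure_of [OF \<rho>_def])
    show "countably_additive (sets \<rho>) (\<lambda>A. emeasure \<mu> A + emeasure \<nu> A)"
    proof (rule countably_additiveI)
      fix A :: "nat \<Rightarrow> real set" assume "range A \<subseteq> sets \<rho>" "disjoint_family A" "(\<Union>i. A i) \<in> sets \<rho>"
      then show "suminf (\<lambda>i. emeasure \<mu> (A i) + emeasure \<nu> (A i)) = emeasure \<mu> (\<Union>i. A i) + emeasure \<nu> (\<Union>i. A i)"
        using has_moments_sets [OF \<mu>] has_moments_sets [OF \<nu>]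
        by (subst suminf_add [symmetric]) (auto simp: suminf_emeasure)
    qed
  qed (use that in \<open>auto simp: positive_def\<close>)
  have nn: "(\<integral>\<^sup>+t. h t \<partial>\<rho>) = (\<integral>\<^sup>+t. h t \<partial>\<mu>) + (\<integral>\<^sup>+t. h t \<partial>\<nu>)" if "h \<in> borel_measurable borel" for h
    using that
  proof (induction rule: borel_measurable_induct)
    case (cong f g)
    then show ?case by (simp cong: nn_integral_cong)
  next
    case (set A)
    then show ?case using has_moments_sets [OF \<mu>] has_moments_sets [OF \<nu>] by (simp add: em)
  next
    case (mult u c)
    then show ?case by (simp add: nn_integral_cmult distrib_left)
  next
    case (add u v)
    then show ?case by (simp add: nn_integral_add add_ac)
  next
    case (seq U)
    have "(\<integral>\<^sup>+t. (SUP i. U i) t \<partial>\<rho>) = (SUP i. \<integral>\<^sup>+t. U i t \<partial>\<rho>)"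
      using seq by (simp add: image_comp) (subst nn_integral_monotone_convergence_SUP; simp)
    also have "\<dots> = (SUP i. (\<integral>\<^sup>+t. U i t \<partial>\<mu>) + (\<integral>\<^sup>+t. U i t \<partial>\<nu>))" using seq by simp
    also have "\<dots> = (SUP i. \<integral>\<^sup>+t. U i t \<partial>\<mu>) + (SUP i. \<integral>\<^sup>+t. U i t \<partial>\<nu>)"
      using seq by (intro ennreal_SUP_add) (auto simp: incseq_def le_fun_def intro!: nn_integral_mono)
    also have "\<dots> = (\<integral>\<^sup>+t. (SUP i. U i) t \<partial>\<mu>) + (\<integral>\<^sup>+t. (SUP i. U i) t \<partial>\<nu>)"
      using seq by (simp add: image_comp) (subst (1 2) nn_integral_monotone_convergence_SUP; simp)
    finally show ?case .
  qed
  have int: "integrable \<rho> h \<and> (\<integral>t. h t \<partial>\<rho>) = (\<integral>t. h t \<partial>\<mu>) + (\<integral>t. h t \<partial>\<nu>)"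
    if pb: "polynomially_bounded h" for h
  proof -
    have [measurable]: "h \<in> borel_measurable borel" using pb by (simp add: polynomially_bounded_def)
    note i\<mu> = integrable_polynomially_bounded [OF \<mu> pb] and i\<nu> = integrable_polynomially_bounded [OF \<nu> pb]
    have fin: "(\<integral>\<^sup>+t. ennreal (norm (h t)) \<partial>\<rho>) < \<infinity>"
      using i\<mu> i\<nu> by (subst nn) (auto simp: integrable_iff_bounded)
    then have i\<rho>: "integrable \<rho> h" by (simp add: integrable_iff_bounded)
    have split: "(\<integral>t. h t \<partial>M) = enn2real (\<integral>\<^sup>+t. ennreal (h t) \<partial>M) - enn2real (\<integral>\<^sup>+t. ennreal (- h t) \<partial>M)"
      if "integrable M h" for M by (rule real_lebesgue_integral_def [OF that])
    have fin': "(\<integral>\<^sup>+t. ennreal (h t) \<partial>M) < top" "(\<integral>\<^sup>+t. ennreal (- h t) \<partial>M) < top" if "integrable M h" for M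
      using that by (auto simp: real_integrable_def less_top)
    have "(\<integral>t. h t \<partial>\<rho>) = (\<integral>t. h t \<partial>\<mu>) + (\<integral>t. h t \<partial>\<nu>)"
      unfolding split [OF i\<rho>] split [OF i\<mu>] split [OF i\<nu>]
      using fin' [OF i\<mu>] fin' [OF i\<nu>] by (subst (1 2) nn) (simp_all add: enn2real_plus)
    with i\<rho> show ?thesis by simp
  qed
  have "finite_measure \<rho>"
    using int [OF polynomially_bounded_const [of 1]] sets_eq_imp_space_eq [OF sets_\<rho>]
    by (intro finite_measureI) (auto simp: em sets_eq_imp_space_eq [OF has_moments_sets [OF \<mu>], symmetric])
  then have "has_moments \<rho> (\<lambda>k. s k + s' k)"
    using int [OF polynomially_bounded_power] \<mu> \<nu> by (simp add: has_moments_def)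
  with int that show thesis by blast
qed

text \<open>\<open>moment_measure\<close> is a choice, so additivity is not built in. The sum of the
  two chosen measures has the moments of the sum, and determinacy of the sum identifies it with the
  chosen one. All linearity of the functional calculus comes from this and its scaling
  analogue.\<close>

lemma integral_moment_measure_add:
  assumes "hankel_psd s" "hankel_psd s'" "determinate (\<lambda>k. s k + s' k)" "polynomially_bounded h"
  shows "(\<integral>t. h t \<partial>moment_measure (\<lambda>k. s k + s' k))
    = (\<integral>t. h t \<partial>moment_measure s) + (\<integral>t. h t \<partial>moment_measure s')"
proof -
  obtain \<rho> where "has_moments \<rho> (\<lambda>k. s k + s' k)"
    "(\<integral>t. h t \<partial>\<rho>) = (\<integral>t. h t \<partial>moment_measure s) + (\<integral>t. h t \<partial>moment_measure s')"
    using has_moments_sum [OF moment_measure moment_measure] assms by metis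
  with moment_measure_unique [OF assms(3)] show ?thesis by metis
qed

lemma integral_moment_measure_scale:
  assumes "hankel_psd s" "0 \<le> c" "determinate (\<lambda>k. c * s k)" "polynomially_bounded h"
  shows "(\<integral>t. h t \<partial>moment_measure (\<lambda>k. c * s k)) = c * (\<integral>t. h t \<partial>moment_measure s)"
proof -
  have "moment_measure (\<lambda>k. c * s k) = density (moment_measure s) (\<lambda>_. ennreal c)"
    using moment_measure_unique [OF assms(3) has_moments_scale [OF moment_measure [OF assms(1)] assms(2)]] by simp
  moreover have "h \<in> borel_measurable (moment_measure s)"
    using integrable_polynomially_bounded [OF moment_measure [OF assms(1)] assms(4)] by simp
  ultimately show ?thesis using assms(2) by (simp add: integral_density)
qed

lemma integral_density_moment_measure:
  assumes \<mu>: "has_moments \<mu> s" and f: "f \<in> borel_measurable borel" "\<And>t. 0 \<le> f t"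
    and fk: "\<And>k. polynomially_bounded (\<lambda>t. f t * t ^ k)"
  shows "has_moments (density \<mu> (\<lambda>t. ennreal (f t))) (\<lambda>k. \<integral>t. f t * t ^ k \<partial>\<mu>)"
proof -
  note [measurable_cong] = has_moments_sets [OF \<mu>]
  note [measurable] = f(1)
  have int: "integrable \<mu> (\<lambda>t. f t * t ^ k)" for k
    by (rule integrable_polynomially_bounded [OF \<mu> fk])
  have "(\<integral>\<^sup>+t. ennreal (f t) \<partial>\<mu>) < \<infinity>"
    using int [of 0] f(2) by (simp add: integrable_iff_bounded)
  then have "finite_measure (density \<mu> (\<lambda>t. ennreal (f t)))"
    by (intro finite_measureI) (simp add: emeasure_density nn_integral_set_ennreal [symmetric] cong: nn_integral_cong)
  then show ?thesis
    unfolding has_moments_def using has_moments_sets [OF \<mu>] int f(2)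
    by (auto simp: integrable_density integral_density)
qed

section \<open>Positive functionals satisfying Carleman's condition\<close>

text \<open>Translates the extended series into a real one. A nonpositive entry has a nonpositive
  root, which \<open>ennreal\<close> sends to 0, so its reciprocal alone makes the series
  infinite.\<close>

lemma carleman_seq_iff:
  "carleman_seq s \<longleftrightarrow>
     (\<exists>k. s (2 * Suc k) \<le> 0) \<or> \<not> summable (\<lambda>k. 1 / root (2 * Suc k) (s (2 * Suc k)))"
proof -
  define r where "r k = root (2 * Suc k) (s (2 * Suc k))" for k
  have carl: "carleman_seq s \<longleftrightarrow> suminf (\<lambda>k. 1 / ennreal (r k)) = \<infinity>"
    by (simp only: carleman_seq_def r_def)
  show ?thesis
  proof (cases "\<exists>k. s (2 * Suc k) \<le> 0")
    case True
    then obtain k where "s (2 * Suc k) \<le> 0" ..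
    then have "r k \<le> 0" unfolding r_def by (subst real_root_le_0_iff) simp_all
    then have "1 / ennreal (r k) = \<infinity>" by (simp add: ennreal_neg)
    moreover have "1 / ennreal (r k) \<le> suminf (\<lambda>k. 1 / ennreal (r k))"
      using sum_le_suminf [of "\<lambda>k. 1 / ennreal (r k)" "{k}"] by simp
    ultimately have "carleman_seq s" unfolding carl by (simp add: top_unique)
    with True show ?thesis by simp
  next
    case False
    then have r: "0 < r k" for k
      unfolding r_def by (intro real_root_gt_zero) (auto simp: not_le)
    have eq: "1 / ennreal (r k) = ennreal (1 / r k)" for k
      using r [of k] divide_ennreal [of 1 "r k"] by simp
    have nn: "0 \<le> 1 / r k" for k using r [of k] by simp
    have "suminf (\<lambda>k. ennreal (1 / r k)) = \<infinity> \<longleftrightarrow> \<not> summable (\<lambda>k. 1 / r k)"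
    proof
      assume *: "suminf (\<lambda>k. ennreal (1 / r k)) = \<infinity>"
      show "\<not> summable (\<lambda>k. 1 / r k)"
      proof
        assume "summable (\<lambda>k. 1 / r k)"
        then have "suminf (\<lambda>k. ennreal (1 / r k)) = ennreal (suminf (\<lambda>k. 1 / r k))"
          using nn by (intro suminf_ennreal_eq summable_sums)
        with * show False by simp
      qed
    next
      assume "\<not> summable (\<lambda>k. 1 / r k)"
      then show "suminf (\<lambda>k. ennreal (1 / r k)) = \<infinity>"
        using summable_suminf_not_top [of "\<lambda>k. 1 / r k"] nn by (metis infinity_ennreal_def)
    qed
    then show ?thesis using False unfolding carl eq by (simp add: r_def)
  qed
qed

definition psd_functional :: "('a::{comm_ring_1,real_algebra_1} \<Rightarrow> real) \<Rightarrow> bool" where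
  "psd_functional L \<longleftrightarrow> linear L \<and> (\<forall>g. 0 \<le> L (g * g))"

lemma psd_linear: "psd_functional L \<Longrightarrow> linear L"
  and psd_square: "psd_functional L \<Longrightarrow> 0 \<le> L (g * g)"
  by (simp_all add: psd_functional_def)

lemma discriminant_le:
  fixes a b c :: real
  assumes q: "\<And>t. 0 \<le> a + 2 * t * b + t\<^sup>2 * c" and c: "0 \<le> c"
  shows "b\<^sup>2 \<le> a * c"
proof (cases "c = 0")
  case True
  have "b = 0"
  proof (rule ccontr)
    assume "b \<noteq> 0"
    with q [of "- (a + 1) / (2 * b)"] True show False by (simp add: field_simps)
  qed
  with True show ?thesis by simp
next
  case False
  with c have c: "0 < c" by simp
  have "0 \<le> c * (a + 2 * (- b / c) * b + (- b / c)\<^sup>2 * c)" using q [of "- b / c"] c by simp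
  also have "\<dots> = a * c - b\<^sup>2" using c by (simp add: field_simps power2_eq_square)
  finally show ?thesis by simp
qed

lemma psd_cauchy_schwarz:
  assumes L: "psd_functional L"
  shows "(L (f * g))\<^sup>2 \<le> L (f * f) * L (g * g)"
proof (rule discriminant_le)
  note lin = linear_add [OF psd_linear [OF L]] linear_scale [OF psd_linear [OF L]]
  fix t :: real
  have "(f + t *\<^sub>R g) * (f + t *\<^sub>R g)
      = f * f + t *\<^sub>R (f * g) + t *\<^sub>R (f * g) + t\<^sup>2 *\<^sub>R (g * g)"
    by (simp add: algebra_simps power2_eq_square)
  then have "L ((f + t *\<^sub>R g) * (f + t *\<^sub>R g)) = L (f * f) + 2 * t * L (f * g) + t\<^sup>2 * L (g * g)"
    by (simp only: lin) simp
  then show "0 \<le> L (f * f) + 2 * t * L (f * g) + t\<^sup>2 * L (g * g)"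
    using psd_square [OF L] by metis
qed (rule psd_square [OF L])

text \<open>Put u k = L (x^(2k)) and R k = (u k)^(1/(2k)). The hypothesis bounds the
  \<open>2k\<close>-th root of v (2 * k) by a constant times R (2 * k), so it speaks only of R at
  even indices, a series that could converge where the full one diverges. By Lyapunov's inequality R
  is increasing up to a constant factor, so the odd terms are controlled by the even ones.\<close>

lemma carleman_seq_transfer:
  fixes x :: "'a::{comm_ring_1,real_algebra_1}"
  assumes L: "psd_functional L" and carl: "carleman_seq (\<lambda>k. L (x ^ k))"
    and v: "\<And>k. (v (2 * k))\<^sup>2 \<le> c * L (x ^ (4 * k))"
  shows "carleman_seq v"
proof (rule ccontr)
  assume not: "\<not> carleman_seq v"
  define u where "u k = L (x ^ (2 * k))" for k
  have u_eq: "L (x ^ n * x ^ n) = u n" for n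
    by (simp add: u_def power_add [symmetric] mult_2)
  have u_nonneg: "0 \<le> u n" for n using psd_square [OF L, of "x ^ n"] by (simp only: u_eq)
  have cs: "(L (x ^ (m + n)))\<^sup>2 \<le> u m * u n" for m n
    using psd_cauchy_schwarz [OF L, of "x ^ m" "x ^ n"] by (simp only: u_eq power_add)
  have v_pos: "0 < v (2 * Suc k)" and sm: "summable (\<lambda>k. 1 / root (2 * Suc k) (v (2 * Suc k)))" for k
    using not unfolding carleman_seq_iff by (auto simp: not_le)
  have v_le: "(v (2 * Suc k))\<^sup>2 \<le> c * u (2 * Suc k)" for k
    using v [of "Suc k"] by (simp only: u_def mult.assoc [symmetric]) simp
  have cu: "0 < c * u (2 * Suc k)" for k
    by (rule less_le_trans [OF _ v_le]) (use v_pos [of k] in simp)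
  have c: "0 < c" using cu [of 0] u_nonneg [of "2 * Suc 0"] by (simp add: zero_less_mult_iff not_less)
  have u2_pos: "0 < u (2 * Suc k)" for k using cu [of k] c by (simp add: zero_less_mult_iff)
  \<comment> \<open>A zero at \<open>Suc k\<close> would propagate by Cauchy-Schwarz, with exponents
    split as 4 = 1 + 3, to u (2 * Suc k), which is positive by comparison with
    \<open>v\<close>.\<close>
  have u_pos: "0 < u (Suc k)" for k
  proof (rule ccontr)
    assume "\<not> 0 < u (Suc k)"
    then have "u (Suc k) = 0" using u_nonneg [of "Suc k"] by simp
    then have "L (x ^ (Suc k + 3 * Suc k)) = 0" using cs [of "Suc k" "3 * Suc k"] by simp
    moreover have "Suc k + 3 * Suc k = 2 * (2 * Suc k)" by simp
    ultimately have "u (2 * Suc k) = 0" by (simp only: u_def)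
    with u2_pos [of k] show False by simp
  qed
  have log_convex: "(u (Suc k))\<^sup>2 \<le> u k * u (Suc (Suc k))" for k
    using cs [of k "Suc (Suc k)"] by (simp add: u_def mult_2)
  have u0: "0 < u 0"
    using log_convex [of 0] u_pos [of 0] u_nonneg [of 0] by (cases "u 0 = 0") auto
  have lyapunov: "u k ^ Suc k \<le> u (Suc k) ^ k * u 0" for k
  proof (induction k)
    case (Suc k)
    have "u (Suc k) ^ k * u (Suc k) ^ Suc (Suc k) = ((u (Suc k))\<^sup>2) ^ Suc k"
      by (simp only: power_add [symmetric] power_mult [symmetric]) (simp add: mult_2)
    also have "\<dots> \<le> (u k * u (Suc (Suc k))) ^ Suc k"
      by (rule power_mono [OF log_convex]) simp
    also have "\<dots> = u k ^ Suc k * u (Suc (Suc k)) ^ Suc k" by (rule power_mult_distrib)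
    also have "\<dots> \<le> (u (Suc k) ^ k * u 0) * u (Suc (Suc k)) ^ Suc k"
      by (rule mult_right_mono [OF Suc]) (simp add: u_nonneg)
    finally have "u (Suc k) ^ k * u (Suc k) ^ Suc (Suc k) \<le> u (Suc k) ^ k * (u (Suc (Suc k)) ^ Suc k * u 0)"
      by (simp only: mult_ac)
    then show ?case by (rule mult_left_le_imp_le) (simp add: u_pos)
  qed simp
  define R where "R n = root (2 * n) (u n)" for n
  have R_pos: "0 < R (Suc n)" for n unfolding R_def by (intro real_root_gt_zero) (auto simp: u_pos)
  have R_pow: "R (Suc n) ^ (2 * Suc n) = u (Suc n)" for n
    unfolding R_def by (rule real_root_pow_pos2) (simp, rule u_nonneg)
  \<comment> \<open>For a normalised functional, with u 0 = 1, Lyapunov's inequality says that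
    \<open>R\<close> increases; otherwise the factor u 0 remains and is absorbed in
    \<open>K\<close>.\<close>
  define K where "K = max 1 (u 0)"
  have R_mono: "R (Suc n) \<le> K * R (Suc (Suc n))" for n
  proof (rule power_le_imp_le_base)
    let ?N = "2 * Suc n * Suc (Suc n)"
    have "R (Suc n) ^ Suc (?N - 1) = (R (Suc n) ^ (2 * Suc n)) ^ Suc (Suc n)"
      by (simp only: power_mult [symmetric]) simp
    also have "\<dots> \<le> u (Suc (Suc n)) ^ Suc n * u 0" unfolding R_pow by (rule lyapunov)
    also have "\<dots> \<le> u (Suc (Suc n)) ^ Suc n * K ^ ?N"
    proof (rule mult_left_mono)
      have "u 0 \<le> K ^ 1" by (simp add: K_def)
      also have "\<dots> \<le> K ^ ?N" by (rule power_increasing) (auto simp: K_def)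
      finally show "u 0 \<le> K ^ ?N" .
    qed (simp add: u_nonneg)
    also have "\<dots> = (R (Suc (Suc n)) ^ (2 * Suc (Suc n))) ^ Suc n * K ^ ?N"
      by (simp only: R_pow)
    also have "\<dots> = (K * R (Suc (Suc n))) ^ Suc (?N - 1)"
    proof -
      have N: "2 * Suc (Suc n) * Suc n = ?N" "Suc (?N - 1) = ?N" by simp_all
      show ?thesis unfolding power_mult [symmetric] N power_mult_distrib by (rule mult.commute)
    qed
    finally show "R (Suc n) ^ Suc (?N - 1) \<le> (K * R (Suc (Suc n))) ^ Suc (?N - 1)" .
    show "0 \<le> K * R (Suc (Suc n))" using R_pos [of "Suc n"] by (simp add: K_def)
  qed
  define C where "C = max 1 c"
  have C: "1 \<le> C" "c \<le> C" by (auto simp: C_def)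
  have v_root: "root (2 * Suc k) (v (2 * Suc k)) \<le> C * R (2 * Suc k)" for k
  proof (rule power_le_imp_le_base)
    let ?N = "2 * (2 * Suc k)"
    have R4: "R (2 * Suc k) ^ ?N = u (2 * Suc k)"
      using R_pow [of "2 * k + 1"] by simp
    have "root (2 * Suc k) (v (2 * Suc k)) ^ ?N = (root (2 * Suc k) (v (2 * Suc k)) ^ (2 * Suc k))\<^sup>2"
      by (simp only: power_mult [symmetric] mult.commute [of 2 "2 * Suc k"])
    also have "\<dots> = (v (2 * Suc k))\<^sup>2"
      using v_pos [of k] by (subst real_root_pow_pos2) (simp_all only: less_imp_le, simp)
    also have "\<dots> \<le> c * u (2 * Suc k)" by (rule v_le)
    also have "\<dots> \<le> C ^ ?N * u (2 * Suc k)"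
    proof (rule mult_right_mono)
      have "c \<le> C ^ 1" using C by simp
      also have "\<dots> \<le> C ^ ?N" by (rule power_increasing) (use C in auto)
      finally show "c \<le> C ^ ?N" .
    qed (rule u_nonneg)
    also have "\<dots> = (C * R (2 * Suc k)) ^ ?N" by (simp only: R4 power_mult_distrib)
    finally show "root (2 * Suc k) (v (2 * Suc k)) ^ Suc (?N - 1) \<le> (C * R (2 * Suc k)) ^ Suc (?N - 1)"
      by simp
    show "0 \<le> C * R (2 * Suc k)" using R_pos [of "2 * k + 1"] C by simp
  qed
  define h where "h k = 1 / R (2 * Suc k)" for k
  have "summable h"
  proof (rule summable_comparison_test' [OF summable_mult [OF sm, of C], where N = 0])
    fix k
    have "0 < R (2 * Suc k)" using R_pos [of "2 * k + 1"] by simp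
    moreover have "0 < root (2 * Suc k) (v (2 * Suc k))" by (rule real_root_gt_zero [OF _ v_pos]) simp
    ultimately show "norm (h k) \<le> C * (1 / root (2 * Suc k) (v (2 * Suc k)))"
      using v_root [of k] by (simp add: h_def field_simps)
  qed
  \<comment> \<open>Each term \<open>h i\<close> is used twice: at position 2 i for 1 / R (2 i + 2),
    and at 2 i + 1 to dominate 1 / R (2 i + 3) up to the factor \<open>K\<close>.\<close>
  then have "summable (\<lambda>n. if even n then h (n div 2) else h ((n - 1) div 2))"
    using sums_if [OF summable_sums summable_sums] sums_summable by blast
  then have "summable (\<lambda>n. K * (if even n then h (n div 2) else h ((n - 1) div 2)))"
    by (rule summable_mult)
  then have "summable (\<lambda>n. 1 / R (Suc (n + 1)))"
  proof (rule summable_comparison_test' [where N = 0])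
    fix n :: nat
    show "norm (1 / R (Suc (n + 1))) \<le> K * (if even n then h (n div 2) else h ((n - 1) div 2))"
    proof (cases "even n")
      case True
      then obtain i where i: "n = 2 * i" by (elim evenE)
      have "1 * h i \<le> K * h i"
        using R_pos [of "2 * i + 1"] by (intro mult_right_mono) (auto simp: K_def h_def)
      then show ?thesis using R_pos [of "n + 1"] by (simp add: i h_def)
    next
      case False
      then obtain i where i: "n = 2 * i + 1" by (elim oddE)
      have "R (2 * Suc i) \<le> K * R (Suc (2 * Suc i))" using R_mono [of "2 * i + 1"] by simp
      moreover have "0 < R (2 * Suc i)" "0 < R (Suc (2 * Suc i))"
        using R_pos [of "2 * i + 1"] R_pos [of "2 * Suc i"] by simp_all
      ultimately have "1 / R (Suc (2 * Suc i)) \<le> K * h i" by (simp add: h_def field_simps)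
      then show ?thesis using R_pos [of "n + 1"] by (simp add: i)
    qed
  qed
  then have "summable (\<lambda>n. 1 / R (Suc n))"
    using summable_iff_shift [of "\<lambda>n. 1 / R (Suc n)" 1] by simp
  moreover have "\<not> summable (\<lambda>k. 1 / R (Suc k))"
    using carl unfolding carleman_seq_iff u_def [symmetric] R_def using u_pos by (auto simp: not_le [symmetric])
  ultimately show False by contradiction
qed

section \<open>The functional calculus of one element\<close>

definition carleman_functional :: "'a::{comm_ring_1,real_algebra_1} set \<Rightarrow> ('a \<Rightarrow> real) \<Rightarrow> bool" where
  "carleman_functional S L \<longleftrightarrow> psd_functional L \<and> (\<forall>x\<in>S. carleman_seq (\<lambda>k. L (x ^ k)))"

text \<open>For linear \<open>L\<close>, the elements P for which q -> L (P * q) is again positive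
  on squares. Unlike the squares themselves, they are visibly closed under sums, and additivity of
  the measures is used on sums such as square_plus q + Q.\<close>

definition psd_element :: "('a::{comm_ring_1,real_algebra_1} \<Rightarrow> real) \<Rightarrow> 'a \<Rightarrow> bool" where
  "psd_element L P \<longleftrightarrow> (\<forall>g. 0 \<le> L (g * g * P))"

lemma carleman_functional_psd: "carleman_functional S L \<Longrightarrow> psd_functional L"
  by (simp add: carleman_functional_def)

lemma carleman_functional_linear: "carleman_functional S L \<Longrightarrow> linear L"
  by (simp add: carleman_functional_def psd_functional_def)

lemma psd_element_square: "psd_functional L \<Longrightarrow> psd_element L (p * p)"
  unfolding psd_element_def using psd_square [of L "_ * p"] by (simp add: mult_ac)

lemma psd_element_add: "linear L \<Longrightarrow> psd_element L P \<Longrightarrow> psd_element L Q \<Longrightarrow> psd_element L (P + Q)"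
  by (simp add: psd_element_def distrib_left linear_add)

lemma psd_element_scale: "linear L \<Longrightarrow> 0 \<le> c \<Longrightarrow> psd_element L P \<Longrightarrow> psd_element L (c *\<^sub>R P)"
  by (simp add: psd_element_def linear_scale)

lemma hankel_psd_element:
  assumes L: "linear L" and P: "psd_element L P"
  shows "hankel_psd (\<lambda>k. L (x ^ k * P))"
  unfolding hankel_psd_def
proof (intro allI)
  fix n and c :: "nat \<Rightarrow> real"
  let ?g = "\<Sum>i\<le>n. c i *\<^sub>R x ^ i"
  have "?g * ?g = (\<Sum>i\<le>n. \<Sum>j\<le>n. (c i * c j) *\<^sub>R x ^ (i + j))"
    by (simp add: sum_product power_add mult.commute [where 'a = real])
  then have "?g * ?g * P = (\<Sum>i\<le>n. \<Sum>j\<le>n. (c i * c j) *\<^sub>R (x ^ (i + j) * P))"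
    by (simp add: sum_distrib_right)
  then have "L (?g * ?g * P) = (\<Sum>i\<le>n. \<Sum>j\<le>n. c i * c j * L (x ^ (i + j) * P))"
    by (simp add: linear_sum [OF L] linear_scale [OF L])
  moreover have "0 \<le> L (?g * ?g * P)" using P by (simp only: psd_element_def)
  ultimately show "0 \<le> (\<Sum>i\<le>n. \<Sum>j\<le>n. c i * c j * L (x ^ (i + j) * P))" by simp
qed

text \<open>Carleman's condition is assumed for the moments of \<open>x\<close> alone.
  Cauchy-Schwarz passes it on to the moments weighted by \<open>P\<close>, at the price of the
  doubled exponent handled in \<open>carleman_seq_transfer\<close>.\<close>

lemma determinate_psd_element:
  assumes L: "carleman_functional S L" and x: "x \<in> S" and P: "psd_element L P"
  shows "determinate (\<lambda>k. L (x ^ k * P))"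
  unfolding determinate_def
proof
  show "hankel_psd (\<lambda>k. L (x ^ k * P))"
    by (rule hankel_psd_element [OF carleman_functional_linear [OF L] P])
  show "carleman_seq (\<lambda>k. L (x ^ k * P))"
  proof (rule carleman_seq_transfer)
    show "carleman_seq (\<lambda>k. L (x ^ k))" using L x by (simp add: carleman_functional_def)
    show "(L (x ^ (2 * k) * P))\<^sup>2 \<le> L (P * P) * L (x ^ (4 * k))" for k
    proof -
      have "x ^ (2 * k) * x ^ (2 * k) = x ^ (4 * k)" by (simp add: power_add [symmetric])
      with psd_cauchy_schwarz [OF carleman_functional_psd [OF L], of "x ^ (2 * k)" P]
      show ?thesis by (simp add: mult.commute)
    qed
  qed (rule carleman_functional_psd [OF L])
qed

text \<open>The stability principle of the whole construction: domination on squares by L weighted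
  with one element \<open>W\<close> gives L'(x^(2k)) \<le> L(W x^(2k)), and Cauchy-Schwarz separates
  \<open>W\<close> from the power of \<open>x\<close>. Rescaling, multiplication and the functional
  calculus are all instances.\<close>

lemma carleman_functional_dominated:
  assumes L: "carleman_functional S L" and L': "psd_functional L'"
    and dom: "\<And>g. L' (g * g) \<le> L (W * (g * g))"
  shows "carleman_functional S L'"
  unfolding carleman_functional_def
proof (intro conjI ballI L')
  fix x assume x: "x \<in> S"
  show "carleman_seq (\<lambda>k. L' (x ^ k))"
  proof (rule carleman_seq_transfer)
    show "carleman_seq (\<lambda>k. L (x ^ k))" using L x by (simp add: carleman_functional_def)
    show "(L' (x ^ (2 * k)))\<^sup>2 \<le> L (W * W) * L (x ^ (4 * k))" for k
    proof -
      have e2: "x ^ k * x ^ k = x ^ (2 * k)" by (simp add: power_add [symmetric] mult_2)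
      have e4: "x ^ (2 * k) * x ^ (2 * k) = x ^ (4 * k)" by (simp add: power_add [symmetric])
      have "0 \<le> L' (x ^ (2 * k))" using psd_square [OF L', of "x ^ k"] by (simp only: e2)
      moreover have "L' (x ^ (2 * k)) \<le> L (W * x ^ (2 * k))" using dom [of "x ^ k"] by (simp only: e2)
      ultimately have "(L' (x ^ (2 * k)))\<^sup>2 \<le> (L (W * x ^ (2 * k)))\<^sup>2" by (intro power_mono) auto
      also have "\<dots> \<le> L (W * W) * L (x ^ (2 * k) * x ^ (2 * k))"
        by (rule psd_cauchy_schwarz [OF carleman_functional_psd [OF L]])
      finally show ?thesis by (simp only: e4)
    qed
  qed (rule carleman_functional_psd [OF L])
qed

lemma carleman_functional_mult:
  assumes L: "carleman_functional S L" and P: "psd_element L P"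
  shows "carleman_functional S (\<lambda>q. L (P * q))"
proof (rule carleman_functional_dominated [OF L, where W = P])
  have "linear (\<lambda>q. L (P * q))"
    using carleman_functional_linear [OF L]
    by (auto intro!: linearI simp: distrib_left linear_add linear_scale)
  then show "psd_functional (\<lambda>q. L (P * q))"
    using P by (simp add: psd_functional_def psd_element_def mult.commute)
qed simp

definition element_measure :: "'a::{comm_ring_1,real_algebra_1} \<Rightarrow> ('a \<Rightarrow> real) \<Rightarrow> 'a \<Rightarrow> real measure" where
  "element_measure x L P = moment_measure (\<lambda>k. L (x ^ k * P))"

lemma element_measure:
  "linear L \<Longrightarrow> psd_element L P \<Longrightarrow> has_moments (element_measure x L P) (\<lambda>k. L (x ^ k * P))"
  unfolding element_measure_def by (intro moment_measure hankel_psd_element)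

lemma element_measure_unique:
  assumes "carleman_functional S L" "x \<in> S" "psd_element L P" "has_moments \<mu> (\<lambda>k. L (x ^ k * P))"
  shows "\<mu> = element_measure x L P"
  unfolding element_measure_def by (rule moment_measure_unique [OF determinate_psd_element]) (fact assms)+

definition square_plus :: "'a::{comm_ring_1,real_algebra_1} \<Rightarrow> 'a" where
  "square_plus q = (1 / 4) *\<^sub>R ((q + 1) * (q + 1))"

definition square_minus :: "'a::{comm_ring_1,real_algebra_1} \<Rightarrow> 'a" where
  "square_minus q = (1 / 4) *\<^sub>R ((q - 1) * (q - 1))"

lemma square_plus_minus: "square_plus q - square_minus q = q"
proof -
  have "(q + 1) * (q + 1) - (q - 1) * (q - 1) = q + q + q + q" by (simp add: algebra_simps)
  also have "\<dots> = (1 + 1 + 1 + 1) *\<^sub>R q" by (simp only: scaleR_left_distrib scaleR_one)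
  also have "\<dots> = 4 *\<^sub>R q" by simp
  finally show ?thesis
    unfolding square_plus_def square_minus_def scaleR_right_diff_distrib [symmetric] by simp
qed

lemma psd_element_square_plus_minus:
  "psd_functional L \<Longrightarrow> psd_element L (square_plus q)"
  "psd_functional L \<Longrightarrow> psd_element L (square_minus q)"
  unfolding square_plus_def square_minus_def
  by (simp_all add: psd_element_scale psd_element_square psd_linear)

text \<open>
  The functional \<open>q \<mapsto> \<langle>h(x) q, 1\<rangle>\<close> of the functional calculus of multiplication by \<open>x\<close>. The
  polarisation \<open>q = square_plus q - square_minus q\<close> reduces it to positive measures.
\<close>

definition spectral ::
    "'a::{comm_ring_1,real_algebra_1} \<Rightarrow> (real \<Rightarrow> real) \<Rightarrow> ('a \<Rightarrow> real) \<Rightarrow> 'a \<Rightarrow> real" where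
  "spectral x h L q = (\<integral>t. h t \<partial>element_measure x L (square_plus q))
     - (\<integral>t. h t \<partial>element_measure x L (square_minus q))"

lemma integral_element_measure_add:
  assumes L: "carleman_functional S L" and x: "x \<in> S" and h: "polynomially_bounded h"
    and P: "psd_element L P" and Q: "psd_element L Q"
  shows "(\<integral>t. h t \<partial>element_measure x L (P + Q))
    = (\<integral>t. h t \<partial>element_measure x L P) + (\<integral>t. h t \<partial>element_measure x L Q)"
proof -
  note lin = carleman_functional_linear [OF L]
  have eq: "(\<lambda>k. L (x ^ k * (P + Q))) = (\<lambda>k. L (x ^ k * P) + L (x ^ k * Q))"
    by (simp add: distrib_left linear_add [OF lin])
  have "determinate (\<lambda>k. L (x ^ k * (P + Q)))"
    by (rule determinate_psd_element [OF L x psd_element_add [OF lin P Q]])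
  then show ?thesis
    unfolding element_measure_def eq
    by (intro integral_moment_measure_add hankel_psd_element lin P Q h)
qed

lemma integral_element_measure_scale:
  assumes L: "carleman_functional S L" and x: "x \<in> S" and h: "polynomially_bounded h"
    and P: "psd_element L P" and c: "0 \<le> c"
  shows "(\<integral>t. h t \<partial>element_measure x L (c *\<^sub>R P)) = c * (\<integral>t. h t \<partial>element_measure x L P)"
proof -
  note lin = carleman_functional_linear [OF L]
  have eq: "(\<lambda>k. L (x ^ k * (c *\<^sub>R P))) = (\<lambda>k. c * L (x ^ k * P))"
    by (simp add: linear_scale [OF lin])
  have "determinate (\<lambda>k. L (x ^ k * (c *\<^sub>R P)))"
    by (rule determinate_psd_element [OF L x psd_element_scale [OF lin c P]])
  then show ?thesis
    unfolding element_measure_def eq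
    by (intro integral_moment_measure_scale hankel_psd_element lin P c h)
qed

text \<open>The value does not depend on how an element is written as a difference of psd elements:
  P + square_minus = Q + square_plus, and integrals are additive on such elements. This makes the
  fixed polarisation, which is quadratic in its argument, yield a linear functional.\<close>

lemma spectral_diff:
  assumes L: "carleman_functional S L" and x: "x \<in> S" and h: "polynomially_bounded h"
    and P: "psd_element L P" and Q: "psd_element L Q"
  shows "spectral x h L (P - Q)
    = (\<integral>t. h t \<partial>element_measure x L P) - (\<integral>t. h t \<partial>element_measure x L Q)"
proof -
  let ?p = "square_plus (P - Q)" and ?m = "square_minus (P - Q)"
  note pm = psd_element_square_plus_minus [OF carleman_functional_psd [OF L]]
  have "?p + Q = ?m + P" using square_plus_minus [of "P - Q"] by (simp add: algebra_simps)
  then have "(\<integral>t. h t \<partial>element_measure x L ?p) + (\<integral>t. h t \<partial>element_measure x L Q)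
    = (\<integral>t. h t \<partial>element_measure x L ?m) + (\<integral>t. h t \<partial>element_measure x L P)"
    using integral_element_measure_add [OF L x h pm(1) Q] integral_element_measure_add [OF L x h pm(2) P]
    by metis
  then show ?thesis by (simp add: spectral_def)
qed

lemma spectral_psd_element:
  assumes L: "carleman_functional S L" and x: "x \<in> S" and h: "polynomially_bounded h"
    and P: "psd_element L P"
  shows "spectral x h L P = (\<integral>t. h t \<partial>element_measure x L P)"
proof -
  note lin = carleman_functional_linear [OF L]
  have P0: "psd_element L 0" using linear_0 [OF lin] by (simp add: psd_element_def)
  have "(\<integral>t. h t \<partial>element_measure x L (0 *\<^sub>R P)) = 0"
    using integral_element_measure_scale [OF L x h P, of 0] by simp
  then show ?thesis using spectral_diff [OF L x h P P0] by simp
qed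

lemma linear_spectral:
  assumes L: "carleman_functional S L" and x: "x \<in> S" and h: "polynomially_bounded h"
  shows "linear (spectral x h L)"
proof (rule linearI)
  let ?E = "\<lambda>P. \<integral>t. h t \<partial>element_measure x L P"
  note lin = carleman_functional_linear [OF L]
  note pm = psd_element_square_plus_minus [OF carleman_functional_psd [OF L]]
  note pm_add = psd_element_add [OF lin pm(1) pm(1)] psd_element_add [OF lin pm(2) pm(2)]
  fix q r :: 'a and c :: real
  have "q + r = (square_plus q + square_plus r) - (square_minus q + square_minus r)"
    using square_plus_minus [of q] square_plus_minus [of r] by (simp add: algebra_simps)
  then have "spectral x h L (q + r) = ?E (square_plus q + square_plus r) - ?E (square_minus q + square_minus r)"
    using spectral_diff [OF L x h pm_add, of q r q r] by metis
  also have "\<dots> = spectral x h L q + spectral x h L r"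
    by (simp add: spectral_def integral_element_measure_add [OF L x h] pm)
  finally show "spectral x h L (q + r) = spectral x h L q + spectral x h L r" .
  show "spectral x h L (c *\<^sub>R q) = c *\<^sub>R spectral x h L q"
  proof (cases "0 \<le> c")
    case True
    have "c *\<^sub>R q = c *\<^sub>R square_plus q - c *\<^sub>R square_minus q"
      by (simp add: square_plus_minus flip: scaleR_right_diff_distrib)
    then have "spectral x h L (c *\<^sub>R q) = ?E (c *\<^sub>R square_plus q) - ?E (c *\<^sub>R square_minus q)"
      using spectral_diff [OF L x h psd_element_scale [OF lin True pm(1)] psd_element_scale [OF lin True pm(2)], of q q] by metis
    then show ?thesis
      by (simp add: spectral_def integral_element_measure_scale [OF L x h] pm True right_diff_distrib)
  next
    \<comment> \<open>Scaling is available for nonnegative factors only; a negative one exchanges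
      the two squares of the polarisation.\<close>
    case False
    then have c: "0 \<le> - c" by simp
    have "c *\<^sub>R q = (- c) *\<^sub>R square_minus q - (- c) *\<^sub>R square_plus q"
      using arg_cong [OF square_plus_minus [of q], of "scaleR c"] by (simp add: scaleR_right_diff_distrib)
    then have "spectral x h L (c *\<^sub>R q) = ?E ((- c) *\<^sub>R square_minus q) - ?E ((- c) *\<^sub>R square_plus q)"
      using spectral_diff [OF L x h psd_element_scale [OF lin c pm(2)] psd_element_scale [OF lin c pm(1)], of q q] by metis
    also have "\<dots> = (- c) * ?E (square_minus q) - (- c) * ?E (square_plus q)"
      by (simp only: integral_element_measure_scale [OF L x h _ c] pm)
    finally show ?thesis by (simp add: spectral_def algebra_simps)
  qed
qed

text \<open>By polarisation the squares span. Identities of functionals are checked on squares,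
  where \<open>spectral\<close> is a single integral against a positive measure.\<close>

lemma linear_eq_on_squares:
  assumes "linear f" "linear g" and eq: "\<And>p. f (p * p) = g (p * p)"
  shows "f = (g :: 'a::{comm_ring_1,real_algebra_1} \<Rightarrow> real)"
proof
  fix q
  have "f q = f (square_plus q) - f (square_minus q)"
    using linear_diff [OF assms(1)] square_plus_minus by metis
  also have "\<dots> = g (square_plus q) - g (square_minus q)"
    by (simp add: square_plus_def square_minus_def linear_scale assms(1,2) eq)
  also have "\<dots> = g q"
    using linear_diff [OF assms(2)] square_plus_minus by metis
  finally show "f q = g q" .
qed

lemma integrable_element_measure:
  assumes "linear L" "psd_element L P" "polynomially_bounded h"
  shows "integrable (element_measure x L P) h"
  using assms by (intro integrable_polynomially_bounded [OF element_measure])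

lemma spectral_bound:
  assumes L: "linear L" and P: "psd_element L P" and h: "polynomially_bounded h"
    and le: "\<And>t. h t \<le> C * (1 + t ^ (2 * m))"
  shows "(\<integral>t. h t \<partial>element_measure x L P) \<le> L (C *\<^sub>R (1 + x ^ (2 * m)) * P)"
proof -
  note mom = element_measure [OF L P, of x]
  have i: "integrable (element_measure x L P) (\<lambda>t. t ^ k)" for k
    using mom by (simp add: has_moments_def)
  have i0: "integrable (element_measure x L P) (\<lambda>t. 1 :: real)" using i [of 0] by simp
  have e: "(\<integral>t. t ^ k \<partial>element_measure x L P) = L (x ^ k * P)" for k
    using mom by (simp add: has_moments_def)
  have e0: "(\<integral>t. 1 \<partial>element_measure x L P) = L P" using e [of 0] by simp
  have "(\<integral>t. h t \<partial>element_measure x L P) \<le> (\<integral>t. C * (1 + t ^ (2 * m)) \<partial>element_measure x L P)"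
    by (intro integral_mono integrable_element_measure L P h integrable_mult_right
        Bochner_Integration.integrable_add i i0 le)
  also have "\<dots> = C * (L P + L (x ^ (2 * m) * P))"
    using Bochner_Integration.integral_add [OF i0 i [of "2 * m"]] e [of "2 * m"] e0 by simp
  also have "\<dots> = L (C *\<^sub>R (1 + x ^ (2 * m)) * P)"
    by (simp add: linear_scale [OF L] linear_add [OF L] distrib_right)
  finally show ?thesis .
qed

lemma spectral_square:
  assumes L: "carleman_functional S L" and x: "x \<in> S" and h: "polynomially_bounded h"
  shows "spectral x h L (p * p) = (\<integral>t. h t \<partial>element_measure x L (p * p))"
  by (rule spectral_psd_element [OF L x h psd_element_square [OF carleman_functional_psd [OF L]]])

text \<open>The growth bound of \<open>h\<close> turns into the algebra element C (1 + x^(2m)),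
  which dominates the new functional on squares. Hence the calculus can be iterated.\<close>

lemma carleman_functional_spectral:
  assumes L: "carleman_functional S L" and x: "x \<in> S" and h: "polynomially_bounded h"
    and nn: "\<And>t. 0 \<le> h t"
  shows "carleman_functional S (spectral x h L)"
proof -
  note lin = carleman_functional_linear [OF L]
  note sq = psd_element_square [OF carleman_functional_psd [OF L]]
  obtain C m where C: "\<And>t. \<bar>h t\<bar> \<le> C * (1 + t ^ (2 * m))"
    using h by (auto simp: polynomially_bounded_def)
  have le: "h t \<le> C * (1 + t ^ (2 * m))" for t using C [of t] by linarith
  show ?thesis
  proof (rule carleman_functional_dominated [OF L, where W = "C *\<^sub>R (1 + x ^ (2 * m))"])
    show "psd_functional (spectral x h L)"
      unfolding psd_functional_def using linear_spectral [OF L x h]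
      by (auto simp: spectral_square [OF L x h] nn intro!: Bochner_Integration.integral_nonneg)
    show "spectral x h L (g * g) \<le> L (C *\<^sub>R (1 + x ^ (2 * m)) * (g * g))" for g
      unfolding spectral_square [OF L x h] by (rule spectral_bound [OF lin sq h le])
  qed
qed

lemma spectral_le:
  assumes L: "carleman_functional S L" and x: "x \<in> S"
    and h: "h \<in> borel_measurable borel" "\<And>t. 0 \<le> h t \<and> h t \<le> 1"
  shows "spectral x h L (p * p) \<le> L (p * p)"
proof -
  note sq = psd_element_square [OF carleman_functional_psd [OF L]]
  have pb: "polynomially_bounded h" using h by (rule polynomially_bounded_unit)
  have "(\<integral>t. h t \<partial>element_measure x L (p * p)) \<le> (\<integral>t. t ^ 0 \<partial>element_measure x L (p * p))"
    using h pb by (intro integral_mono integrable_element_measure [OF carleman_functional_linear [OF L] sq]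
        polynomially_bounded_power) auto
  also have "\<dots> = L (x ^ 0 * (p * p))"
    using element_measure [OF carleman_functional_linear [OF L] sq, of x p] by (simp only: has_moments_def)
  finally show ?thesis using spectral_square [OF L x pb] by simp
qed

lemma spectral_power:
  assumes L: "carleman_functional S L" and x: "x \<in> S"
  shows "spectral x (\<lambda>t. t ^ k) L = (\<lambda>q. L (x ^ k * q))"
proof (rule linear_eq_on_squares)
  note sq = psd_element_square [OF carleman_functional_psd [OF L]]
  show "linear (spectral x (\<lambda>t. t ^ k) L)"
    by (rule linear_spectral [OF L x polynomially_bounded_power])
  show "linear (\<lambda>q. L (x ^ k * q))"
    using carleman_functional_linear [OF L]
    by (auto intro!: linearI simp: distrib_left linear_add linear_scale)
  show "spectral x (\<lambda>t. t ^ k) L (p * p) = L (x ^ k * (p * p))" for p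
    using element_measure [OF carleman_functional_linear [OF L] sq, of x p]
    by (simp add: spectral_square [OF L x polynomially_bounded_power] has_moments_def)
qed

lemma spectral_add:
  assumes L: "carleman_functional S L" and x: "x \<in> S"
    and f: "polynomially_bounded f" and g: "polynomially_bounded g"
  shows "spectral x (\<lambda>t. f t + g t) L = (\<lambda>q. spectral x f L q + spectral x g L q)"
proof (rule ext)
  fix q
  note pm = psd_element_square_plus_minus [OF carleman_functional_psd [OF L]]
  note int = integrable_element_measure [OF carleman_functional_linear [OF L]]
  show "spectral x (\<lambda>t. f t + g t) L q = spectral x f L q + spectral x g L q"
    by (simp add: spectral_def Bochner_Integration.integral_add [OF int [OF _ f] int [OF _ g]] pm)
qed

lemma spectral_cmult: "spectral x (\<lambda>t. c * f t) L = (\<lambda>q. c * spectral x f L q)"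
  by (rule ext) (simp add: spectral_def right_diff_distrib)

text \<open>Linearity in the functional, again from determinacy of the sum. It allows an outer
  calculus to be applied term by term to a sum produced by an inner one.\<close>

lemma spectral_add_functional:
  assumes L: "carleman_functional S L" and M: "carleman_functional S M"
    and LM: "carleman_functional S (\<lambda>q. L q + M q)" and x: "x \<in> S" and h: "polynomially_bounded h"
  shows "spectral x h (\<lambda>q. L q + M q) = (\<lambda>q. spectral x h L q + spectral x h M q)"
proof (rule linear_eq_on_squares)
  show "linear (spectral x h (\<lambda>q. L q + M q))" by (rule linear_spectral [OF LM x h])
  show "linear (\<lambda>q. spectral x h L q + spectral x h M q)"
    using linear_spectral [OF L x h] linear_spectral [OF M x h]
    by (auto intro!: linearI simp: linear_add linear_scale algebra_simps)
  fix p
  have sq: "psd_element N (p * p)" if "carleman_functional S N" for N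
    by (rule psd_element_square [OF carleman_functional_psd [OF that]])
  have "(\<integral>t. h t \<partial>moment_measure (\<lambda>k. L (x ^ k * (p * p)) + M (x ^ k * (p * p))))
    = (\<integral>t. h t \<partial>moment_measure (\<lambda>k. L (x ^ k * (p * p)))) + (\<integral>t. h t \<partial>moment_measure (\<lambda>k. M (x ^ k * (p * p))))"
    using determinate_psd_element [OF LM x sq [OF LM]] determinate_psd_element [OF L x sq [OF L]]
      determinate_psd_element [OF M x sq [OF M]]
    by (intro integral_moment_measure_add h) (auto simp: determinate_def)
  then show "spectral x h (\<lambda>q. L q + M q) (p * p) = spectral x h L (p * p) + spectral x h M (p * p)"
    by (simp add: spectral_square [OF LM x h] spectral_square [OF L x h] spectral_square [OF M x h] element_measure_def)
qed

section \<open>Commutation of functional calculi\<close>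

lemma spectral_scale_functional:
  assumes L: "carleman_functional S L" and cL: "carleman_functional S (\<lambda>q. c * L q)" and c: "0 \<le> c"
    and x: "x \<in> S" and h: "polynomially_bounded h"
  shows "spectral x h (\<lambda>q. c * L q) = (\<lambda>q. c * spectral x h L q)"
proof (rule linear_eq_on_squares)
  show "linear (spectral x h (\<lambda>q. c * L q))" by (rule linear_spectral [OF cL x h])
  show "linear (\<lambda>q. c * spectral x h L q)"
    using linear_spectral [OF L x h]
    by (auto intro!: linearI simp: linear_add linear_scale algebra_simps)
  fix p
  have sq: "psd_element N (p * p)" if "carleman_functional S N" for N
    by (rule psd_element_square [OF carleman_functional_psd [OF that]])
  have "(\<integral>t. h t \<partial>moment_measure (\<lambda>k. c * L (x ^ k * (p * p))))
    = c * (\<integral>t. h t \<partial>moment_measure (\<lambda>k. L (x ^ k * (p * p))))"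
    using determinate_psd_element [OF cL x sq [OF cL]] determinate_psd_element [OF L x sq [OF L]]
    by (intro integral_moment_measure_scale h c) (auto simp: determinate_def)
  then show "spectral x h (\<lambda>q. c * L q) (p * p) = c * spectral x h L (p * p)"
    by (simp add: spectral_square [OF cL x h] spectral_square [OF L x h] element_measure_def)
qed

text \<open>Odd powers change sign, while positivity of a new functional requires a nonnegative
  function. The squares with e = 1 and e = -1 stand in for t^k: their difference is 4 t^k, and on
  the algebra side they are multiplication by a square.\<close>

lemma polynomially_bounded_power_plus_square:
  "polynomially_bounded (\<lambda>t. (t ^ k + e)\<^sup>2)"
proof -
  have "(\<lambda>t :: real. (t ^ k + e)\<^sup>2) = (\<lambda>t. (t ^ (k + k) + (2 * e) * t ^ k) + e\<^sup>2)"
    by (simp add: fun_eq_iff power2_eq_square power_add algebra_simps)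
  then show ?thesis
    by (simp only:) (intro polynomially_bounded_add polynomially_bounded_power polynomially_bounded_cmult
        polynomially_bounded_const)
qed

lemma power_eq_squares: "(t :: real) ^ k = ((t ^ k + 1)\<^sup>2 - (t ^ k + - 1)\<^sup>2) / 4"
  by (simp add: power2_eq_square algebra_simps)

lemma spectral_power_plus_square:
  assumes L: "carleman_functional S L" and x: "x \<in> S"
  shows "spectral x (\<lambda>t. (t ^ k + e)\<^sup>2) L = (\<lambda>q. L ((x ^ k + of_real e) * (x ^ k + of_real e) * q))"
proof -
  note pb = polynomially_bounded_add polynomially_bounded_power polynomially_bounded_cmult
  note lin = linear_add [OF carleman_functional_linear [OF L]] linear_scale [OF carleman_functional_linear [OF L]]
  have eq: "(\<lambda>t :: real. (t ^ k + e)\<^sup>2) = (\<lambda>t. (t ^ (k + k) + (2 * e) * t ^ k) + e\<^sup>2 * t ^ 0)"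
    by (simp add: fun_eq_iff power2_eq_square power_add algebra_simps)
  have "spectral x (\<lambda>t. (t ^ k + e)\<^sup>2) L
    = (\<lambda>q. (L (x ^ (k + k) * q) + (2 * e) * L (x ^ k * q)) + e\<^sup>2 * L (x ^ 0 * q))"
    unfolding eq
    by (subst spectral_add [OF L x] spectral_power [OF L x] spectral_cmult; (intro pb)?)+ (rule refl)
  also have "\<dots> = (\<lambda>q. L ((x ^ k + of_real e) * (x ^ k + of_real e) * q))"
  proof
    fix q
    have "(x ^ k + of_real e) * (x ^ k + of_real e) * q
      = x ^ (k + k) * q + (2 * e) *\<^sub>R (x ^ k * q) + e\<^sup>2 *\<^sub>R (x ^ 0 * q)"
      by (simp add: of_real_def power_add power2_eq_square algebra_simps scaleR_2 [symmetric])
        (simp add: scaleR_scaleR [symmetric] scaleR_2 mult.commute del: scaleR_scaleR)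
    then show "(L (x ^ (k + k) * q) + (2 * e) * L (x ^ k * q)) + e\<^sup>2 * L (x ^ 0 * q)
      = L ((x ^ k + of_real e) * (x ^ k + of_real e) * q)"
      by (simp only: lin) simp
  qed
  finally show ?thesis .
qed

lemma spectral_mult_square:
  assumes L: "carleman_functional S L" and y: "y \<in> S" and h: "polynomially_bounded h"
  shows "spectral y h (\<lambda>q. L (r * r * q)) (p * p) = spectral y h L ((r * p) * (r * p))"
proof -
  have M: "carleman_functional S (\<lambda>q. L (r * r * q))"
    by (rule carleman_functional_mult [OF L psd_element_square [OF carleman_functional_psd [OF L]]])
  have "element_measure y (\<lambda>q. L (r * r * q)) (p * p) = element_measure y L ((r * p) * (r * p))"
    by (simp add: element_measure_def mult_ac)
  then show ?thesis by (simp only: spectral_square [OF M y h] spectral_square [OF L y h])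
qed

lemma square_difference_element:
  fixes x p :: "'a::{comm_ring_1,real_algebra_1}"
  assumes "linear M"
  shows "M (((x ^ k + of_real 1) * p) * ((x ^ k + of_real 1) * p))
       - M (((x ^ k + of_real (- 1)) * p) * ((x ^ k + of_real (- 1)) * p)) = 4 * (M (x ^ k * (p * p)) :: real)"
proof -
  let ?z = "x ^ k * (p * p)"
  have "((x ^ k + of_real 1) * p) * ((x ^ k + of_real 1) * p)
      = ((x ^ k + of_real (- 1)) * p) * ((x ^ k + of_real (- 1)) * p) + (?z + ?z + ?z + ?z)"
    by (simp add: algebra_simps)
  then have "M (((x ^ k + of_real 1) * p) * ((x ^ k + of_real 1) * p))
      = M (((x ^ k + of_real (- 1)) * p) * ((x ^ k + of_real (- 1)) * p)) + (M ?z + M ?z + M ?z + M ?z)"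
    by (simp only: linear_add [OF assms])
  then show ?thesis by simp
qed

text \<open>
  For fixed \<open>p\<close> and \<open>0 \<le> g \<le> 1\<close> the set function \<open>B \<mapsto> spectral y g (spectral x (indicator B) L) (p * p)\<close>
  is a measure. Its moments show that it is the measure of \<open>x\<close> with respect to \<open>spectral y g L\<close>.
\<close>

lemma spectral_commute:
  assumes L: "carleman_functional S L" and x: "x \<in> S" and y: "y \<in> S"
    and g: "g \<in> borel_measurable borel" "\<And>t. 0 \<le> g t \<and> g t \<le> 1"
    and h: "polynomially_bounded h" "\<And>t. 0 \<le> h t"
  shows "spectral x h (spectral y g L) = spectral y g (spectral x h L)"
proof (rule linear_eq_on_squares)
  have pg: "polynomially_bounded g" using g by (rule polynomially_bounded_unit)
  have gL: "carleman_functional S (spectral y g L)"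
    using carleman_functional_spectral [OF L y pg] g by blast
  have T: "carleman_functional S (spectral x f L)" if "polynomially_bounded f" "\<And>t. 0 \<le> f t" for f
    by (rule carleman_functional_spectral [OF L x that])
  show "linear (spectral x h (spectral y g L))" by (rule linear_spectral [OF gL x h(1)])
  show "linear (spectral y g (spectral x h L))" by (rule linear_spectral [OF T [OF h] y pg])
  fix p
  define G where "G f = spectral y g (spectral x f L) (p * p)" for f
  define \<mu> where "\<mu> = element_measure x L (p * p)"
  have mom_\<mu>: "has_moments \<mu> (\<lambda>k. L (x ^ k * (p * p)))"
    unfolding \<mu>_def
    by (intro element_measure carleman_functional_linear [OF L] psd_element_square carleman_functional_psd [OF L])
  note [measurable_cong] = has_moments_sets [OF mom_\<mu>]
  interpret \<mu>: finite_measure \<mu> using mom_\<mu> by (simp add: has_moments_def)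
  have G_nonneg: "0 \<le> G f" if "polynomially_bounded f" "\<And>t. 0 \<le> f t" for f
    unfolding G_def spectral_square [OF T [OF that] y pg] using g by (intro Bochner_Integration.integral_nonneg) auto
  \<comment> \<open>As g \<le> 1, \<open>G\<close> is dominated by integration against the measure
    \<mu> of \<open>x\<close>. This yields continuity at the empty set, hence countable additivity,
    and later monotone convergence.\<close>
  have G_le: "G f \<le> (\<integral>t. f t \<partial>\<mu>)" if "polynomially_bounded f" "\<And>t. 0 \<le> f t" for f
    using spectral_le [OF T [OF that] y g] spectral_square [OF L x that(1)] by (simp add: G_def \<mu>_def)
  have G_add: "G (\<lambda>t. f t + f' t) = G f + G f'"
    if f: "polynomially_bounded f" "\<And>t. 0 \<le> f t" and f': "polynomially_bounded f'" "\<And>t. 0 \<le> f' t" for f f'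
  proof -
    have sum: "carleman_functional S (\<lambda>q. spectral x f L q + spectral x f' L q)"
      unfolding spectral_add [OF L x f(1) f'(1), symmetric]
      by (rule T) (use f f' in \<open>auto intro: polynomially_bounded_add\<close>)
    show ?thesis
      unfolding G_def spectral_add [OF L x f(1) f'(1)]
        spectral_add_functional [OF T [OF f] T [OF f'] sum y pg] ..
  qed
  have G_cmult: "G (\<lambda>t. c * f t) = c * G f"
    if f: "polynomially_bounded f" "\<And>t. 0 \<le> f t" and c: "0 \<le> c" for f c
  proof -
    have "carleman_functional S (\<lambda>q. c * spectral x f L q)"
      unfolding spectral_cmult [symmetric]
      by (rule T) (use f c in \<open>auto intro: polynomially_bounded_cmult\<close>)
    then show ?thesis
      unfolding G_def spectral_cmult using spectral_scale_functional [OF T [OF f] _ c y pg] by metis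
  qed
  have ind: "polynomially_bounded (indicator A)" "\<And>t. (0 :: real) \<le> indicator A t"
    if "A \<in> sets borel" for A :: "real set"
    using that by (auto intro: polynomially_bounded_indicator)
  define \<rho> where "\<rho> = measure_of UNIV (sets borel) (\<lambda>A. ennreal (G (indicator A)))"
  have sets_\<rho> [measurable_cong, simp]: "sets \<rho> = sets borel"
    unfolding \<rho>_def by (subst sets_measure_of) (auto simp: borel_def sigma_sets_sigma_sets_eq)
  have G_empty: "G (indicator {}) = 0"
  proof (rule antisym)
    have "G (indicator {}) \<le> (\<integral>t. indicator {} t \<partial>\<mu>)" by (intro G_le ind; simp)
    moreover have "(\<integral>t. indicator {} t \<partial>\<mu>) = (0 :: real)" by simp
    ultimately show "G (indicator {}) \<le> 0" by (simp only:)
    show "0 \<le> G (indicator {})" by (intro G_nonneg ind; simp)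
  qed
  have em: "emeasure \<rho> A = ennreal (G (indicator A))" if "A \<in> sets borel" for A
  proof (rule emeasure_measure_of [OF \<rho>_def])
    show pos: "positive (sets \<rho>) (\<lambda>A. ennreal (G (indicator A)))"
      by (simp add: positive_def G_empty)
    show "countably_additive (sets \<rho>) (\<lambda>A. ennreal (G (indicator A)))"
    proof (rule sets.empty_continuous_imp_countably_additive)
      show "additive (sets \<rho>) (\<lambda>A. ennreal (G (indicator A)))"
        unfolding additive_def
      proof (intro ballI impI)
        fix A B assume A: "A \<in> sets \<rho>" and B: "B \<in> sets \<rho>" and "A \<inter> B = {}"
        then have "indicator (A \<union> B) = (\<lambda>t :: real. indicator A t + indicator B t :: real)"
          by (auto simp: fun_eq_iff indicator_def)
        then show "ennreal (G (indicator (A \<union> B))) = ennreal (G (indicator A)) + ennreal (G (indicator B))"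
          using A B by (simp add: G_add ind G_nonneg flip: ennreal_plus)
      qed
      fix A :: "nat \<Rightarrow> real set"
      assume A: "range A \<subseteq> sets \<rho>" "decseq A" "(\<Inter>i. A i) = {}"
      have "(\<lambda>i. emeasure \<mu> (A i)) \<longlonglongrightarrow> emeasure \<mu> (\<Inter>i. A i)"
        using A has_moments_sets [OF mom_\<mu>] by (intro Lim_emeasure_decseq) auto
      then have lim: "(\<lambda>i. emeasure \<mu> (A i)) \<longlonglongrightarrow> 0" using A by simp
      show "(\<lambda>i. ennreal (G (indicator (A i)))) \<longlonglongrightarrow> 0"
      proof (rule tendsto_sandwich [OF _ _ tendsto_const lim])
        show "\<forall>\<^sub>F i in sequentially. ennreal (G (indicator (A i))) \<le> emeasure \<mu> (A i)"
        proof (intro always_eventually allI)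
          fix i
          have Ai: "A i \<in> sets borel" using A(1) by auto
          have "G (indicator (A i)) \<le> measure \<mu> (A i)"
            using G_le [OF ind [OF Ai]] Ai has_moments_sets [OF mom_\<mu>] sets.sets_into_space [of "A i" \<mu>]
            by (simp add: Int_absorb2)
          then show "ennreal (G (indicator (A i))) \<le> emeasure \<mu> (A i)"
            by (simp add: \<mu>.emeasure_eq_measure ennreal_leI)
        qed
      qed simp
    qed (use pos in auto)
  qed (use that in \<open>auto simp: positive_def G_empty\<close>)
  \<comment> \<open>The induction runs over extended nonnegative functions, on which
    \<open>G\<close> is not defined. The real function \<open>f\<close> is therefore quantified
    inside the statement, together with its growth bound.\<close>
  have *: "\<forall>f. polynomially_bounded f \<longrightarrow> (\<forall>t. 0 \<le> f t \<and> u t = ennreal (f t)) \<longrightarrow> (\<integral>\<^sup>+t. u t \<partial>\<rho>) = ennreal (G f)"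
    if "u \<in> borel_measurable borel" for u
    using that
  proof (induction rule: borel_measurable_induct)
    case (cong f g)
    have "f = g" using cong(3) by (intro ext) simp
    with cong(4) show ?case by (simp only:)
  next
    case (set A)
    show ?case
    proof (intro allI impI)
      fix f :: "real \<Rightarrow> real" assume f: "\<forall>t. 0 \<le> f t \<and> indicator A t = ennreal (f t)"
      have "f t = indicator A t" for t
      proof -
        have "ennreal (f t) = ennreal (indicator A t)" using f by (simp add: ennreal_indicator)
        then show ?thesis using f by (subst (asm) ennreal_inj) auto
      qed
      then have "f = indicator A" by (rule ext)
      then show "(\<integral>\<^sup>+t. indicator A t \<partial>\<rho>) = ennreal (G f)" using set by (simp add: em)
    qed
  next
    case (mult u c)
    show ?case
    proof (intro allI impI)
      fix f assume f: "polynomially_bounded f" "\<forall>t. 0 \<le> f t \<and> c * u t = ennreal (f t)"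
      show "(\<integral>\<^sup>+t. c * u t \<partial>\<rho>) = ennreal (G f)"
      \<comment> \<open>For c = 0 the growth bound of c * u says nothing about \<open>u\<close>, so
        the induction hypothesis does not apply.\<close>
      proof (cases "c = 0")
        case True
        have "f = indicator {}" using f(2) True by (auto simp: fun_eq_iff ennreal_eq_0_iff intro: antisym)
        then show ?thesis using True G_empty by simp
      next
        case False
        define r where "r = enn2real c"
        have r: "c = ennreal r" "0 < r"
          using mult(1) False by (auto simp: r_def enn2real_positive_iff zero_less_iff_neq_zero)
        have "u t = ennreal (1 / r * f t)" for t
        proof -
          have "u t = ennreal (1 / r) * (c * u t)"
            using r by (simp add: mult.assoc [symmetric] ennreal_mult' [symmetric])
          also have "\<dots> = ennreal (1 / r) * ennreal (f t)" using f(2) by simp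
          also have "\<dots> = ennreal (1 / r * f t)" by (rule ennreal_mult' [symmetric]) (use r in simp)
          finally show ?thesis .
        qed
        moreover have fr: "polynomially_bounded (\<lambda>t. 1 / r * f t)" "\<And>t. 0 \<le> 1 / r * f t"
          using f r by (auto intro: polynomially_bounded_cmult [of f "1 / r", simplified])
        ultimately have "(\<integral>\<^sup>+t. u t \<partial>\<rho>) = ennreal (G (\<lambda>t. 1 / r * f t))"
          using mult.IH by blast
        moreover have "G f = r * G (\<lambda>t. 1 / r * f t)"
          using G_cmult [OF fr, of r] r by simp
        ultimately show ?thesis
          using r G_nonneg [OF fr] mult(2) by (simp add: nn_integral_cmult ennreal_mult)
      qed
    qed
  next
    case (add u v)
    show ?case
    proof (intro allI impI)
      fix f assume f: "polynomially_bounded f" "\<forall>t. 0 \<le> f t \<and> v t + u t = ennreal (f t)"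
      define fu where "fu t = enn2real (u t)" for t
      define fv where "fv t = enn2real (v t)" for t
      have uv: "u t = ennreal (fu t)" "v t = ennreal (fv t)" for t
        using add by (auto simp: fu_def fv_def)
      have nn: "0 \<le> fu t" "0 \<le> fv t" for t by (auto simp: fu_def fv_def)
      have "ennreal (fv t + fu t) = ennreal (f t)" for t using f(2) uv nn by simp
      then have f_eq: "f t = fv t + fu t" for t using f(2) nn by (metis add_nonneg_nonneg ennreal_inj)
      have pb: "polynomially_bounded fu" "polynomially_bounded fv"
        using add.hyps(1) add.hyps(3) nn by (auto simp: fu_def [abs_def] fv_def [abs_def] f_eq [unfolded fu_def fv_def]
            intro!: polynomially_bounded_le [OF _ _ f(1)])
      have "f = (\<lambda>t. fv t + fu t)" by (rule ext) (rule f_eq)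
      then have "G f = G fv + G fu" using G_add [OF pb(2) nn(2) pb(1) nn(1)] by (simp only:)
      moreover have "(\<integral>\<^sup>+t. u t \<partial>\<rho>) = ennreal (G fu)" "(\<integral>\<^sup>+t. v t \<partial>\<rho>) = ennreal (G fv)"
        using add.IH uv nn pb by blast+
      ultimately show "(\<integral>\<^sup>+t. v t + u t \<partial>\<rho>) = ennreal (G f)"
        using add.hyps(1) add.hyps(3) G_nonneg [OF pb(1) nn(1)] G_nonneg [OF pb(2) nn(2)] by (simp add: nn_integral_add)
    qed
  next
    case (seq U)
    show ?case
    proof (intro allI impI)
      fix f assume f: "polynomially_bounded f" "\<forall>t. 0 \<le> f t \<and> (SUP i. U i) t = ennreal (f t)"
      define F where "F i t = enn2real (U i t)" for i t
      have UF: "U i t = ennreal (F i t)" for i t using seq(2) by (auto simp: F_def)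
      have F_nonneg: "0 \<le> F i t" for i t by (simp add: F_def)
      have "U i t \<le> (SUP i. U i) t" for i t by (simp add: image_comp) (rule SUP_upper, simp)
      then have F_le: "F i t \<le> f t" for i t
        using f(2) UF by (metis ennreal_le_iff)
      have F_meas: "F i \<in> borel_measurable borel" for i
        unfolding F_def [abs_def] using seq(1) by measurable
      have pb: "polynomially_bounded (F i)" for i
        by (rule polynomially_bounded_le [OF F_meas _ f(1)]) (use F_nonneg F_le in auto)
      have inc: "incseq (\<lambda>i. U i t)" for t using seq.hyps(3) by (auto simp: incseq_def le_fun_def)
      have lim_F: "(\<lambda>i. F i t) \<longlonglongrightarrow> f t" for t
      proof -
        have "(\<lambda>i. U i t) \<longlonglongrightarrow> ennreal (f t)"
          using LIMSEQ_SUP [OF inc [of t]] f(2) by (simp add: image_comp)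
        then show ?thesis unfolding F_def using f(2) by (intro tendsto_enn2real) auto
      qed
      have [measurable]: "f \<in> borel_measurable borel" "\<And>i. F i \<in> borel_measurable borel"
        using f(1) F_meas by (auto simp: polynomially_bounded_def)
      have lim_\<mu>: "(\<lambda>i. \<integral>t. F i t \<partial>\<mu>) \<longlonglongrightarrow> (\<integral>t. f t \<partial>\<mu>)"
        by (rule integral_dominated_convergence [where w = f])
          (use F_nonneg F_le lim_F in \<open>auto intro: integrable_polynomially_bounded [OF mom_\<mu> f(1)]\<close>)
      \<comment> \<open>The gap between G f and G (F i) lies between 0 and the integral of f - F i
        against \<mu>, which tends to 0 by dominated convergence.\<close>
      have diff: "G f = G (F i) + G (\<lambda>t. f t - F i t)" "G (\<lambda>t. f t - F i t) \<le> (\<integral>t. f t \<partial>\<mu>) - (\<integral>t. F i t \<partial>\<mu>)"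
        "0 \<le> G (\<lambda>t. f t - F i t)" for i
      proof -
        have d: "polynomially_bounded (\<lambda>t. f t - F i t)" "\<And>t. 0 \<le> f t - F i t"
          using F_le F_nonneg by (auto intro!: polynomially_bounded_le [OF _ _ f(1)])
        show "G f = G (F i) + G (\<lambda>t. f t - F i t)" using G_add [OF pb [of i] F_nonneg [of i] d] by simp
        show "G (\<lambda>t. f t - F i t) \<le> (\<integral>t. f t \<partial>\<mu>) - (\<integral>t. F i t \<partial>\<mu>)"
          using G_le [OF d] by (simp add: integrable_polynomially_bounded [OF mom_\<mu>] f(1) pb)
        show "0 \<le> G (\<lambda>t. f t - F i t)" by (rule G_nonneg [OF d])
      qed
      have "(\<lambda>i. G (F i)) \<longlonglongrightarrow> G f"
      proof (rule tendsto_sandwich [OF _ _ _ tendsto_const])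
        show "(\<lambda>i. G f - ((\<integral>t. f t \<partial>\<mu>) - (\<integral>t. F i t \<partial>\<mu>))) \<longlonglongrightarrow> G f"
          using tendsto_diff [OF tendsto_const [of "G f"] tendsto_diff [OF tendsto_const [of "\<integral>t. f t \<partial>\<mu>"] lim_\<mu>]] by simp
        show "\<forall>\<^sub>F i in sequentially. G f - ((\<integral>t. f t \<partial>\<mu>) - (\<integral>t. F i t \<partial>\<mu>)) \<le> G (F i)"
        proof (intro always_eventually allI)
          fix i show "G f - ((\<integral>t. f t \<partial>\<mu>) - (\<integral>t. F i t \<partial>\<mu>)) \<le> G (F i)"
            using diff(1,2) [of i] by linarith
        qed
        show "\<forall>\<^sub>F i in sequentially. G (F i) \<le> G f"
        proof (intro always_eventually allI)
          fix i show "G (F i) \<le> G f" using diff(1,3) [of i] by linarith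
        qed
      qed
      then have "(\<lambda>i. ennreal (G (F i))) \<longlonglongrightarrow> ennreal (G f)" by (rule tendsto_ennrealI)
      moreover have "(\<integral>\<^sup>+t. U i t \<partial>\<rho>) = ennreal (G (F i))" for i
        using seq.IH [of i] pb F_nonneg UF by blast
      moreover have "(\<integral>\<^sup>+t. (SUP i. U i) t \<partial>\<rho>) = (SUP i. \<integral>\<^sup>+t. U i t \<partial>\<rho>)"
        using seq by (simp add: image_comp) (subst nn_integral_monotone_convergence_SUP; simp)
      moreover have "(\<lambda>i. \<integral>\<^sup>+t. U i t \<partial>\<rho>) \<longlonglongrightarrow> (SUP i. \<integral>\<^sup>+t. U i t \<partial>\<rho>)"
        using inc by (intro LIMSEQ_SUP) (auto simp: incseq_def intro!: nn_integral_mono)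
      ultimately show "(\<integral>\<^sup>+t. (SUP i. U i) t \<partial>\<rho>) = ennreal (G f)"
        by (simp add: LIMSEQ_unique)
    qed
  qed
  have nn: "(\<integral>\<^sup>+t. ennreal (f t) \<partial>\<rho>) = ennreal (G f)" if "polynomially_bounded f" "\<And>t. 0 \<le> f t" for f
  proof -
    have [measurable]: "f \<in> borel_measurable borel"
      using that(1) by (simp add: polynomially_bounded_def)
    have "(\<lambda>t. ennreal (f t)) \<in> borel_measurable borel" by measurable
    with * [OF this] that show ?thesis by blast
  qed
  have int: "integrable \<rho> f" "(\<integral>t. f t \<partial>\<rho>) = G f" if f: "polynomially_bounded f" "\<And>t. 0 \<le> f t" for f
  proof -
    have [measurable]: "f \<in> borel_measurable borel" using f by (simp add: polynomially_bounded_def)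
    show "integrable \<rho> f" by (rule integrableI_nn_integral_finite [OF _ _ nn [OF f]]) (use f in auto)
    show "(\<integral>t. f t \<partial>\<rho>) = G f"
      by (subst integral_eq_nn_integral) (use f in \<open>auto simp: nn [OF f] G_nonneg [OF f]\<close>)
  qed
  have "has_moments \<rho> (\<lambda>k. spectral y g L (x ^ k * (p * p)))"
    unfolding has_moments_def
  proof (intro conjI allI sets_\<rho>)
    show "finite_measure \<rho>"
      using nn [OF polynomially_bounded_const [of 1]] by (intro finite_measureI) (auto simp: sets_eq_imp_space_eq [OF sets_\<rho>])
    fix k
    note sq = polynomially_bounded_power_plus_square
    have i: "integrable \<rho> (\<lambda>t. (t ^ k + e)\<^sup>2)"
      "(\<integral>t. (t ^ k + e)\<^sup>2 \<partial>\<rho>) = spectral y g L (((x ^ k + of_real e) * p) * ((x ^ k + of_real e) * p))" for e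
      using int [OF sq [of k e]]
      by (simp_all add: G_def spectral_power_plus_square [OF L x] spectral_mult_square [OF L y pg])
    have eq: "(\<lambda>t :: real. t ^ k) = (\<lambda>t. ((t ^ k + 1)\<^sup>2 - (t ^ k + - 1)\<^sup>2) / 4)"
      by (rule ext) (rule power_eq_squares)
    show "integrable \<rho> (\<lambda>t. t ^ k)"
      unfolding eq by (intro integrable_divide Bochner_Integration.integrable_diff i)
    have "(\<integral>t. t ^ k \<partial>\<rho>) = ((\<integral>t. (t ^ k + 1)\<^sup>2 \<partial>\<rho>) - (\<integral>t. (t ^ k + - 1)\<^sup>2 \<partial>\<rho>)) / 4"
      unfolding eq by (simp only: integral_divide_zero Bochner_Integration.integral_diff [OF i(1) i(1)])
    also have "\<dots> = spectral y g L (x ^ k * (p * p))"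
      using square_difference_element [OF linear_spectral [OF L y pg], of x k p] by (simp only: i(2))
    finally show "(\<integral>t. t ^ k \<partial>\<rho>) = spectral y g L (x ^ k * (p * p))" .
  qed
  then have "\<rho> = element_measure x (spectral y g L) (p * p)"
    by (rule element_measure_unique [OF gL x psd_element_square [OF carleman_functional_psd [OF gL]]])
  then show "spectral x h (spectral y g L) (p * p) = spectral y g (spectral x h L) (p * p)"
    using int(2) [OF h] spectral_square [OF gL x h(1)] by (simp add: G_def)
qed

text \<open>Multiplying \<open>p\<close> by x^k + e multiplies its measure by the density (t^k +
  e)^2. The moments agree by expanding the square, and determinacy does the rest.\<close>

lemma element_measure_power_plus_square:
  assumes L: "carleman_functional S L" and x: "x \<in> S"
  shows "element_measure x L (((x ^ k + of_real e) * p) * ((x ^ k + of_real e) * p))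
    = density (element_measure x L (p * p)) (\<lambda>t. ennreal ((t ^ k + e)\<^sup>2))"
proof (rule sym, rule element_measure_unique [OF L x])
  let ?r = "x ^ k + of_real e"
  note sq = psd_element_square [OF carleman_functional_psd [OF L]]
  show "psd_element L ((?r * p) * (?r * p))" by (rule sq)
  have mom: "has_moments (element_measure x L (p * p)) (\<lambda>k. L (x ^ k * (p * p)))"
    by (rule element_measure [OF carleman_functional_linear [OF L] sq])
  have pb: "polynomially_bounded (\<lambda>t. (t ^ k + e)\<^sup>2 * t ^ n)" for n
  proof -
    have "(\<lambda>t :: real. (t ^ k + e)\<^sup>2 * t ^ n) = (\<lambda>t. (t ^ (k + k + n) + (2 * e) * t ^ (k + n)) + e\<^sup>2 * t ^ n)"
      by (simp add: fun_eq_iff power2_eq_square power_add algebra_simps)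
    then show ?thesis
      by (simp only:) (intro polynomially_bounded_add polynomially_bounded_power polynomially_bounded_cmult)
  qed
  have "(\<integral>t. (t ^ k + e)\<^sup>2 * t ^ n \<partial>element_measure x L (p * p)) = L (x ^ n * ((?r * p) * (?r * p)))" for n
  proof -
    have i: "integrable (element_measure x L (p * p)) (\<lambda>t. t ^ j)"
      "(\<integral>t. t ^ j \<partial>element_measure x L (p * p)) = L (x ^ j * (p * p))" for j
      using mom by (simp_all add: has_moments_def)
    have "(\<lambda>t :: real. (t ^ k + e)\<^sup>2 * t ^ n) = (\<lambda>t. (t ^ (k + k + n) + (2 * e) * t ^ (k + n)) + e\<^sup>2 * t ^ n)"
      by (simp add: fun_eq_iff power2_eq_square power_add algebra_simps)
    then have "(\<integral>t. (t ^ k + e)\<^sup>2 * t ^ n \<partial>element_measure x L (p * p))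
        = L (x ^ (k + k + n) * (p * p)) + 2 * e * L (x ^ (k + n) * (p * p)) + e\<^sup>2 * L (x ^ n * (p * p))"
      by (simp only:) (simp only: Bochner_Integration.integral_add integrable_mult_right i
          Bochner_Integration.integrable_add integral_mult_right_zero)
    also have "\<dots> = L (x ^ n * ((?r * p) * (?r * p)))"
    proof -
      have "x ^ n * ((?r * p) * (?r * p))
        = (x ^ (k + k + n) * (p * p) + e *\<^sub>R (x ^ (k + n) * (p * p)) + e *\<^sub>R (x ^ (k + n) * (p * p)))
          + e\<^sup>2 *\<^sub>R (x ^ n * (p * p))"
        by (simp add: of_real_def power_add power2_eq_square algebra_simps)
      then show ?thesis
        by (simp only: linear_add [OF carleman_functional_linear [OF L]] linear_scale [OF carleman_functional_linear [OF L]])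
          simp
    qed
    finally show ?thesis .
  qed
  with integral_density_moment_measure [OF mom _ _ pb]
  show "has_moments (density (element_measure x L (p * p)) (\<lambda>t. ennreal ((t ^ k + e)\<^sup>2)))
      (\<lambda>n. L (x ^ n * ((?r * p) * (?r * p))))"
    by simp
qed

text \<open>The moments of the density are integrals of g(t) t^k. By polarisation they reduce to
  integrals of g(t) (t^k + e)^2, which by the preceding density formula are values of
  \<open>spectral x g L\<close> on squares.\<close>

lemma element_measure_spectral:
  assumes L: "carleman_functional S L" and x: "x \<in> S"
    and g: "g \<in> borel_measurable borel" "\<And>t. 0 \<le> g t \<and> g t \<le> 1"
  shows "element_measure x (spectral x g L) (p * p) = density (element_measure x L (p * p)) (\<lambda>t. ennreal (g t))"
proof (rule sym, rule element_measure_unique)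
  let ?\<mu> = "element_measure x L (p * p)"
  note sq = psd_element_square [OF carleman_functional_psd [OF L]]
  have pg: "polynomially_bounded g" using g by (rule polynomially_bounded_unit)
  show gL: "carleman_functional S (spectral x g L)"
    using carleman_functional_spectral [OF L x pg] g by blast
  show "psd_element (spectral x g L) (p * p)" by (rule psd_element_square [OF carleman_functional_psd [OF gL]])
  have mom: "has_moments ?\<mu> (\<lambda>k. L (x ^ k * (p * p)))"
    by (rule element_measure [OF carleman_functional_linear [OF L] sq])
  note [measurable_cong] = has_moments_sets [OF mom]
  note [measurable] = g(1)
  have pb: "polynomially_bounded (\<lambda>t. g t * f t)" if "polynomially_bounded f" for f
  proof (rule polynomially_bounded_le)
    show "(\<lambda>t. g t * f t) \<in> borel_measurable borel"
      using that by (auto simp: polynomially_bounded_def)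
    show "\<bar>g t * f t\<bar> \<le> \<bar>f t\<bar>" for t
      using mult_right_mono [of "g t" 1 "\<bar>f t\<bar>"] g(2) [of t] by (simp add: abs_mult)
    show "polynomially_bounded (\<lambda>t. \<bar>f t\<bar>)"
      using that by (auto simp: polynomially_bounded_def)
  qed
  have "(\<integral>t. g t * t ^ k \<partial>?\<mu>) = spectral x g L (x ^ k * (p * p))" for k
  proof -
    note pbs = pb [OF polynomially_bounded_power_plus_square, of k]
    have i: "integrable ?\<mu> (\<lambda>t. g t * (t ^ k + e)\<^sup>2)" for e
      by (rule integrable_polynomially_bounded [OF mom pbs])
    have s: "spectral x g L (((x ^ k + of_real e) * p) * ((x ^ k + of_real e) * p)) = (\<integral>t. g t * (t ^ k + e)\<^sup>2 \<partial>?\<mu>)" for e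
      unfolding spectral_square [OF L x pg] element_measure_power_plus_square [OF L x]
      by (subst integral_density) (auto simp: mult.commute)
    have eq: "(\<lambda>t. g t * t ^ k) = (\<lambda>t. (g t * (t ^ k + 1)\<^sup>2 - g t * (t ^ k + - 1)\<^sup>2) / 4)"
      by (rule ext) (simp add: power2_eq_square algebra_simps)
    have "(\<integral>t. g t * t ^ k \<partial>?\<mu>) = ((\<integral>t. g t * (t ^ k + 1)\<^sup>2 \<partial>?\<mu>) - (\<integral>t. g t * (t ^ k + - 1)\<^sup>2 \<partial>?\<mu>)) / 4"
      unfolding eq by (simp only: integral_divide_zero Bochner_Integration.integral_diff [OF i i])
    also have "\<dots> = spectral x g L (x ^ k * (p * p))"
      using square_difference_element [OF linear_spectral [OF L x pg], of x k p] by (simp only: s)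
    finally show ?thesis .
  qed
  with integral_density_moment_measure [OF mom g(1) _ pb [OF polynomially_bounded_power]] g(2)
  show "has_moments (density ?\<mu> (\<lambda>t. ennreal (g t))) (\<lambda>k. spectral x g L (x ^ k * (p * p)))"
    by simp
qed (rule x)

text \<open>Multiplicativity of the calculus in one variable. It makes half-line indicators
  idempotent and gives the joint law of two bits of the same coordinate.\<close>

lemma spectral_spectral:
  assumes L: "carleman_functional S L" and x: "x \<in> S"
    and g: "g \<in> borel_measurable borel" "\<And>t. 0 \<le> g t \<and> g t \<le> 1"
    and f: "f \<in> borel_measurable borel" "\<And>t. 0 \<le> f t \<and> f t \<le> 1"
  shows "spectral x f (spectral x g L) = spectral x (\<lambda>t. g t * f t) L"
proof (rule linear_eq_on_squares)
  have pg: "polynomially_bounded g" and pf: "polynomially_bounded f"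
    using g f by (auto intro: polynomially_bounded_unit)
  have pgf: "polynomially_bounded (\<lambda>t. g t * f t)"
    using g f by (intro polynomially_bounded_unit) (auto intro: mult_le_one)
  have gL: "carleman_functional S (spectral x g L)"
    using carleman_functional_spectral [OF L x pg] g by blast
  show "linear (spectral x f (spectral x g L))" "linear (spectral x (\<lambda>t. g t * f t) L)"
    by (rule linear_spectral [OF gL x pf] linear_spectral [OF L x pgf])+
  fix p
  have sets: "sets (element_measure x L (p * p)) = sets borel"
    by (intro has_moments_sets [OF element_measure] carleman_functional_linear [OF L] psd_element_square
        carleman_functional_psd [OF L])
  note [measurable_cong] = sets and [measurable] = g(1) f(1)
  show "spectral x f (spectral x g L) (p * p) = spectral x (\<lambda>t. g t * f t) L (p * p)"
    unfolding spectral_square [OF gL x pf] spectral_square [OF L x pgf] element_measure_spectral [OF L x g]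
    by (subst integral_density) (use g in auto)
qed

section \<open>Joint distributions of half-line indicators\<close>

text \<open>
  Coordinate \<open>(j, r)\<close> of the index set carries the indicator of \<open>x\<^sub>j \<le> r\<close>, encoded by \<open>1\<close> and \<open>0\<close>.
\<close>

definition half :: "real \<Rightarrow> real \<Rightarrow> real \<Rightarrow> real" where
  "half r b = indicator (if b = 1 then {..r} else {r<..})"

lemma half_bounds: "0 \<le> half r b t \<and> half r b t \<le> 1"
  by (simp add: half_def indicator_def)

lemma half_measurable [measurable]: "half r b \<in> borel_measurable borel"
  by (simp add: half_def)

lemma polynomially_bounded_half: "polynomially_bounded (half r b)"
  using half_measurable half_bounds by (rule polynomially_bounded_unit)

text \<open>Outside the intended arguments the operation is the identity. Cuts then commute without
  side conditions, as required for \<open>Finite_Set.fold\<close> over an unordered index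
  set.\<close>

definition cut ::
    "('i \<Rightarrow> 'a::{comm_ring_1,real_algebra_1}) \<Rightarrow> 'i set \<Rightarrow> 'i \<times> real \<Rightarrow> real \<Rightarrow> ('a \<Rightarrow> real) \<Rightarrow> 'a \<Rightarrow> real" where
  "cut X \<Omega> a b M = (if fst a \<in> \<Omega> \<and> carleman_functional (X ` \<Omega>) M
     then spectral (X (fst a)) (half (snd a) b) M else M)"

definition cuts ::
    "('i \<Rightarrow> 'a::{comm_ring_1,real_algebra_1}) \<Rightarrow> 'i set \<Rightarrow> ('i \<times> real) set \<Rightarrow> ('i \<times> real \<Rightarrow> real) \<Rightarrow> ('a \<Rightarrow> real) \<Rightarrow> 'a \<Rightarrow> real" where
  "cuts X \<Omega> J s L = Finite_Set.fold (\<lambda>a. cut X \<Omega> a (s a)) L J"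

lemma carleman_functional_cut:
  "carleman_functional (X ` \<Omega>) M \<Longrightarrow> carleman_functional (X ` \<Omega>) (cut X \<Omega> a b M)"
  using half_bounds by (auto simp: cut_def intro!: carleman_functional_spectral polynomially_bounded_half)

lemma cut_eq:
  "carleman_functional (X ` \<Omega>) M \<Longrightarrow> j \<in> \<Omega> \<Longrightarrow> cut X \<Omega> (j, r) b M = spectral (X j) (half r b) M"
  by (simp add: cut_def)

lemma cut_commute: "cut X \<Omega> a b (cut X \<Omega> a' b' M) = cut X \<Omega> a' b' (cut X \<Omega> a b M)"
proof (cases "fst a \<in> \<Omega> \<and> fst a' \<in> \<Omega> \<and> carleman_functional (X ` \<Omega>) M")
  case True
  then show ?thesis
    using carleman_functional_cut [of X \<Omega> M a b] carleman_functional_cut [of X \<Omega> M a' b'] half_bounds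
    by (auto simp: cut_def intro!: spectral_commute polynomially_bounded_half)
next
  case False
  then show ?thesis
    using carleman_functional_cut [of X \<Omega> M] by (auto simp: cut_def)
qed

lemma comp_fun_commute_cut: "comp_fun_commute (\<lambda>a. cut X \<Omega> a (s a))"
  by (rule comp_fun_commute.intro) (rule ext, simp only: o_apply, rule cut_commute)

lemma cuts_empty [simp]: "cuts X \<Omega> {} s L = L"
  by (simp add: cuts_def)

lemma cuts_insert: "finite J \<Longrightarrow> a \<notin> J \<Longrightarrow> cuts X \<Omega> (insert a J) s L = cut X \<Omega> a (s a) (cuts X \<Omega> J s L)"
proof -
  assume "finite J" "a \<notin> J"
  interpret comp_fun_commute "\<lambda>a. cut X \<Omega> a (s a)" by (rule comp_fun_commute_cut)
  show ?thesis unfolding cuts_def using \<open>finite J\<close> \<open>a \<notin> J\<close> by (rule fold_insert)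
qed

lemma cuts_cong: "finite J \<Longrightarrow> (\<And>a. a \<in> J \<Longrightarrow> s a = s' a) \<Longrightarrow> cuts X \<Omega> J s L = cuts X \<Omega> J s' L"
  by (induction J rule: finite_induct) (auto simp: cuts_insert)

lemma carleman_functional_cuts:
  "finite J \<Longrightarrow> carleman_functional (X ` \<Omega>) L \<Longrightarrow> carleman_functional (X ` \<Omega>) (cuts X \<Omega> J s L)"
  by (induction J rule: finite_induct) (auto simp: cuts_insert carleman_functional_cut)

lemma cut_split:
  assumes M: "carleman_functional (X ` \<Omega>) M" and a: "fst a \<in> \<Omega>"
  shows "cut X \<Omega> a 0 M q + cut X \<Omega> a 1 M q = M q"
proof -
  have x: "X (fst a) \<in> X ` \<Omega>" using a by simp
  have "(\<lambda>t. half (snd a) 0 t + half (snd a) 1 t) = (\<lambda>t. t ^ 0)"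
    by (auto simp: half_def fun_eq_iff indicator_def)
  moreover have "spectral (X (fst a)) (\<lambda>t. t ^ 0) M q = M q"
    by (subst spectral_power [OF M x]) simp
  moreover have "spectral (X (fst a)) (\<lambda>t. half (snd a) 0 t + half (snd a) 1 t) M q
      = cut X \<Omega> a 0 M q + cut X \<Omega> a 1 M q"
    by (subst spectral_add [OF M x polynomially_bounded_half polynomially_bounded_half])
      (simp add: cut_def M a)
  ultimately show ?thesis by simp
qed

lemma cut_cut:
  assumes M: "carleman_functional (X ` \<Omega>) M"
  shows "cut X \<Omega> a b (cut X \<Omega> a b M) = cut X \<Omega> a b M"
proof (cases "fst a \<in> \<Omega>")
  case True
  have "(\<lambda>t. half (snd a) b t * half (snd a) b t) = half (snd a) b"
    by (auto simp: half_def fun_eq_iff indicator_def)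
  then show ?thesis
    using True carleman_functional_cut [OF M, of a b] spectral_spectral [OF M _ half_measurable half_bounds half_measurable half_bounds, of "X (fst a)" "snd a" b "snd a" b]
    by (simp add: cut_def M)
qed (simp add: cut_def)

text \<open>The fold ignores an element already present, and so does the cut because it is
  idempotent. Inductions over half-lines thus need no case distinction on repeated ones.\<close>

lemma cuts_insert':
  assumes L: "carleman_functional (X ` \<Omega>) L" and J: "finite J"
  shows "cuts X \<Omega> (insert a J) s L = cut X \<Omega> a (s a) (cuts X \<Omega> J s L)"
proof (cases "a \<in> J")
  case True
  define K where "K = J - {a}"
  have K: "finite K" "a \<notin> K" "J = insert a K" using J True by (auto simp: K_def)
  show ?thesis
    using cut_cut [OF carleman_functional_cuts [OF K(1) L], of a "s a"] K by (simp add: cuts_insert)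
qed (simp add: cuts_insert J)

section \<open>Consistency of the bit laws and Kolmogorov extension\<close>

abbreviation bits :: "'b set \<Rightarrow> ('b \<Rightarrow> real) set" where
  "bits J \<equiv> J \<rightarrow>\<^sub>E {0, 1}"

text \<open>Marginalisation: by commutation the bits in \<open>K\<close> can be cut last and summed
  out one at a time, complementary half-lines adding up to 1. The weight \<phi> is left free so that
  indicators give consistency, and \<phi> = 1 with empty \<open>J\<close> gives the total mass L
  1.\<close>

lemma sum_cuts_restrict:
  assumes L: "carleman_functional (X ` \<Omega>) L" and J: "finite J" and K: "finite K" "K \<subseteq> \<Omega> \<times> UNIV" "J \<inter> K = {}"
  shows "(\<Sum>s\<in>bits (J \<union> K). \<phi> (restrict s J) * cuts X \<Omega> (J \<union> K) s L 1) = (\<Sum>s\<in>bits J. \<phi> s * cuts X \<Omega> J s L 1)"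
  using K
proof (induction K rule: finite_induct)
  case empty
  have "(\<Sum>s\<in>bits J. \<phi> (restrict s J) * cuts X \<Omega> J s L 1) = (\<Sum>s\<in>bits J. \<phi> s * cuts X \<Omega> J s L 1)"
    by (rule sum.cong) (auto simp: PiE_restrict)
  then show ?case by simp
next
  case (insert a K)
  define H where "H = J \<union> K"
  have H: "finite H" "a \<notin> H" "a \<notin> J" "J \<subseteq> H" using insert J by (auto simp: H_def)
  have a: "fst a \<in> \<Omega>" using insert by auto
  have "(\<Sum>s\<in>bits (insert a H). \<phi> (restrict s J) * cuts X \<Omega> (insert a H) s L 1)
      = (\<Sum>(b, s)\<in>{0, 1} \<times> bits H. \<phi> (restrict (s(a := b)) J) * cuts X \<Omega> (insert a H) (s(a := b)) L 1)"
    unfolding PiE_insert_eq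
    by (subst sum.reindex [OF inj_combinator [OF H(2)]]) (simp add: case_prod_unfold o_def)
  also have "\<dots> = (\<Sum>s\<in>bits H. \<Sum>b\<in>{0, 1}. \<phi> (restrict (s(a := b)) J) * cuts X \<Omega> (insert a H) (s(a := b)) L 1)"
    by (subst sum.cartesian_product [symmetric]) (rule sum.swap)
  also have "\<dots> = (\<Sum>s\<in>bits H. \<phi> (restrict s J) * cuts X \<Omega> H s L 1)"
  proof (rule sum.cong)
    fix s assume "s \<in> bits H"
    have r: "restrict (s(a := b)) J = restrict s J" for b using H by (auto simp: restrict_def fun_eq_iff)
    have c: "cuts X \<Omega> (insert a H) (s(a := b)) L 1 = cut X \<Omega> a b (cuts X \<Omega> H s L) 1" for b
    proof -
      have "cuts X \<Omega> H (s(a := b)) L = cuts X \<Omega> H s L"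
        by (rule cuts_cong) (use H in auto)
      then show ?thesis using H by (simp add: cuts_insert)
    qed
    show "(\<Sum>b\<in>{0, 1}. \<phi> (restrict (s(a := b)) J) * cuts X \<Omega> (insert a H) (s(a := b)) L 1)
        = \<phi> (restrict s J) * cuts X \<Omega> H s L 1"
      using cut_split [OF carleman_functional_cuts [OF H(1) L] a, of s 1]
      by (simp add: r c distrib_left [symmetric])
  qed simp
  also have "\<dots> = (\<Sum>s\<in>bits J. \<phi> s * cuts X \<Omega> J s L 1)"
    unfolding H_def by (rule insert.IH) (use insert.prems in auto)
  finally show ?case by (simp only: H_def Un_insert_right)
qed

lemma cuts_nonneg:
  assumes "carleman_functional (X ` \<Omega>) L" "finite J"
  shows "0 \<le> cuts X \<Omega> J s L 1"
  using psd_square [OF carleman_functional_psd [OF carleman_functional_cuts [OF assms(2,1)]], where g = 1] by simp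

text \<open>The finite table of bit probabilities, pushed into a product of real lines since the
  extension theorem wants a Polish coordinate space.\<close>

definition bit_measure ::
    "('i \<Rightarrow> 'a::{comm_ring_1,real_algebra_1}) \<Rightarrow> 'i set \<Rightarrow> ('a \<Rightarrow> real) \<Rightarrow> ('i \<times> real) set \<Rightarrow> ('i \<times> real \<Rightarrow> real) measure" where
  "bit_measure X \<Omega> L J = distr (point_measure (bits J) (\<lambda>s. ennreal (cuts X \<Omega> J s L 1))) (PiM J (\<lambda>_. borel)) (\<lambda>s. s)"

lemma finite_bits: "finite J \<Longrightarrow> finite (bits J)"
  by (rule finite_PiE) auto

lemma emeasure_bit_measure:
  assumes L: "carleman_functional (X ` \<Omega>) L" and J: "finite J" and A: "A \<in> sets (PiM J (\<lambda>_. borel))"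
  shows "emeasure (bit_measure X \<Omega> L J) A = ennreal (\<Sum>s\<in>bits J. indicator A s * cuts X \<Omega> J s L 1)"
proof -
  have meas: "(\<lambda>s. s) \<in> measurable (point_measure (bits J) (\<lambda>s. ennreal (cuts X \<Omega> J s L 1))) (PiM J (\<lambda>_. borel))"
    by (rule measurableI) (auto simp: space_point_measure sets_point_measure space_PiM)
  have "emeasure (bit_measure X \<Omega> L J) A
      = emeasure (point_measure (bits J) (\<lambda>s. ennreal (cuts X \<Omega> J s L 1))) (A \<inter> bits J)"
    unfolding bit_measure_def by (subst emeasure_distr [OF meas A]) (simp add: space_point_measure vimage_def Int_def)
  also have "\<dots> = (\<Sum>s\<in>A \<inter> bits J. ennreal (cuts X \<Omega> J s L 1))"
    using finite_bits [OF J] by (subst emeasure_point_measure_finite) auto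
  also have "\<dots> = (\<Sum>s\<in>bits J. ennreal (indicator A s * cuts X \<Omega> J s L 1))"
    using finite_bits [OF J] by (intro sum.mono_neutral_cong_left) (auto simp: indicator_def)
  also have "\<dots> = ennreal (\<Sum>s\<in>bits J. indicator A s * cuts X \<Omega> J s L 1)"
    by (rule sum_ennreal) (auto intro: mult_nonneg_nonneg cuts_nonneg [OF L J])
  finally show ?thesis .
qed

lemma polish_projective_bits:
  fixes X :: "'i \<Rightarrow> 'a::{comm_ring_1,real_algebra_1}" and \<Omega> :: "'i set" and L :: "'a \<Rightarrow> real"
  assumes L: "carleman_functional (X ` \<Omega>) L" and L1: "L 1 = 1"
  shows "polish_projective (\<Omega> \<times> UNIV) (bit_measure X \<Omega> L)"
  unfolding polish_projective_def
proof (rule projective_family.intro)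
  have sets: "sets (bit_measure X \<Omega> L J) = sets (PiM J (\<lambda>_. borel))" for J
    by (simp add: bit_measure_def)
  have sp: "space (bit_measure X \<Omega> L J) = space (PiM J (\<lambda>_. borel))" for J
    by (simp add: bit_measure_def)
  fix J H :: "('i \<times> real) set"
  assume JH: "J \<subseteq> H" "finite H" "H \<subseteq> \<Omega> \<times> UNIV"
  have J: "finite J" using JH finite_subset by auto
  show "bit_measure X \<Omega> L J = distr (bit_measure X \<Omega> L H) (PiM J (\<lambda>_. borel)) (\<lambda>f. restrict f J)"
  proof (rule measure_eqI)
    fix A assume "A \<in> sets (bit_measure X \<Omega> L J)"
    then have A: "A \<in> sets (PiM J (\<lambda>_. borel))" by (simp add: sets)
    have meas: "(\<lambda>f. restrict f J) \<in> measurable (bit_measure X \<Omega> L H) (PiM J (\<lambda>_. borel))"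
      using measurable_restrict_subset [OF JH(1), of "\<lambda>_. borel"] by (simp cong: measurable_cong_sets add: sets)
    have pre: "(\<lambda>f. restrict f J) -` A \<inter> space (bit_measure X \<Omega> L H) \<in> sets (PiM H (\<lambda>_. borel))"
      using measurable_sets [OF meas A] by (simp add: sets)
    have H: "J \<union> (H - J) = H" using JH by auto
    have "emeasure (distr (bit_measure X \<Omega> L H) (PiM J (\<lambda>_. borel)) (\<lambda>f. restrict f J)) A
      = ennreal (\<Sum>s\<in>bits H. indicator ((\<lambda>f. restrict f J) -` A \<inter> space (bit_measure X \<Omega> L H)) s * cuts X \<Omega> H s L 1)"
      by (subst emeasure_distr [OF meas A]) (rule emeasure_bit_measure [OF L JH(2) pre])
    also have "(\<Sum>s\<in>bits H. indicator ((\<lambda>f. restrict f J) -` A \<inter> space (bit_measure X \<Omega> L H)) s * cuts X \<Omega> H s L 1)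
      = (\<Sum>s\<in>bits H. indicator A (restrict s J) * cuts X \<Omega> H s L 1)"
      by (rule sum.cong) (auto simp: indicator_def sp space_PiM PiE_iff)
    also have "\<dots> = (\<Sum>s\<in>bits J. indicator A s * cuts X \<Omega> J s L 1)"
      using sum_cuts_restrict [OF L J, of "H - J" "indicator A"] JH unfolding H by auto
    finally show "emeasure (bit_measure X \<Omega> L J) A
      = emeasure (distr (bit_measure X \<Omega> L H) (PiM J (\<lambda>_. borel)) (\<lambda>f. restrict f J)) A"
      by (simp only: emeasure_bit_measure [OF L J A])
  qed (simp add: sets)
next
  fix J :: "('i \<times> real) set" assume J: "finite J" "J \<subseteq> \<Omega> \<times> UNIV"
  have sp: "space (bit_measure X \<Omega> L J) = space (PiM J (\<lambda>_. borel))"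
    by (simp add: bit_measure_def)
  show "prob_space (bit_measure X \<Omega> L J)"
  proof (rule prob_spaceI)
    have "emeasure (bit_measure X \<Omega> L J) (space (bit_measure X \<Omega> L J))
      = ennreal (\<Sum>s\<in>bits J. indicator (space (PiM J (\<lambda>_. borel))) s * cuts X \<Omega> J s L 1)"
      unfolding sp by (rule emeasure_bit_measure [OF L J(1)]) simp
    also have "(\<Sum>s\<in>bits J. indicator (space (PiM J (\<lambda>_. borel))) s * cuts X \<Omega> J s L 1) = (\<Sum>s\<in>bits J. 1 * cuts X \<Omega> J s L 1)"
      by (rule sum.cong) (auto simp: indicator_def space_PiM PiE_iff)
    also have "\<dots> = (\<Sum>s\<in>bits ({} :: ('i \<times> real) set). 1 * cuts X \<Omega> {} s L 1)"
      using sum_cuts_restrict [OF L, of "{}" J "\<lambda>_. 1"] J by simp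
    finally show "emeasure (bit_measure X \<Omega> L J) (space (bit_measure X \<Omega> L J)) = 1"
      by (simp add: L1)
  qed
qed

lemma bit_process:
  fixes X :: "'i \<Rightarrow> 'a::{comm_ring_1,real_algebra_1}" and \<Omega> :: "'i set" and L :: "'a \<Rightarrow> real"
  assumes L: "carleman_functional (X ` \<Omega>) L" and L1: "L 1 = 1"
  obtains P :: "('i \<times> real \<Rightarrow> real) measure"
  where "prob_space P" "sets P = sets (PiM (\<Omega> \<times> UNIV) (\<lambda>_. borel))"
    "\<And>J (s :: 'i \<times> real \<Rightarrow> real). finite J \<Longrightarrow> J \<subseteq> \<Omega> \<times> UNIV \<Longrightarrow> s \<in> J \<rightarrow> {0, 1} \<Longrightarrow>
       emeasure P {\<omega> \<in> space P. \<forall>a\<in>J. \<omega> a = s a} = ennreal (cuts X \<Omega> J s L 1)"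
proof
  interpret pp: polish_projective "\<Omega> \<times> UNIV" "bit_measure X \<Omega> L"
    by (rule polish_projective_bits [OF L L1])
  show "prob_space pp.lim" by (rule pp.P.prob_space_axioms)
  show "sets pp.lim = sets (PiM (\<Omega> \<times> UNIV) (\<lambda>_. borel))" by simp
  fix J :: "('i \<times> real) set" and s
  assume J: "finite J" "J \<subseteq> \<Omega> \<times> UNIV" and s: "s \<in> J \<rightarrow> {0, 1 :: real}"
  define A where "A = (\<Pi>\<^sub>E a\<in>J. {s a})"
  have A: "A \<in> sets (PiM J (\<lambda>_. borel))" unfolding A_def using J by (intro sets_PiM_I_finite) auto
  have A_eq: "A = {restrict s J}" unfolding A_def by (auto simp: PiE_iff extensional_def fun_eq_iff)
  have rs: "restrict s J \<in> bits J" using s by auto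
  have "{\<omega> \<in> space pp.lim. \<forall>a\<in>J. \<omega> a = s a} = prod_emb (\<Omega> \<times> UNIV) (\<lambda>_. borel) J A"
  proof -
    have "restrict \<omega> J \<in> A \<longleftrightarrow> (\<forall>a\<in>J. \<omega> a = s a)" for \<omega>
      by (auto simp: A_def PiE_iff)
    then show ?thesis by (auto simp only: prod_emb_def space_PiM vimage_eq Int_iff mem_Collect_eq pp.space_lim)
  qed
  then have "emeasure pp.lim {\<omega> \<in> space pp.lim. \<forall>a\<in>J. \<omega> a = s a} = emeasure (bit_measure X \<Omega> L J) A"
    using pp.emeasure_lim_emb [OF J(2,1) A] by simp
  also have "\<dots> = ennreal (\<Sum>s\<in>bits J. indicator A s * cuts X \<Omega> J s L 1)"
    by (rule emeasure_bit_measure [OF L J(1) A])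
  also have "(\<Sum>s\<in>bits J. indicator A s * cuts X \<Omega> J s L 1) = (\<Sum>s\<in>{restrict s J}. cuts X \<Omega> J s L 1)"
    using rs finite_bits [OF J(1)] by (intro sum.mono_neutral_cong_right) (auto simp: A_eq)
  also have "\<dots> = cuts X \<Omega> J s L 1"
    using cuts_cong [OF J(1), of "restrict s J" s X \<Omega> L] by simp
  finally show "emeasure pp.lim {\<omega> \<in> space pp.lim. \<forall>a\<in>J. \<omega> a = s a} = ennreal (cuts X \<Omega> J s L 1)" .
qed

section \<open>Reading a point of the power space off its bits\<close>

definition half_line_cuts ::
    "('i \<Rightarrow> 'a::{comm_ring_1,real_algebra_1}) \<Rightarrow> 'i set \<Rightarrow> ('i \<times> real) set \<Rightarrow> ('a \<Rightarrow> real) \<Rightarrow> 'a \<Rightarrow> real" where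
  "half_line_cuts X \<Omega> J L = cuts X \<Omega> J (\<lambda>_. 1) L"

definition half_lines :: "'i set \<Rightarrow> ('i \<times> real) set \<Rightarrow> ('i \<Rightarrow> real) set" where
  "half_lines \<Omega> J = {x \<in> \<Omega> \<rightarrow>\<^sub>E UNIV. \<forall>(j, r)\<in>J. x j \<le> r}"

text \<open>The real number whose half-line bits are given by \<omega>: the least level with bit 1.
  Rational levels keep the infimum countable and hence measurable; extended reals give it a value
  even if no bit is 1, and \<open>real_of_ereal\<close> turns infinite values into 0.\<close>

definition bit_infimum :: "('i \<times> real \<Rightarrow> real) \<Rightarrow> 'i \<Rightarrow> real" where
  "bit_infimum \<omega> j = real_of_ereal (INF q. if \<omega> (j, of_rat q) = 1 then ereal (of_rat q) else \<infinity>)"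

text \<open>The hypotheses are those of a distribution function with values 0 and 1: monotone,
  right-continuous, with both values attained. The real level \<open>r\<close> is compared with
  rational levels only, so that countably many conditions suffice.\<close>

lemma bit_infimum_le_iff:
  assumes bits: "\<And>q :: rat. \<omega> (j, of_rat q) \<in> {0, 1}" "\<omega> (j, r) \<in> {0, 1}"
    and mono: "\<And>q q' :: rat. q < q' \<Longrightarrow> \<omega> (j, of_rat q) = 1 \<Longrightarrow> \<omega> (j, of_rat q') = 1"
    and mono_r: "\<And>q :: rat. r < of_rat q \<Longrightarrow> \<omega> (j, r) = 1 \<Longrightarrow> \<omega> (j, of_rat q) = 1"
    and right: "\<omega> (j, r) = 0 \<Longrightarrow> \<exists>q :: rat. r < of_rat q \<and> \<omega> (j, of_rat q) = 0"
    and ex1: "\<exists>q :: rat. \<omega> (j, of_rat q) = 1" and ex0: "\<exists>q :: rat. \<omega> (j, of_rat q) = 0"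
  shows "bit_infimum \<omega> j \<le> r \<longleftrightarrow> \<omega> (j, r) = 1"
proof -
  define I where "I = (INF q. if \<omega> (j, of_rat q) = 1 then ereal (of_rat q) else \<infinity>)"
  have lower: "ereal (of_rat q) \<le> I" if "\<omega> (j, of_rat q) = 0" for q
    unfolding I_def
  proof (rule INF_greatest)
    fix q' :: rat
    have "q \<le> q'" if "\<omega> (j, of_rat q') = 1"
      using mono [of q' q] that \<open>\<omega> (j, of_rat q) = 0\<close> by (cases q q' rule: linorder_cases) auto
    then show "ereal (of_rat q) \<le> (if \<omega> (j, of_rat q') = 1 then ereal (of_rat q') else \<infinity>)"
      by (simp add: of_rat_less_eq)
  qed
  have upper: "I \<le> ereal (of_rat q)" if "\<omega> (j, of_rat q) = 1" for q
    unfolding I_def by (rule INF_lower2 [of q]) (use that in auto)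
  obtain q0 q1 where "\<omega> (j, of_rat q0) = 0" "\<omega> (j, of_rat q1) = 1" using ex0 ex1 by blast
  then have "ereal (of_rat q0) \<le> I" "I \<le> ereal (of_rat q1)" by (auto intro: lower upper)
  then obtain x where I: "I = ereal x" by (cases I) auto
  then have x: "bit_infimum \<omega> j = x" by (simp add: bit_infimum_def I_def)
  show ?thesis
    unfolding x
  proof
    assume 1: "\<omega> (j, r) = 1"
    show "x \<le> r"
    proof (rule ccontr)
      assume "\<not> x \<le> r"
      then obtain q where q: "r < of_rat q" "of_rat q < x" using of_rat_dense [of r x] by auto
      then have "I \<le> ereal (of_rat q)" using mono_r 1 upper by blast
      then show False using q I by simp
    qed
  next
    assume "x \<le> r"
    show "\<omega> (j, r) = 1"
    proof (rule ccontr)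
      assume "\<omega> (j, r) \<noteq> 1"
      then obtain q where "r < of_rat q" "\<omega> (j, of_rat q) = 0" using right bits(2) by auto
      with lower [of q] I \<open>x \<le> r\<close> show False by simp
    qed
  qed
qed

lemma half_lines_measurable:
  assumes J: "finite J" "J \<subseteq> \<Omega> \<times> UNIV"
  shows "half_lines \<Omega> J \<in> sets (PiM \<Omega> (\<lambda>_. borel))"
proof -
  have "half_lines \<Omega> J = {x \<in> space (PiM \<Omega> (\<lambda>_. borel)). \<forall>a\<in>J. x (fst a) \<le> snd a}"
    by (auto simp: half_lines_def space_PiM)
  also have "\<dots> \<in> sets (PiM \<Omega> (\<lambda>_. borel))"
  proof (rule sets.sets_Collect_finite_All [OF _ J(1)])
    fix a assume "a \<in> J"
    then have "fst a \<in> \<Omega>" using J by auto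
    then have [measurable]: "(\<lambda>x. x (fst a)) \<in> borel_measurable (PiM \<Omega> (\<lambda>_. borel :: real measure))"
      by (rule measurable_component_singleton)
    show "{x \<in> space (PiM \<Omega> (\<lambda>_. borel)). x (fst a) \<le> snd a} \<in> sets (PiM \<Omega> (\<lambda>_. borel))"
      by measurable
  qed
  finally show ?thesis .
qed

text \<open>One- and two-bit laws of a coordinate are values of its one-variable measure on
  intervals. Hence each condition for decoding fails only on a null set, and the image of the bit
  process under decoding gives every finite intersection of half-lines its prescribed mass.\<close>

lemma coordinate_measure:
  fixes X :: "'i \<Rightarrow> 'a::{comm_ring_1,real_algebra_1}" and \<Omega> :: "'i set" and L :: "'a \<Rightarrow> real"
  assumes L: "carleman_functional (X ` \<Omega>) L" and L1: "L 1 = 1"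
  obtains \<nu> where "prob_space \<nu>" "sets \<nu> = sets (PiM \<Omega> (\<lambda>_. borel))"
    "\<And>J. finite J \<Longrightarrow> J \<subseteq> \<Omega> \<times> UNIV \<Longrightarrow> emeasure \<nu> (half_lines \<Omega> J) = ennreal (half_line_cuts X \<Omega> J L 1)"
proof -
  obtain P :: "('i \<times> real \<Rightarrow> real) measure"
    where P: "prob_space P" and sets_P: "sets P = sets (PiM (\<Omega> \<times> UNIV) (\<lambda>_. borel))"
      and em: "\<And>J (s :: 'i \<times> real \<Rightarrow> real). finite J \<Longrightarrow> J \<subseteq> \<Omega> \<times> UNIV \<Longrightarrow> s \<in> J \<rightarrow> {0, 1} \<Longrightarrow>
       emeasure P {\<omega> \<in> space P. \<forall>a\<in>J. \<omega> a = s a} = ennreal (cuts X \<Omega> J s L 1)"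
    by (rule bit_process [OF L L1]; rule that)
  interpret P: prob_space P by fact
  have meas [measurable]: "(\<lambda>\<omega>. \<omega> a) \<in> borel_measurable P" if "a \<in> \<Omega> \<times> UNIV" for a
    using measurable_component_singleton [OF that, of "\<lambda>_. borel"] sets_P by (simp cong: measurable_cong_sets)
  define \<mu> where "\<mu> j = element_measure (X j) L 1" for j
  have one: "psd_element L 1" using psd_element_square [OF carleman_functional_psd [OF L], of 1] by simp
  have mom: "has_moments (\<mu> j) (\<lambda>k. L (X j ^ k * 1))" for j
    unfolding \<mu>_def by (rule element_measure [OF carleman_functional_linear [OF L] one])
  have sets_\<mu> [simp]: "sets (\<mu> j) = sets borel" for j by (rule has_moments_sets [OF mom])
  have fin_\<mu>: "finite_measure (\<mu> j)" for j using mom by (simp add: has_moments_def)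
  have spectral_\<mu>: "ennreal (spectral (X j) (indicator B) L 1) = emeasure (\<mu> j) B"
    if "j \<in> \<Omega>" "B \<in> sets borel" for j B
  proof -
    interpret finite_measure "\<mu> j" by (rule fin_\<mu>)
    have "B \<inter> space (\<mu> j) = B" using sets.sets_into_space [of B "\<mu> j"] that(2) by auto
    then have "spectral (X j) (indicator B) L 1 = measure (\<mu> j) B"
      using spectral_psd_element [OF L _ polynomially_bounded_indicator [OF that(2)] one, of "X j"] that
      by (simp add: \<mu>_def)
    then show ?thesis by (simp add: emeasure_eq_measure)
  qed
  have one_bit: "emeasure P {\<omega> \<in> space P. \<omega> (j, r) = b} = emeasure (\<mu> j) (if b = 1 then {..r} else {r<..})"
    if "j \<in> \<Omega>" "b \<in> {0, 1}" for j r b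
  proof -
    have "emeasure P {\<omega> \<in> space P. \<omega> (j, r) = b} = ennreal (cuts X \<Omega> {(j, r)} (\<lambda>_. b) L 1)"
      using em [of "{(j, r)}" "\<lambda>_. b"] that by auto
    also have "cuts X \<Omega> {(j, r)} (\<lambda>_. b) L 1 = spectral (X j) (half r b) L 1"
      using cuts_insert [of "{}" "(j, r)" X \<Omega> "\<lambda>_. b" L] that by (simp add: cut_eq [OF L])
    finally show ?thesis using spectral_\<mu> [OF that(1)] by (simp add: half_def)
  qed
  \<comment> \<open>The levels must differ, for otherwise the bit pattern could not assign
    \<open>b\<close> and \<open>c\<close> independently.\<close>
  have two_bits: "emeasure P {\<omega> \<in> space P. \<omega> (j, r) = b \<and> \<omega> (j, q) = c}
      = emeasure (\<mu> j) ((if b = 1 then {..r} else {r<..}) \<inter> (if c = 1 then {..q} else {q<..}))"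
    if "j \<in> \<Omega>" "b \<in> {0, 1}" "c \<in> {0, 1}" "r \<noteq> q" for j r b q c
  proof -
    define s where "s = (\<lambda>_. c)((j, r) := b)"
    have s: "s (j, r) = b" "s (j, q) = c" using that(4) by (auto simp: s_def)
    have "{\<omega> \<in> space P. \<omega> (j, r) = b \<and> \<omega> (j, q) = c} = {\<omega> \<in> space P. \<forall>a\<in>{(j, q), (j, r)}. \<omega> a = s a}"
      using s by auto
    then have "emeasure P {\<omega> \<in> space P. \<omega> (j, r) = b \<and> \<omega> (j, q) = c} = ennreal (cuts X \<Omega> {(j, q), (j, r)} s L 1)"
      using em [of "{(j, q), (j, r)}" s] that s by auto
    also have "cuts X \<Omega> {(j, q), (j, r)} s L 1 = spectral (X j) (half q c) (spectral (X j) (half r b) L) 1"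
      using that s cuts_insert [of "{}" "(j, r)" X \<Omega> s L] cuts_insert [of "{(j, r)}" "(j, q)" X \<Omega> s L]
        carleman_functional_cut [OF L, of "(j, r)" b] by (simp add: cut_eq [OF L] cut_eq)
    also have "\<dots> = spectral (X j) (\<lambda>t. half r b t * half q c t) L 1"
      using spectral_spectral [OF L _ half_measurable half_bounds half_measurable half_bounds, of "X j" q c r b] that by simp
    also have "(\<lambda>t. half r b t * half q c t) = indicator ((if b = 1 then {..r} else {r<..}) \<inter> (if c = 1 then {..q} else {q<..}))"
      unfolding half_def indicator_inter_arith ..
    finally show ?thesis using spectral_\<mu> [OF that(1)] by auto
  qed
  \<comment> \<open>An event contained in every one of a sequence of events whose probabilities have
    bounds tending to 0.\<close>
  have null_if_le: "AE \<omega> in P. \<not> Q \<omega>"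
    if "\<And>n :: nat. emeasure P {\<omega> \<in> space P. R n \<omega>} \<le> f n" "f \<longlonglongrightarrow> (0 :: ennreal)"
      "\<And>n. {\<omega> \<in> space P. R n \<omega>} \<in> sets P" "\<And>n \<omega>. Q \<omega> \<Longrightarrow> R n \<omega>" for Q R f
  proof -
    have "emeasure P (\<Inter>n. {\<omega> \<in> space P. R n \<omega>}) \<le> f n" for n
      by (rule order_trans [OF _ that(1)]) (auto intro!: emeasure_mono that(3))
    then have "emeasure P (\<Inter>n. {\<omega> \<in> space P. R n \<omega>}) \<le> 0"
      by (intro LIMSEQ_le_const [OF that(2)]) auto
    moreover have "(\<Inter>n. {\<omega> \<in> space P. R n \<omega>}) \<in> sets P" using that(3) by auto
    ultimately have "(\<Inter>n. {\<omega> \<in> space P. R n \<omega>}) \<in> null_sets P" by (auto simp: null_sets_def)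
    then show ?thesis by (rule AE_I') (use that(4) in auto)
  qed
  have m1: "{\<omega> \<in> space P. \<omega> (j, r) = b} \<in> sets P" if "j \<in> \<Omega>" for j r b
    using measurable_sets [OF meas [of "(j, r)"], of "{b}"] that
    by (simp add: vimage_def Int_def conj_commute)
  have m2: "{\<omega> \<in> space P. \<omega> (j, r) = b \<and> \<omega> (j, q) = c} \<in> sets P" if "j \<in> \<Omega>" for j r b q c
    using sets.Int [OF m1 [OF that, of r b] m1 [OF that, of q c]] by (simp add: Int_def conj_ac)
  have ae_bits: "AE \<omega> in P. \<omega> (j, r) \<in> {0, 1}" if j: "j \<in> \<Omega>" for j r
  proof -
    have "emeasure P {\<omega> \<in> space P. \<omega> (j, r) \<in> {0, 1}}
        = emeasure P ({\<omega> \<in> space P. \<omega> (j, r) = 0} \<union> {\<omega> \<in> space P. \<omega> (j, r) = 1})"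
      by (rule arg_cong [where f = "emeasure P"]) auto
    also have "\<dots> = emeasure P {\<omega> \<in> space P. \<omega> (j, r) = 0} + emeasure P {\<omega> \<in> space P. \<omega> (j, r) = 1}"
      by (rule plus_emeasure [symmetric]) (auto intro: m1 [OF j])
    also have "\<dots> = emeasure (\<mu> j) {r<..} + emeasure (\<mu> j) {..r}" using one_bit [OF j] by simp
    also have "\<dots> = emeasure (\<mu> j) ({r<..} \<union> {..r})" by (rule plus_emeasure) auto
    also have "{r<..} \<union> {..r} = UNIV" by auto
    also have "emeasure (\<mu> j) UNIV = ennreal (spectral (X j) (indicator UNIV) L 1)"
      using spectral_\<mu> [OF j, of UNIV] by simp
    also have "indicator UNIV = (\<lambda>t :: real. t ^ 0 :: real)" by auto
    also have "spectral (X j) (\<lambda>t. t ^ 0) L 1 = L 1"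
      using j by (subst spectral_power [OF L]) auto
    finally have "emeasure P {\<omega> \<in> space P. \<omega> (j, r) \<in> {0, 1}} = 1" by (simp add: L1)
    moreover have "{\<omega> \<in> space P. \<omega> (j, r) \<in> {0, 1}} \<in> sets P"
      using measurable_sets [OF meas [of "(j, r)"], of "{0, 1}"] j
      by (simp add: vimage_def Int_def conj_commute)
    ultimately show ?thesis by (simp add: P.AE_iff_emeasure_eq_1)
  qed
  have ae_mono: "AE \<omega> in P. \<omega> (j, r) = 1 \<longrightarrow> \<omega> (j, q) \<in> {0, 1} \<longrightarrow> \<omega> (j, q) = 1"
    if j: "j \<in> \<Omega>" and "r < q" for j r q
  proof -
    have e: "{..r} \<inter> {q<..} = {}" using that(2) by auto
    have "AE \<omega> in P. \<not> (\<omega> (j, r) = 1 \<and> \<omega> (j, q) = 0)"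
      by (rule null_if_le [where f1 = "\<lambda>_. 0" and R1 = "\<lambda>_ \<omega>. \<omega> (j, r) = 1 \<and> \<omega> (j, q) = 0"])
        (use that two_bits [OF j, of 1 0 r q] m2 [OF j] in \<open>auto simp: e\<close>)
    then show ?thesis by eventually_elim auto
  qed
  have lim: "(\<lambda>n. emeasure (\<mu> j) (A n)) \<longlonglongrightarrow> 0"
    if "range A \<subseteq> sets borel" "decseq A" "(\<Inter>n. A n) = {}" for A :: "nat \<Rightarrow> real set" and j
  proof -
    interpret finite_measure "\<mu> j" by (rule fin_\<mu>)
    have "(\<lambda>n. emeasure (\<mu> j) (A n)) \<longlonglongrightarrow> emeasure (\<mu> j) (\<Inter>n. A n)"
      using that by (intro Lim_emeasure_decseq) auto
    then show ?thesis by (simp add: that)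
  qed
  \<comment> \<open>A failure of right-continuity puts the bit change, for each n, into the interval
    from r to r + 1 / (n + 1), open at \<open>r\<close>. These intervals decrease to the empty
    set.\<close>
  have ae_right: "AE \<omega> in P. \<not> (\<omega> (j, r) = 0 \<and> (\<forall>q :: rat. r < of_rat q \<longrightarrow> \<omega> (j, of_rat q) = 1))"
    if j: "j \<in> \<Omega>" for j r
  proof -
    have "\<exists>q :: rat. r < of_rat q \<and> of_rat q < r + 1 / real (Suc n)" for n
      by (rule of_rat_dense) simp
    then obtain q :: "nat \<Rightarrow> rat" where q: "r < of_rat (q n)" "of_rat (q n) < r + 1 / real (Suc n)" for n
      by metis
    show ?thesis
    proof (rule null_if_le [where R1 = "\<lambda>n \<omega>. \<omega> (j, r) = 0 \<and> \<omega> (j, of_rat (q n)) = 1"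
          and f1 = "\<lambda>n. emeasure (\<mu> j) {r<..r + 1 / real (Suc n)}"])
      fix n
      have "emeasure P {\<omega> \<in> space P. \<omega> (j, r) = 0 \<and> \<omega> (j, of_rat (q n)) = 1} = emeasure (\<mu> j) ({r<..} \<inter> {..of_rat (q n)})"
        using two_bits [OF j, of 0 1 r "of_rat (q n)"] q(1) [of n] by simp
      also have "\<dots> \<le> emeasure (\<mu> j) {r<..r + 1 / real (Suc n)}"
        using q(2) [of n] by (intro emeasure_mono) auto
      finally show "emeasure P {\<omega> \<in> space P. \<omega> (j, r) = 0 \<and> \<omega> (j, of_rat (q n)) = 1}
          \<le> emeasure (\<mu> j) {r<..r + 1 / real (Suc n)}" .
    next
      show "(\<lambda>n. emeasure (\<mu> j) {r<..r + 1 / real (Suc n)}) \<longlonglongrightarrow> 0"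
      proof (rule lim)
        show "decseq (\<lambda>n. {r<..r + 1 / real (Suc n)})"
        proof (rule antimonoI)
          fix m n :: nat assume "m \<le> n"
          then have "1 / real (Suc n) \<le> 1 / real (Suc m)" by (simp add: frac_le)
          then show "{r<..r + 1 / real (Suc n)} \<subseteq> {r<..r + 1 / real (Suc m)}" by auto
        qed
        have False if "\<forall>n. r < t \<and> t \<le> r + 1 / real (Suc n)" for t
        proof -
          have "0 < t - r" using that by simp
          then obtain n where "1 / real (Suc n) < t - r" using nat_approx_posE by metis
          then show False using that [rule_format, of n] by simp
        qed
        then show "(\<Inter>n. {r<..r + 1 / real (Suc n)}) = {}" by fastforce
      qed auto
    qed (use m2 [OF j] q in auto)
  qed
  have ae_ex1: "AE \<omega> in P. \<not> (\<forall>q :: rat. \<omega> (j, of_rat q) = 0)" if j: "j \<in> \<Omega>" for j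
  proof (rule null_if_le [where R1 = "\<lambda>n \<omega>. \<omega> (j, real n) = 0" and f1 = "\<lambda>n. emeasure (\<mu> j) {real n<..}"])
    show "(\<lambda>n. emeasure (\<mu> j) {real n<..}) \<longlonglongrightarrow> 0"
    proof (rule lim)
      have "\<exists>n. x \<le> real n" for x by (rule real_arch_simple)
      then show "(\<Inter>n. {real n<..}) = {}" by (simp add: set_eq_iff not_less)
    qed (auto intro!: antimonoI)
    show "\<omega> (j, real n) = 0" if "\<forall>q :: rat. \<omega> (j, of_rat q) = 0" for n \<omega>
      using that [rule_format, of "of_nat n"] by simp
  qed (use m1 [OF j] one_bit [OF j, of 0] in auto)
  have ae_ex0: "AE \<omega> in P. \<not> (\<forall>q :: rat. \<omega> (j, of_rat q) = 1)" if j: "j \<in> \<Omega>" for j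
  proof (rule null_if_le [where R1 = "\<lambda>n \<omega>. \<omega> (j, - real n) = 1" and f1 = "\<lambda>n. emeasure (\<mu> j) {..- real n}"])
    show "(\<lambda>n. emeasure (\<mu> j) {..- real n}) \<longlonglongrightarrow> 0"
    proof (rule lim)
      have "\<exists>n. - real n < x" for x using reals_Archimedean2 [of "- x"] by (simp add: minus_less_iff)
      then show "(\<Inter>n. {..- real n}) = {}" by (simp add: set_eq_iff not_le)
    qed (auto intro!: antimonoI)
    show "\<omega> (j, - real n) = 1" if "\<forall>q :: rat. \<omega> (j, of_rat q) = 1" for n \<omega>
      using that [rule_format, of "- of_nat n"] by (simp add: of_rat_minus)
  qed (use m1 [OF j] one_bit [OF j, of 1] in auto)
  \<comment> \<open>The exceptional set depends on \<open>j\<close> and \<open>r\<close>. Only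
    finitely many such pairs are combined at a time, which is what admits an uncountable
    \<Omega>.\<close>
  have ae_le: "AE \<omega> in P. bit_infimum \<omega> j \<le> r \<longleftrightarrow> \<omega> (j, r) = 1" if j: "j \<in> \<Omega>" for j r
  proof -
    have 1: "AE \<omega> in P. \<forall>q :: rat. \<omega> (j, of_rat q) \<in> {0, 1}" by (subst AE_all_countable) (intro allI ae_bits j)
    have 2: "AE \<omega> in P. \<forall>(q :: rat) q' :: rat. q < q' \<longrightarrow> \<omega> (j, of_rat q) = 1 \<longrightarrow> \<omega> (j, of_rat q') \<in> {0, 1} \<longrightarrow> \<omega> (j, of_rat q') = 1"
      unfolding AE_all_countable
    proof (intro allI)
      fix q q' :: rat
      show "AE \<omega> in P. q < q' \<longrightarrow> \<omega> (j, of_rat q) = 1 \<longrightarrow> \<omega> (j, of_rat q') \<in> {0, 1} \<longrightarrow> \<omega> (j, of_rat q') = 1"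
        using ae_mono [OF j, of "of_rat q" "of_rat q'"] by (cases "q < q'") (auto simp: of_rat_less)
    qed
    have 3: "AE \<omega> in P. \<forall>q :: rat. r < of_rat q \<longrightarrow> \<omega> (j, r) = 1 \<longrightarrow> \<omega> (j, of_rat q) \<in> {0, 1} \<longrightarrow> \<omega> (j, of_rat q) = 1"
      unfolding AE_all_countable
    proof (intro allI)
      fix q :: rat
      show "AE \<omega> in P. r < of_rat q \<longrightarrow> \<omega> (j, r) = 1 \<longrightarrow> \<omega> (j, of_rat q) \<in> {0, 1} \<longrightarrow> \<omega> (j, of_rat q) = 1"
        using ae_mono [OF j, of r "of_rat q"] by (cases "r < of_rat q") auto
    qed
    show ?thesis
      using 1 2 3 ae_bits [OF j, of r] ae_right [OF j, of r] ae_ex1 [OF j] ae_ex0 [OF j]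
    proof eventually_elim
      case (elim \<omega>)
      show ?case
        by (rule bit_infimum_le_iff) (use elim in \<open>blast+\<close>)
    qed
  qed
  define Y where "Y \<omega> = (\<lambda>j\<in>\<Omega>. bit_infimum \<omega> j)" for \<omega> :: "'i \<times> real \<Rightarrow> real"
  have meas_Y: "Y \<in> measurable P (PiM \<Omega> (\<lambda>_. borel))"
    unfolding Y_def
  proof (rule measurable_restrict)
    fix j assume j: "j \<in> \<Omega>"
    have [measurable]: "(\<lambda>\<omega>. \<omega> (j, r)) \<in> borel_measurable P" for r using meas [of "(j, r)"] j by simp
    show "(\<lambda>\<omega>. bit_infimum \<omega> j) \<in> borel_measurable P"
      unfolding bit_infimum_def by measurable
  qed
  define \<nu> where "\<nu> = distr P (PiM \<Omega> (\<lambda>_. borel)) Y"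
  have "prob_space \<nu>" unfolding \<nu>_def by (rule P.prob_space_distr [OF meas_Y])
  moreover have "sets \<nu> = sets (PiM \<Omega> (\<lambda>_. borel))" by (simp add: \<nu>_def)
  moreover have "emeasure \<nu> (half_lines \<Omega> J) = ennreal (half_line_cuts X \<Omega> J L 1)"
    if J: "finite J" "J \<subseteq> \<Omega> \<times> UNIV" for J
  proof -
    note hl = half_lines_measurable [OF J]
    have "emeasure \<nu> (half_lines \<Omega> J) = emeasure P (Y -` half_lines \<Omega> J \<inter> space P)"
      unfolding \<nu>_def by (rule emeasure_distr [OF meas_Y hl])
    also have "\<dots> = emeasure P {\<omega> \<in> space P. \<forall>a\<in>J. \<omega> a = 1}"
    proof (rule emeasure_eq_AE)
      have "AE \<omega> in P. \<forall>a\<in>J. bit_infimum \<omega> (fst a) \<le> snd a \<longleftrightarrow> \<omega> a = 1"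
        unfolding AE_ball_countable [OF countable_finite [OF J(1)]]
      proof
        fix a assume "a \<in> J"
        then have "fst a \<in> \<Omega>" using J by auto
        then show "AE \<omega> in P. bit_infimum \<omega> (fst a) \<le> snd a \<longleftrightarrow> \<omega> a = 1"
          using ae_le [of "fst a" "snd a"] by simp
      qed
      then show "AE \<omega> in P. \<omega> \<in> Y -` half_lines \<Omega> J \<inter> space P \<longleftrightarrow> \<omega> \<in> {\<omega> \<in> space P. \<forall>a\<in>J. \<omega> a = 1}"
      proof eventually_elim
        case (elim \<omega>)
        have "Y \<omega> (fst a) = bit_infimum \<omega> (fst a)" if "a \<in> J" for a
          using that J by (auto simp: Y_def)
        then have "(\<forall>(j, r)\<in>J. Y \<omega> j \<le> r) \<longleftrightarrow> (\<forall>a\<in>J. \<omega> a = 1)"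
          using elim by (auto simp: case_prod_unfold)
        moreover have "Y \<omega> \<in> \<Omega> \<rightarrow>\<^sub>E UNIV" by (simp add: Y_def)
        ultimately show ?case by (auto simp: half_lines_def)
      qed
      show "{\<omega> \<in> space P. \<forall>a\<in>J. \<omega> a = 1} \<in> sets P"
      proof (rule sets.sets_Collect_finite_All [OF _ J(1)])
        fix a assume "a \<in> J"
        then have "fst a \<in> \<Omega>" using J by auto
        from m1 [OF this, of "snd a" 1] show "{\<omega> \<in> space P. \<omega> a = 1} \<in> sets P" by simp
      qed
    qed (rule measurable_sets [OF meas_Y hl])
    also have "\<dots> = ennreal (half_line_cuts X \<Omega> J L 1)"
      using em [OF J, of "\<lambda>_. 1"] by (simp add: half_line_cuts_def)
    finally show ?thesis .
  qed
  ultimately show thesis by (rule that)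
qed

section \<open>Half-lines and moments\<close>

lemma finite_measure_eqI_atMost:
  fixes \<mu> \<nu> :: "real measure"
  assumes "sets \<mu> = sets borel" "sets \<nu> = sets borel" "finite_measure \<mu>"
    and eq: "\<And>r. emeasure \<mu> {..r} = emeasure \<nu> {..r}"
  shows "\<mu> = \<nu>"
proof (rule measure_eqI_generator_eq [where E = "range atMost" and \<Omega> = UNIV and A = "\<lambda>n. {..real n}"])
  interpret finite_measure \<mu> by fact
  show "Int_stable (range (atMost :: real \<Rightarrow> real set))"
  proof (rule Int_stableI)
    fix a b :: "real set" assume "a \<in> range atMost" "b \<in> range atMost"
    then obtain x y where "a = {..x}" "b = {..y}" by auto
    then have "a \<inter> b = {..min x y}" by auto
    then show "a \<inter> b \<in> range atMost" by blast
  qed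
  show "sets \<mu> = sigma_sets UNIV (range atMost)" "sets \<nu> = sigma_sets UNIV (range atMost)"
    using assms(1,2) by (simp_all add: borel_eq_atMost)
  show "(\<Union>n. {..real n}) = UNIV" using real_arch_simple by auto
  show "emeasure \<mu> {..real i} \<noteq> \<infinity>" for i by simp
qed (auto simp: eq)

lemma sets_PiM_half_lines:
  "sets (PiM \<Omega> (\<lambda>_. borel)) = sigma_sets (\<Omega> \<rightarrow>\<^sub>E UNIV) {half_lines \<Omega> J | J. finite J \<and> J \<subseteq> \<Omega> \<times> UNIV}"
proof
  define N where "N = sigma (\<Omega> \<rightarrow>\<^sub>E (UNIV :: real set)) {half_lines \<Omega> J | J. finite J \<and> J \<subseteq> \<Omega> \<times> UNIV}"
  have sub: "{half_lines \<Omega> J | J. finite J \<and> J \<subseteq> \<Omega> \<times> UNIV} \<subseteq> Pow (\<Omega> \<rightarrow>\<^sub>E UNIV)"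
    by (auto simp: half_lines_def)
  have sets_N: "sets N = sigma_sets (\<Omega> \<rightarrow>\<^sub>E UNIV) {half_lines \<Omega> J | J. finite J \<and> J \<subseteq> \<Omega> \<times> UNIV}"
    and space_N: "space N = \<Omega> \<rightarrow>\<^sub>E UNIV"
    using sub by (simp_all add: N_def)
  have id: "(\<lambda>x. x) \<in> measurable N (PiM \<Omega> (\<lambda>_. borel))"
  proof (rule measurable_PiM_single')
    fix i assume i: "i \<in> \<Omega>"
    show "(\<lambda>x. x i) \<in> borel_measurable N"
    proof (rule borel_measurableI_le)
      fix r
      have "{x \<in> space N. x i \<le> r} = half_lines \<Omega> {(i, r)}" by (auto simp: space_N half_lines_def)
      moreover have "finite {(i, r)} \<and> {(i, r)} \<subseteq> \<Omega> \<times> UNIV" using i by simp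
      ultimately show "{x \<in> space N. x i \<le> r} \<in> sets N" unfolding sets_N by (blast intro: sigma_sets.Basic)
    qed
  qed (simp add: space_N)
  have "A \<inter> space N \<in> sets N" if "A \<in> sets (PiM \<Omega> (\<lambda>_. borel))" for A
    using measurable_sets [OF id that] by (simp add: vimage_def)
  moreover have "A \<inter> space N = A" if "A \<in> sets (PiM \<Omega> (\<lambda>_. borel :: real measure))" for A
    using sets.sets_into_space [OF that] by (auto simp: space_N space_PiM)
  ultimately show "sets (PiM \<Omega> (\<lambda>_. borel)) \<subseteq> sigma_sets (\<Omega> \<rightarrow>\<^sub>E UNIV) {half_lines \<Omega> J | J. finite J \<and> J \<subseteq> \<Omega> \<times> UNIV}"
    unfolding sets_N [symmetric] by auto
  show "sigma_sets (\<Omega> \<rightarrow>\<^sub>E UNIV) {half_lines \<Omega> J | J. finite J \<and> J \<subseteq> \<Omega> \<times> UNIV} \<subseteq> sets (PiM \<Omega> (\<lambda>_. borel))"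
    using half_lines_measurable [of _ \<Omega>] sets.sigma_sets_subset [of "{half_lines \<Omega> J | J. finite J \<and> J \<subseteq> \<Omega> \<times> UNIV}" "PiM \<Omega> (\<lambda>_. borel)"]
    by (auto simp: space_PiM)
qed

lemma measure_eqI_half_lines:
  assumes \<mu>: "sets \<mu> = sets (PiM \<Omega> (\<lambda>_. borel :: real measure))" "finite_measure \<mu>"
    and \<nu>: "sets \<nu> = sets (PiM \<Omega> (\<lambda>_. borel :: real measure))"
    and eq: "\<And>J. finite J \<Longrightarrow> J \<subseteq> \<Omega> \<times> UNIV \<Longrightarrow> emeasure \<mu> (half_lines \<Omega> J) = emeasure \<nu> (half_lines \<Omega> J)"
  shows "\<mu> = \<nu>"
proof (rule measure_eqI_generator_eq [where \<Omega> = "\<Omega> \<rightarrow>\<^sub>E UNIV" and A = "\<lambda>_. \<Omega> \<rightarrow>\<^sub>E UNIV"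
      and E = "{half_lines \<Omega> J | J. finite J \<and> J \<subseteq> \<Omega> \<times> UNIV}"])
  have "half_lines \<Omega> J \<inter> half_lines \<Omega> J' = half_lines \<Omega> (J \<union> J')" for J J' :: "('a \<times> real) set"
    by (auto simp: half_lines_def)
  then show "Int_stable {half_lines \<Omega> J | J. finite J \<and> J \<subseteq> \<Omega> \<times> UNIV}"
    by (auto simp: Int_stable_def) (metis Un_subset_iff finite_UnI)
  have "half_lines \<Omega> {} = \<Omega> \<rightarrow>\<^sub>E UNIV" by (simp add: half_lines_def)
  then show "range (\<lambda>_::nat. \<Omega> \<rightarrow>\<^sub>E UNIV) \<subseteq> {half_lines \<Omega> J | J. finite J \<and> J \<subseteq> \<Omega> \<times> UNIV}"
    by blast
qed (use \<mu> \<nu> eq in \<open>auto simp: sets_PiM_half_lines half_lines_def finite_measure.emeasure_finite\<close>)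

lemma half_line_cuts_empty: "half_line_cuts X \<Omega> {} L = L"
  by (simp add: half_line_cuts_def)

lemma carleman_functional_half_line_cuts:
  "finite J \<Longrightarrow> carleman_functional (X ` \<Omega>) L \<Longrightarrow> carleman_functional (X ` \<Omega>) (half_line_cuts X \<Omega> J L)"
  unfolding half_line_cuts_def by (rule carleman_functional_cuts)

text \<open>The hinge between half-lines and moments: as a function of \<open>r\<close>, one more
  half-line is the distribution function of a one-variable measure that is determined by its
  moments.\<close>

lemma half_line_cuts_insert:
  assumes L: "carleman_functional (X ` \<Omega>) L" and J: "finite J" and j: "j \<in> \<Omega>"
  shows "half_line_cuts X \<Omega> (insert (j, r) J) L (p * p)
    = measure (element_measure (X j) (half_line_cuts X \<Omega> J L) (p * p)) {..r}"
proof -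
  let ?H = "half_line_cuts X \<Omega> J L"
  note H = carleman_functional_half_line_cuts [OF J L]
  let ?\<mu> = "element_measure (X j) ?H (p * p)"
  have sets: "sets ?\<mu> = sets borel"
    by (intro has_moments_sets [OF element_measure] carleman_functional_linear [OF H] psd_element_square
        carleman_functional_psd [OF H])
  have "half_line_cuts X \<Omega> (insert (j, r) J) L = spectral (X j) (half r 1) ?H"
    unfolding half_line_cuts_def cuts_insert' [OF L J]
    by (rule cut_eq [OF carleman_functional_cuts [OF J L] j])
  then have "half_line_cuts X \<Omega> (insert (j, r) J) L (p * p) = spectral (X j) (half r 1) ?H (p * p)"
    by simp
  also have "\<dots> = (\<integral>t. indicator {..r} t \<partial>?\<mu>)"
    using spectral_square [OF H _ polynomially_bounded_half, of "X j" r 1 p] j by (simp add: half_def)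
  also have "\<dots> = measure ?\<mu> {..r}"
    using sets sets_eq_imp_space_eq [OF sets] by simp
  finally show ?thesis .
qed

text \<open>What the measure-theoretic part has to know about polynomials: at each point an algebra
  homomorphism sending generators to coordinates, measurable in the point. Monomials do not
  appear.\<close>

locale evaluation =
  fixes X :: "'i \<Rightarrow> 'a::{comm_ring_1,real_algebra_1}" and \<Omega> :: "'i set"
    and ev :: "('i \<Rightarrow> real) \<Rightarrow> 'a \<Rightarrow> real"
  assumes ev_linear: "linear (ev x)"
    and ev_mult: "ev x (f * g) = ev x f * ev x g"
    and ev_one: "ev x 1 = 1"
    and ev_X: "j \<in> \<Omega> \<Longrightarrow> ev x (X j) = x j"
    and ev_measurable: "(\<lambda>x. ev x f) \<in> borel_measurable (PiM \<Omega> (\<lambda>_. borel))"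
begin

lemma ev_power: "ev x (f ^ k) = ev x f ^ k"
  by (induction k) (simp_all add: ev_one ev_mult)

lemma ev_of_real: "ev x (of_real c) = c"
  using linear_scale [OF ev_linear, of x c 1] by (simp add: of_real_def ev_one)

text \<open>Start from the known masses of half-lines and multiply by one squared linear factor at a
  time. Under the weight v^2 on an intersection of half-lines, the coordinate x_j has the
  distribution function of the measure of X j, so it has that law, and (x_j + e)^2 may be integrated
  against it.\<close>

lemma moments_of_half_lines:
  assumes L: "carleman_functional (X ` \<Omega>) L"
    and \<nu>: "sets \<nu> = sets (PiM \<Omega> (\<lambda>_. borel))" "finite_measure \<nu>"
    and hl: "\<And>J. finite J \<Longrightarrow> J \<subseteq> \<Omega> \<times> UNIV \<Longrightarrow>
      emeasure \<nu> (half_lines \<Omega> J) = ennreal (half_line_cuts X \<Omega> J L 1)"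
    and js: "set js \<subseteq> \<Omega>"
  shows "integrable \<nu> (\<lambda>x. ev x (prod_list (map X js)))"
    "(\<integral>x. ev x (prod_list (map X js)) \<partial>\<nu>) = L (prod_list (map X js))"
proof -
  interpret finite_measure \<nu> by fact
  note [measurable_cong] = \<nu>(1)
  note [measurable] = ev_measurable
  have hl_sets: "half_lines \<Omega> J \<in> sets \<nu>" if "finite J" "J \<subseteq> \<Omega> \<times> UNIV" for J
    unfolding \<nu>(1) using that by (rule half_lines_measurable)
  have coord [measurable]: "(\<lambda>x. x j) \<in> borel_measurable \<nu>" if "j \<in> \<Omega>" for j
    using measurable_component_singleton [OF that, of "\<lambda>_. borel"] \<nu>(1) by (simp cong: measurable_cong_sets)
  \<comment> \<open>All finite \<open>J\<close> are required at once: the distribution function of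
    the next coordinate is obtained by adding one half-line to \<open>J\<close>.\<close>
  define G where "G = {v. \<forall>J. finite J \<longrightarrow> J \<subseteq> \<Omega> \<times> UNIV \<longrightarrow>
    (\<integral>\<^sup>+x. ennreal (ev x (v * v)) * indicator (half_lines \<Omega> J) x \<partial>\<nu>) = ennreal (half_line_cuts X \<Omega> J L (v * v))}"
  have G1: "1 \<in> G"
    using hl hl_sets by (auto simp: G_def ev_one)
  have G_step: "v * (X j + of_real e) \<in> G" if v: "v \<in> G" and j: "j \<in> \<Omega>" for v j e
    unfolding G_def
  proof (intro CollectI allI impI)
    fix J :: "('i \<times> real) set"
    assume J: "finite J" "J \<subseteq> \<Omega> \<times> UNIV"
    let ?H = "half_line_cuts X \<Omega> J L"
    note H = carleman_functional_half_line_cuts [OF J(1) L]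
    define \<mu> where "\<mu> = element_measure (X j) ?H (v * v)"
    have sq: "psd_element ?H (v * v)" by (rule psd_element_square [OF carleman_functional_psd [OF H]])
    have mom: "has_moments \<mu> (\<lambda>k. ?H (X j ^ k * (v * v)))"
      unfolding \<mu>_def by (rule element_measure [OF carleman_functional_linear [OF H] sq])
    interpret \<mu>: finite_measure \<mu> using mom by (simp add: has_moments_def)
    have [measurable]: "half_lines \<Omega> J \<in> sets \<nu>" by (rule hl_sets [OF J])
    have [measurable]: "(\<lambda>x. x j) \<in> borel_measurable \<nu>" by (rule coord [OF j])
    define D where "D = density \<nu> (\<lambda>x. ennreal (ev x (v * v)) * indicator (half_lines \<Omega> J) x)"
    have [measurable_cong]: "sets D = sets \<nu>" by (simp add: D_def)
    define \<rho> where "\<rho> = distr D borel (\<lambda>x. x j)"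
    have sets_\<rho>: "sets \<rho> = sets borel" by (simp add: \<rho>_def)
    have at_most: "emeasure \<rho> {..r} = emeasure \<mu> {..r}" for r
    proof -
      have J': "finite (insert (j, r) J)" "insert (j, r) J \<subseteq> \<Omega> \<times> UNIV" using J j by auto
      have "emeasure \<rho> {..r} = emeasure D ((\<lambda>x. x j) -` {..r} \<inter> space D)"
        unfolding \<rho>_def by (rule emeasure_distr) auto
      also have "\<dots> = (\<integral>\<^sup>+x. ennreal (ev x (v * v)) * indicator (half_lines \<Omega> J) x * indicator ((\<lambda>x. x j) -` {..r} \<inter> space D) x \<partial>\<nu>)"
        unfolding D_def by (rule emeasure_density) (auto simp: D_def)
      also have "\<dots> = (\<integral>\<^sup>+x. ennreal (ev x (v * v)) * indicator (half_lines \<Omega> (insert (j, r) J)) x \<partial>\<nu>)"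
        by (rule nn_integral_cong) (auto simp: D_def half_lines_def indicator_def)
      also have "\<dots> = ennreal (half_line_cuts X \<Omega> (insert (j, r) J) L (v * v))"
        using v J' unfolding G_def by blast
      also have "\<dots> = emeasure \<mu> {..r}"
        unfolding half_line_cuts_insert [OF L J(1) j] \<mu>_def [symmetric] by (simp add: \<mu>.emeasure_eq_measure)
      finally show ?thesis .
    qed
    have "\<rho> = \<mu>"
      using finite_measure_eqI_atMost [of \<mu> \<rho>] has_moments_sets [OF mom] sets_\<rho> \<mu>.finite_measure_axioms at_most
      by auto
    have int_sq: "integrable \<mu> (\<lambda>t. (t ^ 1 + e)\<^sup>2)"
      by (rule integrable_polynomially_bounded [OF mom polynomially_bounded_power_plus_square])
    have "(\<integral>\<^sup>+x. ennreal (ev x (v * (X j + of_real e) * (v * (X j + of_real e)))) * indicator (half_lines \<Omega> J) x \<partial>\<nu>)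
      = (\<integral>\<^sup>+x. (ennreal (ev x (v * v)) * indicator (half_lines \<Omega> J) x) * ennreal ((x j ^ 1 + e)\<^sup>2) \<partial>\<nu>)"
    proof (rule nn_integral_cong)
      fix x
      have "ev x (v * (X j + of_real e) * (v * (X j + of_real e))) = ev x (v * v) * (x j ^ 1 + e)\<^sup>2"
        by (simp add: ev_mult linear_add [OF ev_linear] ev_X [OF j] ev_of_real power2_eq_square)
      moreover have "0 \<le> ev x (v * v)" by (simp add: ev_mult)
      ultimately show "ennreal (ev x (v * (X j + of_real e) * (v * (X j + of_real e)))) * indicator (half_lines \<Omega> J) x
          = (ennreal (ev x (v * v)) * indicator (half_lines \<Omega> J) x) * ennreal ((x j ^ 1 + e)\<^sup>2)"
        by (simp only: ennreal_mult zero_le_power2) (simp add: mult_ac)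
    qed
    also have "\<dots> = (\<integral>\<^sup>+x. ennreal ((x j ^ 1 + e)\<^sup>2) \<partial>D)"
      unfolding D_def by (rule nn_integral_density [symmetric]) auto
    also have "\<dots> = (\<integral>\<^sup>+t. ennreal ((t ^ 1 + e)\<^sup>2) \<partial>\<rho>)"
      unfolding \<rho>_def by (rule nn_integral_distr [symmetric]) auto
    also have "\<dots> = ennreal (\<integral>t. (t ^ 1 + e)\<^sup>2 \<partial>\<mu>)"
      unfolding \<open>\<rho> = \<mu>\<close> by (rule nn_integral_eq_integral [OF int_sq]) auto
    also have "(\<integral>t. (t ^ 1 + e)\<^sup>2 \<partial>\<mu>) = spectral (X j) (\<lambda>t. (t ^ 1 + e)\<^sup>2) ?H (v * v)"
      unfolding \<mu>_def using j by (intro spectral_square [OF H _ polynomially_bounded_power_plus_square, symmetric]) auto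
    also have "\<dots> = ?H ((X j ^ 1 + of_real e) * (X j ^ 1 + of_real e) * (v * v))"
      using spectral_power_plus_square [OF H, of "X j" 1 e] j by simp
    also have "(X j ^ 1 + of_real e) * (X j ^ 1 + of_real e) * (v * v) = v * (X j + of_real e) * (v * (X j + of_real e))"
      by (simp add: mult_ac)
    finally show "(\<integral>\<^sup>+x. ennreal (ev x (v * (X j + of_real e) * (v * (X j + of_real e)))) * indicator (half_lines \<Omega> J) x \<partial>\<nu>)
      = ennreal (?H (v * (X j + of_real e) * (v * (X j + of_real e))))" .
  qed
  define V where "V f \<longleftrightarrow> integrable \<nu> (\<lambda>x. ev x f) \<and> (\<integral>x. ev x f \<partial>\<nu>) = L f" for f
  have V_square: "V (v * v)" if "v \<in> G" for v
  proof -
    have "(\<integral>\<^sup>+x. ennreal (ev x (v * v)) * indicator (half_lines \<Omega> {}) x \<partial>\<nu>) = ennreal (half_line_cuts X \<Omega> {} L (v * v))"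
      using that unfolding G_def by blast
    moreover have "(\<integral>\<^sup>+x. ennreal (ev x (v * v)) * indicator (half_lines \<Omega> {}) x \<partial>\<nu>) = (\<integral>\<^sup>+x. ennreal (ev x (v * v)) \<partial>\<nu>)"
      using sets_eq_imp_space_eq [OF \<nu>(1)]
      by (intro nn_integral_cong) (simp add: half_lines_def space_PiM)
    ultimately have nn: "(\<integral>\<^sup>+x. ennreal (ev x (v * v)) \<partial>\<nu>) = ennreal (L (v * v))"
      by (simp add: half_line_cuts_empty)
    have pos: "0 \<le> ev x (v * v)" for x by (simp add: ev_mult)
    have "0 \<le> L (v * v)" by (rule psd_square [OF carleman_functional_psd [OF L]])
    with nn pos show ?thesis
      unfolding V_def
      by (auto intro!: integrableI_nn_integral_finite [OF _ _ nn] simp: integral_eq_nn_integral)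
  qed
  have V_lin: "V (f + g)" "V (c *\<^sub>R f)" "V (f - g)" if "V f" "V g" for f g c
    using that carleman_functional_linear [OF L]
    by (auto simp: V_def linear_add linear_scale linear_diff linear_add [OF ev_linear] linear_scale [OF ev_linear]
        linear_diff [OF ev_linear])
  \<comment> \<open>A product of variables is not a square. A variable is traded for squares by 2
    v^2 X = (v (X + 1))^2 - (v X)^2 - v^2, each multiplied by the remaining product; hence the
    square v * v is carried through the induction.\<close>
  have "V (v * v * prod_list (map X js))" if "v \<in> G" for v
    using js that
  proof (induction js arbitrary: v)
    case Nil
    then show ?case by (simp add: V_square)
  next
    case (Cons j js)
    let ?r = "prod_list (map X js)"
    define a where "a = v * (X j + of_real 1)"
    define b where "b = v * (X j + of_real 0)"
    have "a \<in> G" unfolding a_def by (rule G_step) (use Cons.prems in auto)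
    moreover have "b \<in> G" unfolding b_def by (rule G_step) (use Cons.prems in auto)
    ultimately have V: "V (a * a * ?r)" "V (b * b * ?r)" "V (v * v * ?r)" using Cons by auto
    have "a * a * ?r - b * b * ?r - v * v * ?r = 2 * (v * v * prod_list (map X (j # js)))"
      by (simp add: a_def b_def algebra_simps)
    also have "\<dots> = 2 *\<^sub>R (v * v * prod_list (map X (j # js)))" by (simp only: scaleR_2 mult_2)
    finally have "v * v * prod_list (map X (j # js)) = (1 / 2) *\<^sub>R (a * a * ?r - b * b * ?r - v * v * ?r)"
      by simp
    moreover have d: "V (a * a * ?r - b * b * ?r - v * v * ?r)"
      by (rule V_lin(3) [OF V_lin(3) [OF V(1,2)] V(3)])
    ultimately show ?case using V_lin(2) [OF d d] by simp
  qed
  from this [OF G1] show "integrable \<nu> (\<lambda>x. ev x (prod_list (map X js)))"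
    "(\<integral>x. ev x (prod_list (map X js)) \<partial>\<nu>) = L (prod_list (map X js))"
    by (simp_all add: V_def)
qed

text \<open>The reverse passage, by induction on the half-lines: weighted by p^2 and restricted to
  those treated so far, the next coordinate has the moments of a determinate measure. That fixes its
  law, and its distribution function is the value for one more half-line.\<close>

lemma half_lines_of_moments:
  assumes L: "carleman_functional (X ` \<Omega>) L"
    and \<nu>: "sets \<nu> = sets (PiM \<Omega> (\<lambda>_. borel))"
    and int: "\<And>f. integrable \<nu> (\<lambda>x. ev x f)" and mom: "\<And>f. (\<integral>x. ev x f \<partial>\<nu>) = L f"
    and J: "finite J" "J \<subseteq> \<Omega> \<times> UNIV"
  shows "emeasure \<nu> (half_lines \<Omega> J) = ennreal (half_line_cuts X \<Omega> J L 1)"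
proof -
  have sp: "space \<nu> = \<Omega> \<rightarrow>\<^sub>E UNIV" using sets_eq_imp_space_eq [OF \<nu>] by (simp add: space_PiM)
  note [measurable_cong] = \<nu>
  note [measurable] = ev_measurable
  have int_J: "integrable \<nu> (\<lambda>x. indicator (half_lines \<Omega> J) x * ev x q)" if "finite J" "J \<subseteq> \<Omega> \<times> UNIV" for J q
  proof -
    have "integrable \<nu> (\<lambda>x. ev x q * indicator (half_lines \<Omega> J) x)"
      using half_lines_measurable [OF that] \<nu> by (intro integrable_real_mult_indicator int) simp
    then show ?thesis by (simp only: mult.commute)
  qed
  have "(\<integral>x. indicator (half_lines \<Omega> J) x * ev x (p * p) \<partial>\<nu>) = half_line_cuts X \<Omega> J L (p * p)" for p
    using J
  proof (induction J arbitrary: p rule: finite_induct)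
    case empty
    have "(\<integral>x. indicator (half_lines \<Omega> {}) x * ev x (p * p) \<partial>\<nu>) = (\<integral>x. ev x (p * p) \<partial>\<nu>)"
      by (rule Bochner_Integration.integral_cong) (auto simp: half_lines_def sp)
    then show ?case by (simp add: half_line_cuts_empty mom)
  next
    case (insert a J)
    obtain j r where a: "a = (j, r)" by fastforce
    have j: "j \<in> \<Omega>" and J: "finite J" "J \<subseteq> \<Omega> \<times> UNIV" using insert a by auto
    let ?H = "half_line_cuts X \<Omega> J L"
    let ?I = "indicator (half_lines \<Omega> J) :: _ \<Rightarrow> real"
    note H = carleman_functional_half_line_cuts [OF J(1) L]
    \<comment> \<open>The induction hypothesis speaks of squares, but the odd moments X^k p^2 are
      not squares; linearity extends it to all elements.\<close>
    have all: "(\<integral>x. ?I x * ev x q \<partial>\<nu>) = ?H q" for q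
    proof -
      have "linear (\<lambda>q. \<integral>x. ?I x * ev x q \<partial>\<nu>)"
      proof (rule linearI)
        fix q q' :: 'a and c :: real
        show "(\<integral>x. ?I x * ev x (q + q') \<partial>\<nu>) = (\<integral>x. ?I x * ev x q \<partial>\<nu>) + (\<integral>x. ?I x * ev x q' \<partial>\<nu>)"
          by (simp add: linear_add [OF ev_linear] distrib_left int_J [OF J])
        have "?I x * ev x (c *\<^sub>R q) = c * (?I x * ev x q)" for x
          by (simp add: linear_scale [OF ev_linear])
        then show "(\<integral>x. ?I x * ev x (c *\<^sub>R q) \<partial>\<nu>) = c *\<^sub>R (\<integral>x. ?I x * ev x q \<partial>\<nu>)"
          by (simp only: integral_mult_right_zero) simp
      qed
      then have "(\<lambda>q. \<integral>x. ?I x * ev x q \<partial>\<nu>) = ?H"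
        using carleman_functional_linear [OF H] insert.IH [OF J(2)] by (rule linear_eq_on_squares)
      from fun_cong [OF this] show ?thesis .
    qed
    define D where "D = density \<nu> (\<lambda>x. ennreal (?I x * ev x (p * p)))"
    have nn: "0 \<le> ?I x * ev x (p * p)" for x by (simp add: ev_mult)
    have [measurable]: "half_lines \<Omega> J \<in> sets \<nu>" unfolding \<nu> by (rule half_lines_measurable [OF J])
    have [measurable_cong]: "sets D = sets \<nu>" by (simp add: D_def)
    have [measurable]: "(\<lambda>x. x j) \<in> borel_measurable \<nu>"
      using measurable_component_singleton [OF j, of "\<lambda>_. borel"] \<nu> by (simp cong: measurable_cong_sets)
    define \<rho> where "\<rho> = distr D borel (\<lambda>x. x j)"
    have pow: "?I x * ev x (p * p) * x j ^ k = ?I x * ev x (X j ^ k * (p * p))" for x k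
      by (simp add: ev_mult ev_power ev_X [OF j])
    have "has_moments \<rho> (\<lambda>k. ?H (X j ^ k * (p * p)))"
      unfolding has_moments_def
    proof (intro conjI allI)
      show "sets \<rho> = sets borel" by (simp add: \<rho>_def)
      have "emeasure D (space D) = (\<integral>\<^sup>+x. ennreal (?I x * ev x (p * p)) \<partial>\<nu>)"
        unfolding D_def by (subst emeasure_density) (auto intro!: nn_integral_cong)
      also have "\<dots> < \<infinity>"
        using int_J [OF J, of "p * p"] nn by (simp add: integrable_iff_bounded)
      finally have "finite_measure D" by (intro finite_measureI) simp
      then show "finite_measure \<rho>" unfolding \<rho>_def by (rule finite_measure.finite_measure_distr) measurable
      fix k
      have i: "integrable D (\<lambda>x. x j ^ k)"
        unfolding D_def by (subst integrable_density) (use nn int_J [OF J] in \<open>auto simp: pow\<close>)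
      show "integrable \<rho> (\<lambda>t. t ^ k)"
        unfolding \<rho>_def by (subst integrable_distr_eq) (use i in auto)
      have "(\<integral>t. t ^ k \<partial>\<rho>) = (\<integral>x. x j ^ k \<partial>D)"
        unfolding \<rho>_def by (rule integral_distr) auto
      also have "\<dots> = (\<integral>x. ?I x * ev x (p * p) * x j ^ k \<partial>\<nu>)"
        unfolding D_def by (subst integral_density) (use nn in auto)
      finally show "(\<integral>t. t ^ k \<partial>\<rho>) = ?H (X j ^ k * (p * p))" by (simp only: pow all)
    qed
    then have \<rho>: "\<rho> = element_measure (X j) ?H (p * p)"
      using j by (intro element_measure_unique [OF H _ psd_element_square [OF carleman_functional_psd [OF H]]]) auto
    have "(\<integral>x. indicator (half_lines \<Omega> (insert a J)) x * ev x (p * p) \<partial>\<nu>)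
      = (\<integral>x. ?I x * ev x (p * p) * indicator {..r} (x j) \<partial>\<nu>)"
      by (rule Bochner_Integration.integral_cong) (auto simp: half_lines_def indicator_def a)
    also have "\<dots> = (\<integral>x. indicator {..r} (x j) \<partial>D)"
      unfolding D_def by (subst integral_density) (use nn in auto)
    also have "\<dots> = (\<integral>t. indicator {..r} t \<partial>\<rho>)"
      unfolding \<rho>_def by (rule integral_distr [symmetric]) auto
    also have "\<dots> = measure \<rho> {..r}" by (simp add: \<rho>_def)
    finally show ?case
      unfolding a half_line_cuts_insert [OF L J(1) j] \<rho> .
  qed
  from this [of 1] have "(\<integral>x. indicator (half_lines \<Omega> J) x \<partial>\<nu>) = half_line_cuts X \<Omega> J L 1"
    by (simp add: ev_one)
  moreover have "finite_measure \<nu>"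
    using int [of 1] by (intro finite_measureI) (simp add: ev_one integrable_iff_bounded)
  moreover have "half_lines \<Omega> J \<inter> space \<nu> = half_lines \<Omega> J" by (auto simp: half_lines_def sp)
  ultimately show ?thesis
    using half_lines_measurable [OF J] \<nu> by (simp add: finite_measure.emeasure_eq_measure)
qed

end

section \<open>Radon measures on spaces of characters\<close>

lemma real_subalgebra_hull: "real_subalgebra (real_subalgebra hull C)"
proof (rule hull_in)
  fix T :: "'a set set" assume "Ball T real_subalgebra"
  then show "real_subalgebra (\<Inter> T)" unfolding real_subalgebra_def by simp
qed

text \<open>A ring endomorphism of the reals fixes the rationals and maps squares to squares, hence
  preserves order. Since characters are only required to be ring homomorphisms, their real linearity
  rests on this.\<close>

lemma real_ring_hom_id:
  fixes f :: "real \<Rightarrow> real"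
  assumes f1: "f 1 = 1" and add: "\<And>x y. f (x + y) = f x + f y" and mult: "\<And>x y. f (x * y) = f x * f y"
  shows "f x = x"
proof -
  have f0: "f 0 = 0" using add [of 0 0] by simp
  have minus: "f (- x) = - f x" for x using add [of x "- x"] f0 by simp
  have diff: "f (x - y) = f x - f y" for x y using add [of x "- y"] minus [of y] by simp
  have nat: "f (of_nat n) = of_nat n" for n by (induction n) (simp_all add: f0 f1 add)
  have int: "f (of_int k) = of_int k" for k by (cases k rule: int_cases2) (simp_all add: nat minus)
  have rat: "f (of_rat q) = of_rat q" for q
  proof -
    obtain a b where q: "q = Rat.Fract a b" "b > 0" by (cases q)
    have "of_rat q * of_int b = (of_int a :: real)" using q by (simp add: of_rat_rat)
    then have "f (of_rat q) * of_int b = of_int a" using mult [of "of_rat q" "of_int b"] by (simp add: int)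
    then show ?thesis using q by (simp add: of_rat_rat field_simps)
  qed
  have nonneg: "0 \<le> f x" if "0 \<le> x" for x
    using mult [of "sqrt x" "sqrt x"] that by simp
  have mono: "f x \<le> f y" if "x \<le> y" for x y
    using nonneg [of "y - x"] that by (simp add: diff)
  show ?thesis
  proof (cases "f x" x rule: linorder_cases)
    case less
    then obtain q where "f x < of_rat q" "of_rat q < x" using of_rat_dense by blast
    then show ?thesis using mono [of "of_rat q" x] by (simp add: rat)
  next
    case greater
    then obtain q where "x < of_rat q" "of_rat q < f x" using of_rat_dense by blast
    then show ?thesis using mono [of x "of_rat q"] by (simp add: rat)
  qed simp
qed

lemma characters_scaleR:
  assumes D: "real_subalgebra D" and \<alpha>: "\<alpha> \<in> characters D" and a: "a \<in> D"
  shows "\<alpha> (c *\<^sub>R a) = c * \<alpha> a"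
proof -
  have one: "1 \<in> D" and sc: "\<And>c a. a \<in> D \<Longrightarrow> c *\<^sub>R a \<in> D" using D by (auto simp: real_subalgebra_def)
  have \<alpha>': "\<alpha> 1 = 1" "\<And>a b. a \<in> D \<Longrightarrow> b \<in> D \<Longrightarrow> \<alpha> (a + b) = \<alpha> a + \<alpha> b"
    "\<And>a b. a \<in> D \<Longrightarrow> b \<in> D \<Longrightarrow> \<alpha> (a * b) = \<alpha> a * \<alpha> b"
    using \<alpha> by (auto simp: characters_def)
  have "\<alpha> (c *\<^sub>R 1) = c"
  proof (rule real_ring_hom_id [of "\<lambda>c. \<alpha> (c *\<^sub>R 1)"])
    fix x y :: real
    show "\<alpha> ((x + y) *\<^sub>R 1) = \<alpha> (x *\<^sub>R 1) + \<alpha> (y *\<^sub>R 1)"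
      unfolding scaleR_left_distrib by (intro \<alpha>' sc one)
    have "(x * y) *\<^sub>R (1 :: 'a) = (x *\<^sub>R 1) * (y *\<^sub>R 1)" by simp
    then show "\<alpha> ((x * y) *\<^sub>R 1) = \<alpha> (x *\<^sub>R 1) * \<alpha> (y *\<^sub>R 1)"
      by (simp only:) (intro \<alpha>'(3) sc one)
  qed (simp add: \<alpha>')
  moreover have "\<alpha> (c *\<^sub>R a) = \<alpha> (c *\<^sub>R 1) * \<alpha> a" using \<alpha>'(3) [OF sc [OF one, of c] a] by simp
  ultimately show ?thesis by simp
qed

lemma topspace_character_topology:
  assumes "1 \<in> D"
  shows "topspace (character_topology D) = characters D"
proof -
  have "characters D \<in> {{\<alpha> \<in> characters D. \<alpha> a \<in> U} | a U. a \<in> D \<and> open U}"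
    using assms by (auto intro!: exI [of _ 1] exI [of _ UNIV])
  then show ?thesis unfolding character_topology_def topology_generated_by_topspace by blast
qed

lemma openin_character_topology_coarsest:
  assumes gen: "\<And>a U. a \<in> D \<Longrightarrow> open U \<Longrightarrow> openin T {\<alpha> \<in> characters D. \<alpha> a \<in> U}"
    and W: "openin (character_topology D) W"
  shows "openin T W"
proof (rule generate_topology_on_coarsest [OF istopology_openin])
  show "generate_topology_on {{\<alpha> \<in> characters D. \<alpha> a \<in> U} | a U. a \<in> D \<and> open U} W"
    using W by (simp add: character_topology_def openin_topology_generated_by_iff)
qed (use gen in auto)

text \<open>\<Phi> evaluates a character at the countably many generators, with values in a Polish
  space of real sequences. It remains to see that open sets of characters are preimages of open sets
  and that preimages of compact sets are compact; inner regularity of the image measure then pulls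
  back. A finite measure is locally finite.\<close>

lemma radon_measure_characters:
  fixes C :: "'a::{comm_ring_1,real_algebra_1} set"
  assumes C: "countable C" and D: "D = real_subalgebra hull C"
    and N: "sets N = sets (borel_of (character_topology D))" and fin: "emeasure N (space N) \<noteq> \<infinity>"
  shows "radon_measure (character_topology D) N"
proof -
  let ?T = "character_topology D"
  have sub: "real_subalgebra D" unfolding D by (rule real_subalgebra_hull)
  then have one: "1 \<in> D" and cl: "\<And>a b. a \<in> D \<Longrightarrow> b \<in> D \<Longrightarrow> a + b \<in> D" "\<And>a b. a \<in> D \<Longrightarrow> b \<in> D \<Longrightarrow> a * b \<in> D"
    "\<And>c a. a \<in> D \<Longrightarrow> c *\<^sub>R a \<in> D"
    by (auto simp: real_subalgebra_def)
  have CD: "C \<subseteq> D" unfolding D by (rule hull_subset)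
  have top: "topspace ?T = characters D" by (rule topspace_character_topology [OF one])
  have pow: "{U. openin ?T U} \<subseteq> Pow (topspace ?T)" using openin_subset by auto
  have sets_N: "sets N = sigma_sets (characters D) {U. openin ?T U}"
    using N pow by (simp add: borel_of_def top)
  have space_N: "space N = characters D"
    using sets_eq_imp_space_eq [OF N] pow by (simp add: borel_of_def top space_measure_of_conv)
  interpret N: finite_measure N by (rule finite_measureI) (fact fin)
  have hom: "\<alpha> 1 = 1" "a \<in> D \<Longrightarrow> b \<in> D \<Longrightarrow> \<alpha> (a + b) = \<alpha> a + \<alpha> b"
    "a \<in> D \<Longrightarrow> b \<in> D \<Longrightarrow> \<alpha> (a * b) = \<alpha> a * \<alpha> b" if "\<alpha> \<in> characters D" for \<alpha> a b
    using that by (auto simp: characters_def)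
  note scale = characters_scaleR [OF sub]
  \<comment> \<open>\<open>from_nat_into\<close> enumerates a nonempty set, and \<open>C\<close> may
    be empty; 1 lies in the generated algebra anyway.\<close>
  define c where "c = from_nat_into (insert 1 C)"
  have range_c: "range c = insert 1 C" unfolding c_def by (rule range_from_nat_into) (use C in auto)
  then have cD: "c n \<in> D" for n using CD one by (metis insertE rangeI subsetD)
  define \<Phi> where "\<Phi> \<alpha> = (\<lambda>n. \<alpha> (c n))" for \<alpha> :: "'a \<Rightarrow> real"
  have induct: "P a" if "a \<in> D" "P 1" "\<And>n. P (c n)" "\<And>a b. a \<in> D \<Longrightarrow> b \<in> D \<Longrightarrow> P a \<Longrightarrow> P b \<Longrightarrow> P (a + b)"
    "\<And>a b. a \<in> D \<Longrightarrow> b \<in> D \<Longrightarrow> P a \<Longrightarrow> P b \<Longrightarrow> P (a * b)" "\<And>a r. a \<in> D \<Longrightarrow> P a \<Longrightarrow> P (r *\<^sub>R a)" for P a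
  proof -
    have "D \<subseteq> {a \<in> D. P a}"
    proof (subst (1) D, rule hull_minimal)
      have "x \<in> range c" if "x \<in> C" for x using that range_c by simp
      then show "C \<subseteq> {a \<in> D. P a}" using CD that(3) by auto
      show "real_subalgebra {a \<in> D. P a}"
        using one cl that(2) that(4-6) by (auto simp: real_subalgebra_def)
    qed
    then show ?thesis using that(1) by auto
  qed
  have gen: "openin ?T {\<alpha> \<in> characters D. \<alpha> a \<in> U}" if "a \<in> D" "open U" for a U
    unfolding character_topology_def by (rule topology_generated_by_Basis) (use that in blast)
  have cont_\<Phi>: "continuous_map ?T euclidean \<Phi>"
    unfolding euclidean_product_topology [symmetric] continuous_map_componentwise_UNIV
  proof
    fix n
    show "continuous_map ?T euclidean (\<lambda>\<alpha>. \<Phi> \<alpha> n)"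
      using gen [OF cD] by (auto simp: continuous_map_def top \<Phi>_def)
  qed
  have open_\<Phi>: "\<exists>V. open V \<and> W = \<Phi> -` V \<inter> characters D" if "openin ?T W" for W
  proof -
    have "openin (pullback_topology (characters D) \<Phi> euclidean) W"
    proof (rule openin_character_topology_coarsest [OF _ that])
      fix a and U :: "real set" assume a: "a \<in> D" and U: "open U"
      \<comment> \<open>Along the generation of \<open>D\<close>, every evaluation is a continuous
        function of the values at the generators.\<close>
      have "\<exists>g. continuous_on UNIV g \<and> (\<forall>\<alpha>\<in>characters D. \<alpha> a = g (\<Phi> \<alpha>))"
        using a
      proof (rule induct)
        show "\<exists>g. continuous_on UNIV g \<and> (\<forall>\<alpha>\<in>characters D. \<alpha> 1 = g (\<Phi> \<alpha>))"
          by (rule exI [of _ "\<lambda>_. 1"]) (auto simp: hom)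
        show "\<exists>g. continuous_on UNIV g \<and> (\<forall>\<alpha>\<in>characters D. \<alpha> (c n) = g (\<Phi> \<alpha>))" for n
          by (rule exI [of _ "\<lambda>y. y n"]) (auto simp: \<Phi>_def intro!: continuous_on_product_coordinates)
      next
        fix a b assume ab: "a \<in> D" "b \<in> D"
          and "\<exists>g. continuous_on UNIV g \<and> (\<forall>\<alpha>\<in>characters D. \<alpha> a = g (\<Phi> \<alpha>))"
          and "\<exists>g. continuous_on UNIV g \<and> (\<forall>\<alpha>\<in>characters D. \<alpha> b = g (\<Phi> \<alpha>))"
        then obtain g h where "continuous_on UNIV g" "\<forall>\<alpha>\<in>characters D. \<alpha> a = g (\<Phi> \<alpha>)"
          "continuous_on UNIV h" "\<forall>\<alpha>\<in>characters D. \<alpha> b = h (\<Phi> \<alpha>)" by blast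
        then show "\<exists>g. continuous_on UNIV g \<and> (\<forall>\<alpha>\<in>characters D. \<alpha> (a + b) = g (\<Phi> \<alpha>))"
          and "\<exists>g. continuous_on UNIV g \<and> (\<forall>\<alpha>\<in>characters D. \<alpha> (a * b) = g (\<Phi> \<alpha>))"
          using ab
          by - ((rule exI [of _ "\<lambda>y. g y + h y"], auto simp: hom intro!: continuous_intros)[1],
            (rule exI [of _ "\<lambda>y. g y * h y"], auto simp: hom intro!: continuous_intros)[1])
      next
        fix a and r :: real assume "a \<in> D" "\<exists>g. continuous_on UNIV g \<and> (\<forall>\<alpha>\<in>characters D. \<alpha> a = g (\<Phi> \<alpha>))"
        then obtain g where "continuous_on UNIV g" "\<forall>\<alpha>\<in>characters D. \<alpha> (r *\<^sub>R a) = r * g (\<Phi> \<alpha>)"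
          using scale by auto
        then show "\<exists>g. continuous_on UNIV g \<and> (\<forall>\<alpha>\<in>characters D. \<alpha> (r *\<^sub>R a) = g (\<Phi> \<alpha>))"
          by (auto intro!: exI [of _ "\<lambda>y. r * g y"] continuous_intros)
      qed
      then obtain g where g: "continuous_on UNIV g" "\<forall>\<alpha>\<in>characters D. \<alpha> a = g (\<Phi> \<alpha>)" by blast
      have "open (g -` U)" using g(1) U by (simp add: open_vimage)
      moreover have "{\<alpha> \<in> characters D. \<alpha> a \<in> U} = \<Phi> -` (g -` U) \<inter> characters D" using g(2) by auto
      ultimately show "openin (pullback_topology (characters D) \<Phi> euclidean) {\<alpha> \<in> characters D. \<alpha> a \<in> U}"
        unfolding openin_pullback_topology by auto
    qed
    then show ?thesis by (auto simp: openin_pullback_topology)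
  qed
  have meas_\<Phi>: "\<Phi> \<in> borel_measurable N"
  proof (rule borel_measurableI)
    fix V :: "(nat \<Rightarrow> real) set" assume "open V"
    then have "openin ?T {\<alpha> \<in> topspace ?T. \<Phi> \<alpha> \<in> V}"
      using cont_\<Phi> openin_continuous_map_preimage [of ?T euclidean \<Phi> V] by auto
    then have "{\<alpha> \<in> characters D. \<Phi> \<alpha> \<in> V} \<in> sets N" unfolding sets_N top by (intro sigma_sets.Basic) simp
    moreover have "\<Phi> -` V \<inter> space N = {\<alpha> \<in> characters D. \<Phi> \<alpha> \<in> V}" by (auto simp: space_N)
    ultimately show "\<Phi> -` V \<inter> space N \<in> sets N" by simp
  qed
  have borel_\<Phi>: "\<exists>B. B \<in> sets borel \<and> A = \<Phi> -` B \<inter> characters D" if "A \<in> sets N" for A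
  proof -
    have f: "\<Phi> \<in> characters D \<rightarrow> space borel" by simp
    have "sigma_sets (characters D) {U. openin ?T U} \<subseteq> sets (vimage_algebra (characters D) \<Phi> borel)"
    proof -
      have "U \<in> sets (vimage_algebra (characters D) \<Phi> borel)" if U: "openin ?T U" for U
      proof -
        obtain V where "open V" "U = \<Phi> -` V \<inter> characters D" using open_\<Phi> [OF U] by blast
        then show ?thesis unfolding sets_vimage_algebra2 [OF f] by (blast intro: borel_open)
      qed
      then have "{U. openin ?T U} \<subseteq> sets (vimage_algebra (characters D) \<Phi> borel)" by blast
      from sets.sigma_sets_subset [OF this] show ?thesis by simp
    qed
    then have "A \<in> sets (vimage_algebra (characters D) \<Phi> borel)" using that by (auto simp: sets_N)
    then show ?thesis unfolding sets_vimage_algebra2 [OF f] by blast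
  qed
  have compact_\<Phi>: "compactin ?T (\<Phi> -` K \<inter> characters D)" if K: "compact K" for K
  proof -
    define S where "S = \<Phi> -` K \<inter> characters D"
    define P where "P = product_topology (\<lambda>_. euclidean :: real topology) D"
    have top_P: "topspace P = D \<rightarrow>\<^sub>E UNIV" by (simp add: P_def)
    \<comment> \<open>Bounds at the generators come from compactness of \<open>K\<close> and
      propagate to all of \<open>D\<close>. Thus \<open>S\<close> sits in a product of compact
      intervals over \<open>D\<close>, where Tychonoff's theorem applies; the homomorphism
      identities and membership in \<open>K\<close> are closed conditions.\<close>
    have "\<exists>R. \<forall>\<alpha>\<in>S. \<bar>\<alpha> a\<bar> \<le> R" if "a \<in> D" for a
      using that
    proof (rule induct)
      show "\<exists>R. \<forall>\<alpha>\<in>S. \<bar>\<alpha> 1\<bar> \<le> R" by (rule exI [of _ 1]) (auto simp: S_def hom)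
      fix n
      have "bounded ((\<lambda>y. y n) ` K)"
        by (intro compact_imp_bounded compact_continuous_image K continuous_on_subset [OF continuous_on_product_coordinates]) auto
      then obtain R where R: "\<forall>y\<in>K. \<bar>y n\<bar> \<le> R" by (auto simp: bounded_iff)
      have "\<bar>\<alpha> (c n)\<bar> \<le> R" if "\<alpha> \<in> S" for \<alpha>
      proof -
        have "\<Phi> \<alpha> \<in> K" using that by (simp add: S_def)
        with R have "\<bar>\<Phi> \<alpha> n\<bar> \<le> R" by blast
        then show ?thesis by (simp add: \<Phi>_def)
      qed
      then show "\<exists>R. \<forall>\<alpha>\<in>S. \<bar>\<alpha> (c n)\<bar> \<le> R" by blast
    next
      fix a b assume ab: "a \<in> D" "b \<in> D" and "\<exists>R. \<forall>\<alpha>\<in>S. \<bar>\<alpha> a\<bar> \<le> R" "\<exists>R. \<forall>\<alpha>\<in>S. \<bar>\<alpha> b\<bar> \<le> R"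
      then obtain R R' where R: "\<And>\<alpha>. \<alpha> \<in> S \<Longrightarrow> \<bar>\<alpha> a\<bar> \<le> R" "\<And>\<alpha>. \<alpha> \<in> S \<Longrightarrow> \<bar>\<alpha> b\<bar> \<le> R'" by blast
      show "\<exists>R. \<forall>\<alpha>\<in>S. \<bar>\<alpha> (a + b)\<bar> \<le> R"
      proof (intro exI [of _ "R + R'"] ballI)
        fix \<alpha> assume \<alpha>: "\<alpha> \<in> S"
        then have "\<alpha> (a + b) = \<alpha> a + \<alpha> b" using ab by (simp add: S_def hom)
        then show "\<bar>\<alpha> (a + b)\<bar> \<le> R + R'" using R [OF \<alpha>] by linarith
      qed
      show "\<exists>R. \<forall>\<alpha>\<in>S. \<bar>\<alpha> (a * b)\<bar> \<le> R"
      proof (intro exI [of _ "R * R'"] ballI)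
        fix \<alpha> assume \<alpha>: "\<alpha> \<in> S"
        then have "\<alpha> (a * b) = \<alpha> a * \<alpha> b" using ab by (simp add: S_def hom)
        moreover have "\<bar>\<alpha> a\<bar> * \<bar>\<alpha> b\<bar> \<le> R * R'"
          using R [OF \<alpha>] by (intro mult_mono) auto
        ultimately show "\<bar>\<alpha> (a * b)\<bar> \<le> R * R'" by (simp add: abs_mult)
      qed
    next
      fix a and r :: real assume a: "a \<in> D" and "\<exists>R. \<forall>\<alpha>\<in>S. \<bar>\<alpha> a\<bar> \<le> R"
      then obtain R where R: "\<And>\<alpha>. \<alpha> \<in> S \<Longrightarrow> \<bar>\<alpha> a\<bar> \<le> R" by blast
      show "\<exists>R. \<forall>\<alpha>\<in>S. \<bar>\<alpha> (r *\<^sub>R a)\<bar> \<le> R"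
        using R a by (auto simp: S_def scale abs_mult intro!: exI [of _ "\<bar>r\<bar> * R"] mult_left_mono)
    qed
    then obtain R where R: "\<And>a \<alpha>. a \<in> D \<Longrightarrow> \<alpha> \<in> S \<Longrightarrow> \<bar>\<alpha> a\<bar> \<le> R a" by metis
    have proj: "continuous_map P euclidean (\<lambda>f. f a)" if "a \<in> D" for a
      unfolding P_def by (rule continuous_map_product_projection [OF that])
    have comp: "compactin P S"
    proof (rule closed_compactin)
      show "compactin P (\<Pi>\<^sub>E a\<in>D. {- R a..R a})"
        unfolding P_def compactin_PiE by simp
      show "S \<subseteq> (\<Pi>\<^sub>E a\<in>D. {- R a..R a})"
      proof
        fix \<alpha> assume \<alpha>: "\<alpha> \<in> S"
        have "\<alpha> \<in> extensional D" using \<alpha> by (auto simp: S_def characters_def)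
        moreover have "\<alpha> a \<in> {- R a..R a}" if "a \<in> D" for a using R [OF that \<alpha>] by auto
        ultimately show "\<alpha> \<in> (\<Pi>\<^sub>E a\<in>D. {- R a..R a})" by (simp add: PiE_iff)
      qed
      have c1: "closedin P {f \<in> topspace P. f 1 = 1}"
        using closedin_continuous_map_preimage [OF proj [OF one], of "{1}"] by simp
      have c2: "closedin P {f \<in> topspace P. f (a + b) = f a + f b}" if "a \<in> D" "b \<in> D" for a b
      proof -
        have "continuous_map P euclidean (\<lambda>f. f (a + b) - (f a + f b))"
          by (intro continuous_map_diff continuous_map_add proj that cl)
        from closedin_continuous_map_preimage [OF this, of "{0}"] show ?thesis by simp
      qed
      have c3: "closedin P {f \<in> topspace P. f (a * b) = f a * f b}" if "a \<in> D" "b \<in> D" for a b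
      proof -
        have "continuous_map P euclidean (\<lambda>f. f (a * b) - (f a * f b))"
          by (intro continuous_map_diff continuous_map_real_mult proj that cl)
        from closedin_continuous_map_preimage [OF this, of "{0}"] show ?thesis by simp
      qed
      have c4: "closedin P {f \<in> topspace P. \<Phi> f \<in> K}"
      proof -
        have "continuous_map P euclidean \<Phi>"
          unfolding euclidean_product_topology [symmetric] continuous_map_componentwise_UNIV \<Phi>_def
          by (intro allI proj cD)
        then show ?thesis
          by (rule closedin_continuous_map_preimage) (simp add: compact_imp_closed K)
      qed
      define F where "F = {{f \<in> topspace P. f 1 = 1}, {f \<in> topspace P. \<Phi> f \<in> K}}
        \<union> {{f \<in> topspace P. f (a + b) = f a + f b} | a b. a \<in> D \<and> b \<in> D}
        \<union> {{f \<in> topspace P. f (a * b) = f a * f b} | a b. a \<in> D \<and> b \<in> D}"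
      have "closedin P (\<Inter>F)"
        by (rule closedin_Inter) (auto simp: F_def intro: c1 c2 c3 c4)
      moreover have "S = \<Inter>F"
      proof
        show "S \<subseteq> \<Inter>F" by (auto simp: F_def S_def characters_def top_P PiE_iff)
        show "\<Inter>F \<subseteq> S"
        proof
          fix f assume f: "f \<in> \<Inter>F"
          then have "f \<in> extensional D" "f 1 = 1" "\<Phi> f \<in> K" by (auto simp: F_def top_P PiE_iff)
          moreover have "f (a + b) = f a + f b \<and> f (a * b) = f a * f b" if "a \<in> D" "b \<in> D" for a b
          proof -
            have "{f \<in> topspace P. f (a + b) = f a + f b} \<in> F" "{f \<in> topspace P. f (a * b) = f a * f b} \<in> F"
              using that by (auto simp: F_def)
            from InterD [OF f this(1)] InterD [OF f this(2)] show ?thesis by simp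
          qed
          ultimately show "f \<in> S" by (simp add: S_def characters_def)
        qed
      qed
      ultimately show "closedin P S" by simp
    qed
    \<comment> \<open>The character topology is no finer than the product topology restricted to
      characters, so compactness passes to it.\<close>
    have coarse: "openin (subtopology P (characters D)) W" if "openin ?T W" for W
    proof (rule openin_character_topology_coarsest [OF _ that])
      fix a and U :: "real set" assume "a \<in> D" "open U"
      then have "openin P {f \<in> topspace P. f a \<in> U}"
        using openin_continuous_map_preimage [OF proj] by auto
      moreover have "{\<alpha> \<in> characters D. \<alpha> a \<in> U} = {f \<in> topspace P. f a \<in> U} \<inter> characters D"
        by (auto simp: top_P characters_def PiE_iff extensional_def)
      ultimately show "openin (subtopology P (characters D)) {\<alpha> \<in> characters D. \<alpha> a \<in> U}"
        unfolding openin_subtopology by blast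
    qed
    have "topspace (subtopology P (characters D)) = characters D"
      by (auto simp: top_P characters_def PiE_iff extensional_def)
    moreover have "{x \<in> characters D. x \<in> U} = U" if "openin ?T U" for U
      using openin_subset [OF that] by (auto simp: top)
    ultimately have "continuous_map (subtopology P (characters D)) ?T (\<lambda>f. f)"
      unfolding continuous_map_def top using coarse by auto
    moreover have "compactin (subtopology P (characters D)) S"
      using comp by (simp add: compactin_subtopology S_def)
    ultimately have "compactin ?T ((\<lambda>f. f) ` S)" by (rule image_compactin [rotated])
    then show ?thesis by (simp add: S_def)
  qed
  define M where "M = distr N borel \<Phi>"
  have fin_M: "finite_measure M" unfolding M_def by (rule N.finite_measure_distr [OF meas_\<Phi>])
  have em_M: "emeasure M B = emeasure N (\<Phi> -` B \<inter> characters D)" if "B \<in> sets borel" for B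
    unfolding M_def using emeasure_distr [OF meas_\<Phi> that] by (simp add: space_N)
  show ?thesis
    unfolding radon_measure_def
  proof (intro conjI ballI N)
    fix \<alpha> assume "\<alpha> \<in> topspace ?T"
    moreover have "emeasure N (topspace ?T) < \<infinity>" by (metis N.emeasure_finite infinity_ennreal_def less_top)
    ultimately show "\<exists>U. openin ?T U \<and> \<alpha> \<in> U \<and> emeasure N U < \<infinity>"
      using openin_topspace by blast
  next
    fix A assume A: "A \<in> sets N"
    then obtain B where B: "B \<in> sets borel" "A = \<Phi> -` B \<inter> characters D" using borel_\<Phi> by blast
    show "emeasure N A = (SUP K\<in>{K. compactin ?T K \<and> K \<subseteq> A}. emeasure N K)"
    proof (rule antisym)
      have "emeasure N A = emeasure M B" using em_M [OF B(1)] B(2) by simp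
      also have "\<dots> = (SUP K\<in>{K. K \<subseteq> B \<and> compact K}. emeasure M K)"
        by (rule inner_regular) (use B fin_M in \<open>auto simp: M_def finite_measure.emeasure_finite\<close>)
      also have "\<dots> \<le> (SUP K\<in>{K. compactin ?T K \<and> K \<subseteq> A}. emeasure N K)"
      proof (rule SUP_least)
        fix K assume K: "K \<in> {K. K \<subseteq> B \<and> compact K}"
        then have "emeasure M K = emeasure N (\<Phi> -` K \<inter> characters D)"
          by (intro em_M) (auto intro: borel_closed compact_imp_closed)
        also have "\<dots> \<le> (SUP K\<in>{K. compactin ?T K \<and> K \<subseteq> A}. emeasure N K)"
          using compact_\<Phi> [of K] K B(2) by (intro SUP_upper) auto
        finally show "emeasure M K \<le> (SUP K\<in>{K. compactin ?T K \<and> K \<subseteq> A}. emeasure N K)" .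
      qed
      finally show "emeasure N A \<le> (SUP K\<in>{K. compactin ?T K \<and> K \<subseteq> A}. emeasure N K)" .
      show "(SUP K\<in>{K. compactin ?T K \<and> K \<subseteq> A}. emeasure N K) \<le> emeasure N A"
        by (rule SUP_least) (auto intro: emeasure_mono A)
    qed
  qed
qed

text \<open>
  The bound on the total mass of \<open>distr\<close> needs no measurability, since \<open>distr\<close> of a nonmeasurable
  map that does not yield a measure is the zero measure.
\<close>

lemma emeasure_distr_finite:
  assumes "finite_measure M"
  shows "emeasure (distr M N f) A \<noteq> \<infinity>"
  unfolding distr_def emeasure_measure_of_conv using finite_measure.emeasure_finite [OF assms] by simp

lemma constructibly_radon_finite:
  assumes "sets \<mu> = sets (constructible_borel D)" "finite_measure \<mu>"
  shows "constructibly_radon D \<mu>"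
  unfolding constructibly_radon_def Let_def
  using assms by (auto intro!: radon_measure_characters emeasure_distr_finite)

section \<open>Polynomials\<close>

lemma lookup_scaleR:
  "Poly_Mapping.lookup (c *\<^sub>R f) m = c *\<^sub>R Poly_Mapping.lookup (f :: 'a \<Rightarrow>\<^sub>0 'b::real_vector) m"
proof -
  have "finite {i. c *\<^sub>R Poly_Mapping.lookup f i \<noteq> 0}"
    by (rule finite_subset [of _ "Poly_Mapping.keys f"]) (auto simp: in_keys_iff)
  then show ?thesis by (simp add: scaleR_poly_mapping_def)
qed

lemma poly_mapping_sum_single:
  "f = (\<Sum>m\<in>Poly_Mapping.keys f. Poly_Mapping.single m (Poly_Mapping.lookup f m))"
proof (rule poly_mapping_eqI)
  fix k
  show "Poly_Mapping.lookup f k = Poly_Mapping.lookup (\<Sum>m\<in>Poly_Mapping.keys f. Poly_Mapping.single m (Poly_Mapping.lookup f m)) k"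
    by (simp add: lookup_sum lookup_single when_def in_keys_iff)
qed

text \<open>By distributivity multiplicativity need only be checked on terms with one monomial; both
  evaluation and the restriction of variables are treated this way.\<close>

lemma multiplicative_from_single:
  fixes \<phi> :: "('a::monoid_add \<Rightarrow>\<^sub>0 'b::semiring_0) \<Rightarrow> 'c::semiring_0"
  assumes add: "\<And>f g. \<phi> (f + g) = \<phi> f + \<phi> g" and zero: "\<phi> 0 = 0"
    and single: "\<And>m n a b. \<phi> (Poly_Mapping.single (m + n) (a * b)) = \<phi> (Poly_Mapping.single m a) * \<phi> (Poly_Mapping.single n b)"
  shows "\<phi> (f * g) = \<phi> f * \<phi> g"
proof -
  have sum: "\<phi> (sum h A) = (\<Sum>a\<in>A. \<phi> (h a))" for h and A :: "'a set"
    by (induction A rule: infinite_finite_induct) (auto simp: add zero)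
  let ?s = "\<lambda>f m. Poly_Mapping.single m (Poly_Mapping.lookup f m)"
  have "f * g = (\<Sum>m\<in>Poly_Mapping.keys f. ?s f m) * (\<Sum>n\<in>Poly_Mapping.keys g. ?s g n)"
    using poly_mapping_sum_single [of f] poly_mapping_sum_single [of g] by simp
  also have "\<dots> = (\<Sum>m\<in>Poly_Mapping.keys f. \<Sum>n\<in>Poly_Mapping.keys g. ?s f m * ?s g n)"
    by (rule sum_product)
  finally have "\<phi> (f * g) = (\<Sum>m\<in>Poly_Mapping.keys f. \<Sum>n\<in>Poly_Mapping.keys g. \<phi> (?s f m) * \<phi> (?s g n))"
    by (simp add: sum mult_single single)
  also have "\<dots> = (\<Sum>m\<in>Poly_Mapping.keys f. \<phi> (?s f m)) * (\<Sum>n\<in>Poly_Mapping.keys g. \<phi> (?s g n))"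
    by (rule sum_product [symmetric])
  also have "\<dots> = \<phi> (\<Sum>m\<in>Poly_Mapping.keys f. ?s f m) * \<phi> (\<Sum>n\<in>Poly_Mapping.keys g. ?s g n)"
    by (simp only: sum)
  also have "\<dots> = \<phi> f * \<phi> g"
    by (simp only: poly_mapping_sum_single [symmetric])
  finally show ?thesis .
qed

lemma keys_add_nat:
  fixes m n :: "'i \<Rightarrow>\<^sub>0 nat"
  shows "Poly_Mapping.keys (m + n) = Poly_Mapping.keys m \<union> Poly_Mapping.keys n"
  by (auto simp: in_keys_iff lookup_add)

definition monomial_eval :: "('i \<Rightarrow> real) \<Rightarrow> ('i \<Rightarrow>\<^sub>0 nat) \<Rightarrow> real" where
  "monomial_eval x m = (\<Prod>i\<in>Poly_Mapping.keys m. x i ^ Poly_Mapping.lookup m i)"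

lemma poly_eval_monomial_eval:
  "poly_eval x f = (\<Sum>m\<in>Poly_Mapping.keys f. Poly_Mapping.lookup f m * monomial_eval x m)"
  by (simp add: poly_eval_def monomial_eval_def)

lemma monomial_eval_add: "monomial_eval x (m + n) = monomial_eval x m * monomial_eval x n"
proof -
  let ?A = "Poly_Mapping.keys m \<union> Poly_Mapping.keys n"
  have "monomial_eval x k = (\<Prod>i\<in>?A. x i ^ Poly_Mapping.lookup k i)" if "Poly_Mapping.keys k \<subseteq> ?A" for k
    unfolding monomial_eval_def using that by (intro prod.mono_neutral_left) (auto simp: in_keys_iff)
  then show ?thesis
    by (simp add: keys_add_nat lookup_add power_add prod.distrib)
qed

lemma poly_eval_add: "poly_eval x (f + g) = poly_eval x f + poly_eval x g"
  unfolding poly_eval_monomial_eval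
  by (rule setsum_keys_plus_distrib) (simp_all add: distrib_right)

lemma poly_eval_scaleR: "poly_eval x (c *\<^sub>R f) = c * poly_eval x f"
proof -
  have "poly_eval x (c *\<^sub>R f) = (\<Sum>m\<in>Poly_Mapping.keys f. Poly_Mapping.lookup (c *\<^sub>R f) m * monomial_eval x m)"
    unfolding poly_eval_monomial_eval
    by (intro sum.mono_neutral_left) (auto simp: in_keys_iff lookup_scaleR)
  then show ?thesis
    by (simp add: poly_eval_monomial_eval lookup_scaleR sum_distrib_left mult.assoc)
qed

lemma poly_eval_zero: "poly_eval x 0 = 0"
  by (simp add: poly_eval_def)

lemma poly_eval_single: "poly_eval x (Poly_Mapping.single m a) = a * monomial_eval x m"
  by (simp add: poly_eval_monomial_eval)

lemma poly_eval_mult: "poly_eval x (f * g) = poly_eval x f * poly_eval x g"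
  by (rule multiplicative_from_single)
    (simp_all add: poly_eval_add poly_eval_zero poly_eval_single monomial_eval_add mult_ac)

lemma poly_eval_one: "poly_eval x 1 = 1"
proof -
  have "poly_eval x (Poly_Mapping.single 0 1) = 1"
    unfolding poly_eval_single by (simp add: monomial_eval_def)
  then show ?thesis by simp
qed

lemma poly_eval_var: "poly_eval x (poly_var j) = x j"
  by (simp add: poly_var_def poly_eval_single monomial_eval_def)

text \<open>Setting the variables outside \<open>\<Omega>\<close> to \<open>0\<close> reduces everything to functionals on a whole type.\<close>

definition restrict_vars :: "'i set \<Rightarrow> 'i rpoly \<Rightarrow> 'i rpoly" where
  "restrict_vars \<Omega> f = (\<Sum>m\<in>{m \<in> Poly_Mapping.keys f. Poly_Mapping.keys m \<subseteq> \<Omega>}. Poly_Mapping.single m (Poly_Mapping.lookup f m))"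

lemma lookup_restrict_vars:
  "Poly_Mapping.lookup (restrict_vars \<Omega> f) m = (if Poly_Mapping.keys m \<subseteq> \<Omega> then Poly_Mapping.lookup f m else 0)"
  by (auto simp: restrict_vars_def lookup_sum lookup_single when_def in_keys_iff)

lemma restrict_vars_add: "restrict_vars \<Omega> (f + g) = restrict_vars \<Omega> f + restrict_vars \<Omega> g"
  by (rule poly_mapping_eqI) (simp add: lookup_restrict_vars lookup_add)

lemma restrict_vars_scaleR: "restrict_vars \<Omega> (c *\<^sub>R f) = c *\<^sub>R restrict_vars \<Omega> f"
  by (rule poly_mapping_eqI) (simp add: lookup_restrict_vars lookup_scaleR)

lemma restrict_vars_zero: "restrict_vars \<Omega> 0 = 0"
  by (rule poly_mapping_eqI) (simp add: lookup_restrict_vars)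

lemma restrict_vars_single:
  "restrict_vars \<Omega> (Poly_Mapping.single m a) = (if Poly_Mapping.keys m \<subseteq> \<Omega> then Poly_Mapping.single m a else 0)"
  by (rule poly_mapping_eqI) (auto simp: lookup_restrict_vars lookup_single when_def)

lemma restrict_vars_mult: "restrict_vars \<Omega> (f * g) = restrict_vars \<Omega> f * restrict_vars \<Omega> g"
  by (rule multiplicative_from_single)
    (auto simp: restrict_vars_add restrict_vars_zero restrict_vars_single keys_add_nat mult_single)

lemma restrict_vars_in_poly_alg: "restrict_vars \<Omega> f \<in> poly_alg \<Omega>"
proof -
  have "Poly_Mapping.keys m \<subseteq> \<Omega>" if "m \<in> Poly_Mapping.keys (restrict_vars \<Omega> f)" for m
    by (rule ccontr) (use that in \<open>simp add: in_keys_iff lookup_restrict_vars\<close>)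
  then show ?thesis by (simp add: poly_alg_def)
qed

lemma restrict_vars_id: "f \<in> poly_alg \<Omega> \<Longrightarrow> restrict_vars \<Omega> f = f"
  by (rule poly_mapping_eqI) (auto simp: lookup_restrict_vars poly_alg_def in_keys_iff)

lemma restrict_vars_one: "restrict_vars \<Omega> 1 = 1"
  using restrict_vars_single [of \<Omega> 0 1] by simp

lemma poly_var_in_poly_alg: "j \<in> \<Omega> \<Longrightarrow> poly_var j \<in> poly_alg \<Omega>"
  by (simp add: poly_alg_def poly_var_def)

lemma restrict_vars_power: "restrict_vars \<Omega> (f ^ k) = restrict_vars \<Omega> f ^ k"
  by (induction k) (simp_all add: restrict_vars_one restrict_vars_mult)

lemma monomial_eval_measurable:
  assumes "Poly_Mapping.keys m \<subseteq> \<Omega>"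
  shows "(\<lambda>x. monomial_eval x m) \<in> borel_measurable (PiM \<Omega> (\<lambda>_. borel))"
  unfolding monomial_eval_def
proof (intro borel_measurable_prod borel_measurable_power)
  fix i assume "i \<in> Poly_Mapping.keys m"
  then have "i \<in> \<Omega>" using assms by auto
  then show "(\<lambda>x. x i) \<in> borel_measurable (PiM \<Omega> (\<lambda>_. borel :: real measure))"
    by (rule measurable_component_singleton)
qed

lemma poly_eval_measurable:
  assumes "f \<in> poly_alg \<Omega>"
  shows "(\<lambda>x. poly_eval x f) \<in> borel_measurable (PiM \<Omega> (\<lambda>_. borel))"
  unfolding poly_eval_monomial_eval using assms
  by (intro borel_measurable_sum borel_measurable_times borel_measurable_const monomial_eval_measurable)
    (auto simp: poly_alg_def)

interpretation poly: evaluation poly_var \<Omega> "\<lambda>x f. poly_eval x (restrict_vars \<Omega> f)" for \<Omega> :: "'i set"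
proof
  fix x :: "'i \<Rightarrow> real" and f g :: "'i rpoly" and j and c :: real
  show "poly_eval x (restrict_vars \<Omega> (f + g)) = poly_eval x (restrict_vars \<Omega> f) + poly_eval x (restrict_vars \<Omega> g)"
    by (simp add: restrict_vars_add poly_eval_add)
  show "poly_eval x (restrict_vars \<Omega> (c *\<^sub>R f)) = c *\<^sub>R poly_eval x (restrict_vars \<Omega> f)"
    by (simp add: restrict_vars_scaleR poly_eval_scaleR)
  show "poly_eval x (restrict_vars \<Omega> (f * g)) = poly_eval x (restrict_vars \<Omega> f) * poly_eval x (restrict_vars \<Omega> g)"
    by (simp add: restrict_vars_mult poly_eval_mult)
  show "poly_eval x (restrict_vars \<Omega> 1) = 1"
    by (simp add: restrict_vars_one poly_eval_one)
  show "poly_eval x (restrict_vars \<Omega> (poly_var j)) = x j" if "j \<in> \<Omega>"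
    using that by (simp add: restrict_vars_id poly_var_in_poly_alg poly_eval_var)
  show "(\<lambda>x. poly_eval x (restrict_vars \<Omega> f)) \<in> borel_measurable (PiM \<Omega> (\<lambda>_. borel))"
    by (rule poly_eval_measurable [OF restrict_vars_in_poly_alg])
qed

lemma point_character: "point_character \<Omega> x \<in> characters (poly_alg \<Omega>)"
proof -
  have keys: "f + g \<in> poly_alg \<Omega>" "f * g \<in> poly_alg \<Omega>" "1 \<in> poly_alg \<Omega>"
    if "f \<in> poly_alg \<Omega>" "g \<in> poly_alg \<Omega>" for f g :: "'a rpoly"
    using restrict_vars_in_poly_alg [of \<Omega> "f + g"] restrict_vars_in_poly_alg [of \<Omega> "f * g"]
      restrict_vars_in_poly_alg [of \<Omega> 1] that
    by (simp_all add: restrict_vars_add restrict_vars_mult restrict_vars_id restrict_vars_one)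
  have "(1 :: 'a rpoly) \<in> poly_alg \<Omega>"
    using restrict_vars_in_poly_alg [of \<Omega> 1] by (simp add: restrict_vars_one)
  then show ?thesis
    by (simp add: characters_def point_character_def keys poly_eval_add poly_eval_mult poly_eval_one)
qed

text \<open>The constructibly Borel sets of the power space are the product sigma-algebra:
  polynomials are measurable functions of finitely many coordinates, and conversely x_j > r is
  positivity of the polynomial x_j - r.\<close>

lemma sets_power_space:
  "sets (vimage_algebra (real_power_space \<Omega>) (point_character \<Omega>) (constructible_borel (poly_alg \<Omega>)))
    = sets (PiM \<Omega> (\<lambda>_. borel))"
proof -
  define E where "E = {{x \<in> real_power_space \<Omega>. 0 < poly_eval x a} | a. a \<in> poly_alg \<Omega>}"
  have "{point_character \<Omega> -` A \<inter> real_power_space \<Omega> | A. A \<in> {{\<alpha> \<in> characters (poly_alg \<Omega>). 0 < \<alpha> a} | a. a \<in> poly_alg \<Omega>}} = E"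
  proof -
    have "point_character \<Omega> -` {\<alpha> \<in> characters (poly_alg \<Omega>). 0 < \<alpha> a} \<inter> real_power_space \<Omega>
      = {x \<in> real_power_space \<Omega>. 0 < poly_eval x a}" if "a \<in> poly_alg \<Omega>" for a
      using that point_character by (auto simp: point_character_def)
    then have img: "(\<lambda>a. point_character \<Omega> -` {\<alpha> \<in> characters (poly_alg \<Omega>). 0 < \<alpha> a} \<inter> real_power_space \<Omega>) ` poly_alg \<Omega>
        = (\<lambda>a. {x \<in> real_power_space \<Omega>. 0 < poly_eval x a}) ` poly_alg \<Omega>"
      by (intro image_cong) simp_all
    show ?thesis
      unfolding E_def Setcompr_eq_image image_image by (rule img)
  qed
  moreover have "vimage_algebra (real_power_space \<Omega>) (point_character \<Omega>) (constructible_borel (poly_alg \<Omega>))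
      = sigma (real_power_space \<Omega>) {point_character \<Omega> -` A \<inter> real_power_space \<Omega> | A. A \<in> {{\<alpha> \<in> characters (poly_alg \<Omega>). 0 < \<alpha> a} | a. a \<in> poly_alg \<Omega>}}"
    unfolding constructible_borel_def
    by (rule vimage_algebra_sigma) (auto intro: point_character)
  ultimately have eq: "vimage_algebra (real_power_space \<Omega>) (point_character \<Omega>) (constructible_borel (poly_alg \<Omega>)) = sigma (real_power_space \<Omega>) E"
    by simp
  have E_pow: "E \<subseteq> Pow (real_power_space \<Omega>)" by (auto simp: E_def)
  define N where "N = sigma (real_power_space \<Omega>) E"
  have space_N: "space N = real_power_space \<Omega>" and sets_N: "sets N = sigma_sets (real_power_space \<Omega>) E"
    using E_pow by (simp_all add: N_def)
  have "sigma_sets (real_power_space \<Omega>) E \<subseteq> sets (PiM \<Omega> (\<lambda>_. borel))"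
  proof -
    have "E \<subseteq> sets (PiM \<Omega> (\<lambda>_. borel))"
    proof
      fix A assume "A \<in> E"
      then obtain a where a: "a \<in> poly_alg \<Omega>" "A = {x \<in> real_power_space \<Omega>. 0 < poly_eval x a}" by (auto simp: E_def)
      have [measurable]: "(\<lambda>x. poly_eval x a) \<in> borel_measurable (PiM \<Omega> (\<lambda>_. borel))" by (rule poly_eval_measurable [OF a(1)])
      have "{x \<in> space (PiM \<Omega> (\<lambda>_. borel)). 0 < poly_eval x a} \<in> sets (PiM \<Omega> (\<lambda>_. borel))" by measurable
      then show "A \<in> sets (PiM \<Omega> (\<lambda>_. borel))" by (simp add: a(2) space_PiM)
    qed
    from sets.sigma_sets_subset [OF this] show ?thesis by (simp add: space_PiM)
  qed
  moreover have "sets (PiM \<Omega> (\<lambda>_. borel)) \<subseteq> sigma_sets (real_power_space \<Omega>) E"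
  proof -
    have id: "(\<lambda>x. x) \<in> measurable N (PiM \<Omega> (\<lambda>_. borel))"
    proof (rule measurable_PiM_single')
      fix j assume j: "j \<in> \<Omega>"
      show "(\<lambda>x. x j) \<in> borel_measurable N"
      proof (rule borel_measurableI_greater)
        fix r
        define a where "a = poly_var j + (- r) *\<^sub>R (1 :: 'a rpoly)"
        have "restrict_vars \<Omega> a = a"
          unfolding a_def restrict_vars_add restrict_vars_scaleR restrict_vars_one
          using j by (simp add: restrict_vars_id poly_var_in_poly_alg)
        then have "a \<in> poly_alg \<Omega>" using restrict_vars_in_poly_alg [of \<Omega> a] by simp
        moreover have "{x \<in> space N. r < x j} = {x \<in> real_power_space \<Omega>. 0 < poly_eval x a}"
          by (simp only: space_N a_def poly_eval_add poly_eval_scaleR poly_eval_one poly_eval_var) auto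
        ultimately have "{x \<in> space N. r < x j} \<in> E" by (auto simp: E_def)
        then show "{x \<in> space N. r < x j} \<in> sets N" unfolding sets_N by (rule sigma_sets.Basic)
      qed
    qed (simp add: space_N)
    have "A \<in> sets N" if "A \<in> sets (PiM \<Omega> (\<lambda>_. borel :: real measure))" for A
    proof -
      have "A \<inter> space N \<in> sets N" using measurable_sets [OF id that] by (simp add: vimage_def)
      moreover have "A \<inter> space N = A"
        using sets.sets_into_space [OF that] by (auto simp: space_N space_PiM)
      ultimately show ?thesis by simp
    qed
    then show ?thesis unfolding sets_N [symmetric] by blast
  qed
  ultimately show ?thesis unfolding eq using E_pow by simp
qed

lemma monomial_prod_list:
  assumes "Poly_Mapping.keys m \<subseteq> \<Omega>"
  obtains js where "set js \<subseteq> \<Omega>" "prod_list (map poly_var js) = Poly_Mapping.single m (1 :: real)"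
proof -
  have "\<exists>js. set js \<subseteq> \<Omega> \<and> prod_list (map poly_var js) = Poly_Mapping.single m (1 :: real)"
    using assms
  proof (induction "\<Sum>i\<in>Poly_Mapping.keys m. Poly_Mapping.lookup m i" arbitrary: m rule: less_induct)
    case less
    show ?case
    proof (cases "m = 0")
      case True
      then show ?thesis by (intro exI [of _ "[]"]) simp
    next
      case False
      then obtain i where i: "i \<in> Poly_Mapping.keys m" by (metis all_not_in_conv keys_eq_empty)
      define n where "n = m - Poly_Mapping.single i 1"
      have m_eq: "m = Poly_Mapping.single i 1 + n"
        unfolding n_def using i
        by (intro poly_mapping_eqI) (auto simp: lookup_add lookup_minus lookup_single when_def in_keys_iff)
      have lookup_m: "Poly_Mapping.lookup m k = Poly_Mapping.lookup (Poly_Mapping.single i 1) k + Poly_Mapping.lookup n k" for k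
        by (subst m_eq) (rule lookup_add)
      have keys_n: "Poly_Mapping.keys n \<subseteq> Poly_Mapping.keys m" by (auto simp: in_keys_iff lookup_m)
      have "(\<Sum>k\<in>Poly_Mapping.keys n. Poly_Mapping.lookup n k) = (\<Sum>k\<in>Poly_Mapping.keys m. Poly_Mapping.lookup n k)"
        using keys_n by (intro sum.mono_neutral_left) (auto simp: in_keys_iff)
      also have "\<dots> < (\<Sum>k\<in>Poly_Mapping.keys m. Poly_Mapping.lookup m k)"
      proof (rule sum_strict_mono_ex1)
        show "\<forall>k\<in>Poly_Mapping.keys m. Poly_Mapping.lookup n k \<le> Poly_Mapping.lookup m k"
          by (simp add: lookup_m)
        have "Poly_Mapping.lookup n i < Poly_Mapping.lookup m i" by (simp add: lookup_m)
        then show "\<exists>k\<in>Poly_Mapping.keys m. Poly_Mapping.lookup n k < Poly_Mapping.lookup m k" using i by blast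
      qed simp
      finally obtain js where js: "set js \<subseteq> \<Omega>" "prod_list (map poly_var js) = Poly_Mapping.single n (1 :: real)"
        using less.hyps [of n] keys_n less.prems by blast
      have "prod_list (map poly_var (i # js)) = Poly_Mapping.single m (1 :: real)"
        by (simp only: list.map prod_list.Cons js(2) poly_var_def mult_single mult_1 m_eq [symmetric])
      then show ?thesis using js(1) i less.prems by (intro exI [of _ "i # js"]) auto
    qed
  qed
  then show thesis using that by blast
qed

lemma poly_alg_induct:
  fixes V :: "'i rpoly \<Rightarrow> bool"
  assumes f: "f \<in> poly_alg \<Omega>" and add: "\<And>f g. V f \<Longrightarrow> V g \<Longrightarrow> V (f + g)" and scale: "\<And>c f. V f \<Longrightarrow> V (c *\<^sub>R f)"
    and zero: "V 0" and mono: "\<And>m. Poly_Mapping.keys m \<subseteq> \<Omega> \<Longrightarrow> V (Poly_Mapping.single m 1)"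
  shows "V f"
proof -
  have "V (\<Sum>m\<in>A. Poly_Mapping.single m (Poly_Mapping.lookup f m))" if "finite A" "A \<subseteq> Poly_Mapping.keys f" for A
    using that
  proof (induction A rule: finite_induct)
    case (insert m A)
    have "Poly_Mapping.single m (Poly_Mapping.lookup f m) = Poly_Mapping.lookup f m *\<^sub>R Poly_Mapping.single m 1"
      by (rule poly_mapping_eqI) (simp add: lookup_scaleR lookup_single when_def)
    moreover have "V (Poly_Mapping.lookup f m *\<^sub>R Poly_Mapping.single m 1)"
      using insert.prems f by (intro scale mono) (auto simp: poly_alg_def)
    ultimately show ?case using insert by (simp add: add)
  qed (simp add: zero)
  from this [of "Poly_Mapping.keys f"] show ?thesis
    using poly_mapping_sum_single [of f] by simp
qed

lemma monomial_in_poly_alg: "Poly_Mapping.keys m \<subseteq> \<Omega> \<Longrightarrow> Poly_Mapping.single m 1 \<in> poly_alg \<Omega>"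
  by (simp add: poly_alg_def)

section \<open>Existence and uniqueness of the representing measure\<close>

lemma carleman_functional_restrict_vars:
  fixes \<Omega> :: "'i set" and L :: "'i rpoly \<Rightarrow> real"
  assumes lin: "linear_functional_on (poly_alg \<Omega>) L" and psd: "psd_on (poly_alg \<Omega>) L"
    and carl: "\<And>j. j \<in> \<Omega> \<Longrightarrow> carleman L j"
  shows "carleman_functional (poly_var ` \<Omega>) (\<lambda>f. L (restrict_vars \<Omega> f))"
  unfolding carleman_functional_def psd_functional_def
proof (intro conjI allI ballI)
  show "linear (\<lambda>f. L (restrict_vars \<Omega> f))"
    using lin by (intro linearI) (simp_all add: restrict_vars_add restrict_vars_scaleR
        linear_functional_on_def restrict_vars_in_poly_alg)
  show "0 \<le> L (restrict_vars \<Omega> (g * g))" for g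
    using psd [unfolded psd_on_def, rule_format, of "[restrict_vars \<Omega> g]"]
    by (simp add: restrict_vars_in_poly_alg restrict_vars_mult power2_eq_square)
  fix x assume "x \<in> poly_var ` \<Omega>"
  then obtain j where j: "j \<in> \<Omega>" "x = poly_var j" by auto
  then have "restrict_vars \<Omega> (x ^ k) = poly_var j ^ k" for k
    by (simp add: restrict_vars_power restrict_vars_id poly_var_in_poly_alg)
  then show "carleman_seq (\<lambda>k. L (restrict_vars \<Omega> (x ^ k)))"
    using carl [OF j(1)] by (simp only: carleman_seq_def carleman_def)
qed

text \<open>Kolmogorov's theorem produces probability measures, so \<open>L\<close> is divided by L
  1 and the measure multiplied back. If L 1 = 0, Cauchy-Schwarz against 1 gives L = 0, represented
  by the zero measure.\<close>

lemma exists_representing_measure: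
  fixes \<Omega> :: "'i set" and L :: "'i rpoly \<Rightarrow> real"
  assumes L: "carleman_functional (poly_var ` \<Omega>) L"
  obtains \<nu> where "finite_measure \<nu>" "sets \<nu> = sets (PiM \<Omega> (\<lambda>_. borel))"
    "\<And>f. f \<in> poly_alg \<Omega> \<Longrightarrow> integrable \<nu> (\<lambda>x. poly_eval x f)"
    "\<And>f. f \<in> poly_alg \<Omega> \<Longrightarrow> (\<integral>x. poly_eval x f \<partial>\<nu>) = L f"
proof -
  note lin = carleman_functional_linear [OF L] and psd = carleman_functional_psd [OF L]
  have L1: "0 \<le> L 1" using psd_square [OF psd, of 1] by simp
  have "\<exists>\<nu>. finite_measure \<nu> \<and> sets \<nu> = sets (PiM \<Omega> (\<lambda>_. borel)) \<and>
    (\<forall>js. set js \<subseteq> \<Omega> \<longrightarrow> integrable \<nu> (\<lambda>x. poly_eval x (restrict_vars \<Omega> (prod_list (map poly_var js)))) \<and>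
      (\<integral>x. poly_eval x (restrict_vars \<Omega> (prod_list (map poly_var js))) \<partial>\<nu>) = L (prod_list (map poly_var js)))"
  proof (cases "L 1 = 0")
    case True
    have "L f = 0" for f using psd_cauchy_schwarz [OF psd, of f 1] True by simp
    then show ?thesis
      by (intro exI [of _ "null_measure (PiM \<Omega> (\<lambda>_. borel))"]) (simp add: finite_measureI poly.ev_measurable)
  next
    case False
    define c where "c = L 1"
    have c: "0 < c" using L1 False by (simp add: c_def)
    define L' where "L' f = L f / c" for f
    have "linear L'" unfolding L'_def using lin by (auto intro!: linearI simp: linear_add linear_scale add_divide_distrib)
    then have psd': "psd_functional L'"
      using psd c by (auto simp: psd_functional_def L'_def)
    have L': "carleman_functional (poly_var ` \<Omega>) L'"
    proof (rule carleman_functional_dominated [OF L psd', where W = "(1 / c) *\<^sub>R 1"])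
      show "L' (g * g) \<le> L ((1 / c) *\<^sub>R 1 * (g * g))" for g
        by (simp add: L'_def linear_scale [OF lin])
    qed
    have L'1: "L' 1 = 1" using c by (simp add: L'_def c_def)
    obtain \<nu> where \<nu>: "prob_space \<nu>" "sets \<nu> = sets (PiM \<Omega> (\<lambda>_. borel))"
      "\<And>J. finite J \<Longrightarrow> J \<subseteq> \<Omega> \<times> UNIV \<Longrightarrow> emeasure \<nu> (half_lines \<Omega> J) = ennreal (half_line_cuts poly_var \<Omega> J L' 1)"
      by (rule coordinate_measure [OF L' L'1]; rule that)
    interpret prob_space \<nu> by fact
    note mom = poly.moments_of_half_lines [OF L' \<nu>(2) finite_measure_axioms \<nu>(3)]
    show ?thesis
    proof (intro exI [of _ "density \<nu> (\<lambda>_. ennreal c)"] conjI allI impI)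
      show "finite_measure (density \<nu> (\<lambda>_. ennreal c))"
        by (intro finite_measureI) (simp add: emeasure_density_const ennreal_mult_eq_top_iff)
      show "sets (density \<nu> (\<lambda>_. ennreal c)) = sets (PiM \<Omega> (\<lambda>_. borel))" using \<nu>(2) by simp
      fix js assume js: "set js \<subseteq> \<Omega>"
      let ?f = "\<lambda>x. poly_eval x (restrict_vars \<Omega> (prod_list (map poly_var js)))"
      note m = mom [OF _ _ js]
      have meas: "?f \<in> borel_measurable \<nu>" using m(1) by simp
      show "integrable (density \<nu> (\<lambda>_. ennreal c)) ?f"
        using m(1) c meas by (subst integrable_density) auto
      have "(\<integral>x. ?f x \<partial>density \<nu> (\<lambda>_. ennreal c)) = c * (\<integral>x. ?f x \<partial>\<nu>)"
        using c meas by (subst integral_density) auto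
      also have "\<dots> = L (prod_list (map poly_var js))" using m(2) c by (simp add: L'_def)
      finally show "(\<integral>x. ?f x \<partial>density \<nu> (\<lambda>_. ennreal c)) = L (prod_list (map poly_var js))" .
    qed
  qed
  then obtain \<nu> where \<nu>: "finite_measure \<nu>" "sets \<nu> = sets (PiM \<Omega> (\<lambda>_. borel))"
    and mom: "\<And>js. set js \<subseteq> \<Omega> \<Longrightarrow> integrable \<nu> (\<lambda>x. poly_eval x (restrict_vars \<Omega> (prod_list (map poly_var js)))) \<and>
      (\<integral>x. poly_eval x (restrict_vars \<Omega> (prod_list (map poly_var js))) \<partial>\<nu>) = L (prod_list (map poly_var js))"
    by blast
  have "integrable \<nu> (\<lambda>x. poly_eval x f) \<and> (\<integral>x. poly_eval x f \<partial>\<nu>) = L f" if "f \<in> poly_alg \<Omega>" for f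
    using that
  proof (rule poly_alg_induct)
    fix m :: "'i \<Rightarrow>\<^sub>0 nat" assume m: "Poly_Mapping.keys m \<subseteq> \<Omega>"
    obtain js where js: "set js \<subseteq> \<Omega>" "prod_list (map poly_var js) = Poly_Mapping.single m (1 :: real)"
      by (rule monomial_prod_list [OF m])
    show "integrable \<nu> (\<lambda>x. poly_eval x (Poly_Mapping.single m 1)) \<and>
      (\<integral>x. poly_eval x (Poly_Mapping.single m 1) \<partial>\<nu>) = L (Poly_Mapping.single m 1)"
      using mom [OF js(1)] by (simp only: js(2) restrict_vars_id [OF monomial_in_poly_alg [OF m]])
  qed (simp_all add: poly_eval_add poly_eval_scaleR poly_eval_zero linear_add [OF lin] linear_scale [OF lin] linear_0 [OF lin])
  then show thesis using that [OF \<nu>] by blast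
qed

theorem proposition4p8:
  fixes \<Omega> :: "'i set" and L :: "'i rpoly \<Rightarrow> real"
  assumes "linear_functional_on (poly_alg \<Omega>) L"
    and "psd_on (poly_alg \<Omega>) L"
    and "\<And>j. j \<in> \<Omega> \<Longrightarrow> carleman L j"
  shows "\<exists>!\<nu>. constructibly_radon_power \<Omega> \<nu> \<and>
           (\<forall>f\<in>poly_alg \<Omega>. L f = moment_functional \<nu> f)"
proof (rule ex_ex1I)
  let ?L = "\<lambda>f. L (restrict_vars \<Omega> f)"
  have L: "carleman_functional (poly_var ` \<Omega>) ?L"
    by (rule carleman_functional_restrict_vars) (fact assms)+
  show "\<exists>\<nu>. constructibly_radon_power \<Omega> \<nu> \<and> (\<forall>f\<in>poly_alg \<Omega>. L f = moment_functional \<nu> f)"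
  proof -
    obtain \<nu> where \<nu>: "finite_measure \<nu>" "sets \<nu> = sets (PiM \<Omega> (\<lambda>_. borel))"
      "\<And>f. f \<in> poly_alg \<Omega> \<Longrightarrow> integrable \<nu> (\<lambda>x. poly_eval x f)"
      "\<And>f. f \<in> poly_alg \<Omega> \<Longrightarrow> (\<integral>x. poly_eval x f \<partial>\<nu>) = ?L f"
      by (rule exists_representing_measure [OF L]; rule that)
    have "constructibly_radon (poly_alg \<Omega>) (distr \<nu> (constructible_borel (poly_alg \<Omega>)) (point_character \<Omega>))"
      by (intro constructibly_radon_finite finite_measureI emeasure_distr_finite \<nu>(1)) simp
    moreover have "\<forall>f\<in>monomials \<Omega>. integrable \<nu> (\<lambda>x. poly_eval x f)"
      using \<nu>(3) monomial_in_poly_alg by (auto simp: monomials_def)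
    ultimately have "constructibly_radon_power \<Omega> \<nu>"
      unfolding constructibly_radon_power_def sets_power_space using \<nu>(2) by blast
    moreover have "\<forall>f\<in>poly_alg \<Omega>. L f = moment_functional \<nu> f"
      using \<nu>(4) by (simp add: moment_functional_def restrict_vars_id)
    ultimately show ?thesis by blast
  qed
  fix \<nu> \<nu>'
  assume \<nu>: "constructibly_radon_power \<Omega> \<nu> \<and> (\<forall>f\<in>poly_alg \<Omega>. L f = moment_functional \<nu> f)"
    and \<nu>': "constructibly_radon_power \<Omega> \<nu>' \<and> (\<forall>f\<in>poly_alg \<Omega>. L f = moment_functional \<nu>' f)"
  \<comment> \<open>The half-line masses of any representing measure depend on \<open>L\<close>
    only, and half-lines form an intersection-stable generator.\<close>
  have *: "sets \<rho> = sets (PiM \<Omega> (\<lambda>_. borel)) \<and> finite_measure \<rho> \<and>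
      (\<forall>J. finite J \<longrightarrow> J \<subseteq> \<Omega> \<times> UNIV \<longrightarrow> emeasure \<rho> (half_lines \<Omega> J) = ennreal (half_line_cuts poly_var \<Omega> J ?L 1))"
    if \<rho>: "constructibly_radon_power \<Omega> \<rho> \<and> (\<forall>f\<in>poly_alg \<Omega>. L f = moment_functional \<rho> f)" for \<rho>
  proof -
    have sets: "sets \<rho> = sets (PiM \<Omega> (\<lambda>_. borel))"
      and mono: "\<And>m. Poly_Mapping.keys m \<subseteq> \<Omega> \<Longrightarrow> integrable \<rho> (\<lambda>x. poly_eval x (Poly_Mapping.single m 1))"
      using \<rho> by (auto simp: constructibly_radon_power_def sets_power_space monomials_def)
    have int: "integrable \<rho> (\<lambda>x. poly_eval x f)" if "f \<in> poly_alg \<Omega>" for f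
      using that by (rule poly_alg_induct) (simp_all add: mono poly_eval_add poly_eval_scaleR poly_eval_zero)
    \<comment> \<open>The empty monomial is the constant 1, so finite moments include finite total
      mass.\<close>
    have "integrable \<rho> (\<lambda>x. poly_eval x (Poly_Mapping.single 0 1))" by (rule mono) simp
    then have "finite_measure \<rho>"
      by (intro finite_measureI) (simp add: poly_eval_one integrable_iff_bounded)
    moreover have "emeasure \<rho> (half_lines \<Omega> J) = ennreal (half_line_cuts poly_var \<Omega> J ?L 1)"
      if "finite J" "J \<subseteq> \<Omega> \<times> UNIV" for J
    proof (rule poly.half_lines_of_moments [OF L sets _ _ that])
      show "integrable \<rho> (\<lambda>x. poly_eval x (restrict_vars \<Omega> f))" for f
        by (rule int [OF restrict_vars_in_poly_alg])
      show "(\<integral>x. poly_eval x (restrict_vars \<Omega> f) \<partial>\<rho>) = ?L f" for f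
        using \<rho> restrict_vars_in_poly_alg [of \<Omega> f] by (simp add: moment_functional_def)
    qed
    ultimately show ?thesis using sets by blast
  qed
  show "\<nu> = \<nu>'"
    by (rule measure_eqI_half_lines [of _ \<Omega>]) (use * [OF \<nu>] * [OF \<nu>'] in simp_all)
qed

end
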